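(* Consider the Cauchy problem on the torus $\mathbb{S}^1$ $$ f_t + \Lambda^3 f = \partial_x \left( [\![\mathcal{H}, f]\!]\, \Lambda^3 f \right), \qquad f|_{t=0} = f_0 . \tag{P}$$ Given $f_0 \in \dot{H}^{3/2}(\mathbb{S}^1)$ there exists $T = T(f_0) > 0$ such that (P) has a unique solution $f$ in the space $L^4([0,T]; \dot{H}^{9/4}(\mathbb{S}^1))$, and this solution, in addition, satisfies $$ f \in \mathcal{C}([0,T]; \dot{H}^{3/2}(\mathbb{S}^1)) \cap L^2([0,T]; \dot{H}^{3}(\mathbb{S}^1)). $$ Moreover, there exists $\varepsilon_0 > 0$ such that if $\|f_0\|_{\dot{H}^{3/2}} \le \varepsilon_0$, then $T = \infty$ and the solution is global (i.e. (P) has a unique solution $f$ in the space $L^4([0,\infty); \dot{H}^{9/4}(\mathbb{S}^1))$, and this solution, in addition, satisfies $f \in \mathcal{C}([0,\infty); \dot{H}^{3/2}(\mathbb{S}^1)) \cap L^2([0,\infty); \dot{H}^{3}(\mathbb{S}^1))$).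
   Context: The space domain is the one-dimensional torus $\mathbb{S}^1 = \mathbb{R}/2\pi\mathbb{Z}$. For a distribution $v$ on $\mathbb{S}^1$ the Fourier coefficients are $\hat v(n) = \frac{1}{2\pi}\int_{-\pi}^{\pi} v(x) e^{-inx}\,dx$, $n\in\mathbb{Z}$ (understood as a duality pairing). The Hilbert transform $\mathcal{H}$ is the Fourier multiplier $\widehat{\mathcal{H}v}(n) = -i\,\mathrm{sgn}(n)\hat v(n)$, with $\mathrm{sgn}(0)=0$. The Calderón operator is $\Lambda = \mathcal{H}\partial_x$, i.e. $\widehat{\Lambda v}(n) = |n|\hat v(n)$, and $\Lambda^s$ is the multiplier $|n|^s$. The commutator is $[\![A,B]\!]g = A(Bg) - B(Ag)$; here $f$ in $[\![\mathcal{H},f]\!]$ denotes the operator of multiplication by $f$, so $[\![\mathcal{H},f]\!]g = \mathcal{H}(fg) - f\,\mathcal{H}g$. For $s\in\mathbb{R}$, $\dot{H}^s = \dot H^s(\mathbb{S}^1)$ is the space of zero-average distributions $v$ on $\mathbb{S}^1$ with $\Lambda^s v \in L^2$, with norm $\|v\|_{\dot{H}^s}^2 = \sum_{n} |n|^{2s}|\hat v(n)|^2$. Solving (P) on $[0,T]$ is understood as solving the integral (Duhamel) equation $$ f(x,t) = e^{-t\Lambda^3} f_0(x) + \int_0^t e^{-(t-t')\Lambda^3}\, \partial_x\left([\![\mathcal{H},f]\!]\Lambda^3 f\right)(x,t')\,dt', \qquad (x,t)\in\mathbb{S}^1\times[0,T], $$ where $e^{-t\Lambda^3}$ is the Fourier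 multiplier $e^{-t|n|^3}$. *)

theory Defs
  imports "HOL-Analysis.Analysis"
begin

section \<open>Distributions on the torus\<close>

definition deriv_fun :: "(real \<Rightarrow> complex) \<Rightarrow> real \<Rightarrow> complex" where
  "deriv_fun \<phi> = (\<lambda>x. vector_derivative \<phi> (at x))"

text \<open>Functions on \<open>\<real> / 2\<pi>\<int>\<close> are \<open>2\<pi>\<close>-periodic functions on \<open>\<real>\<close>.\<close>

definition test_functions :: "(real \<Rightarrow> complex) set" where
  "test_functions =
     {\<phi>. (\<forall>x. \<phi> (x + 2 * pi) = \<phi> x) \<and> (\<forall>k x. (deriv_fun ^^ k) \<phi> differentiable (at x))}"

definition sup_norm :: "(real \<Rightarrow> complex) \<Rightarrow> real" where
  "sup_norm \<phi> = (SUP x. norm (\<phi> x))"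

text \<open>Distributions are the linear functionals on the test functions that are continuous for
  the \<open>C\<^sup>\<infinity>\<close> topology. The first condition is a normalisation: functionals are total functions in
  HOL, and without it one distribution would have many representatives.\<close>

definition is_distribution :: "((real \<Rightarrow> complex) \<Rightarrow> complex) \<Rightarrow> bool" where
  "is_distribution u \<longleftrightarrow>
     (\<forall>\<phi>. \<phi> \<notin> test_functions \<longrightarrow> u \<phi> = 0) \<and>
     (\<forall>\<phi>\<in>test_functions. \<forall>\<psi>\<in>test_functions. u (\<lambda>x. \<phi> x + \<psi> x) = u \<phi> + u \<psi>) \<and>
     (\<forall>c. \<forall>\<phi>\<in>test_functions. u (\<lambda>x. c * \<phi> x) = c * u \<phi>) \<and>
     (\<exists>C N. \<forall>\<phi>\<in>test_functions. norm (u \<phi>) \<le> C * (\<Sum>k\<le>N. sup_norm ((deriv_fun ^^ k) \<phi>)))"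

typedef torus_distribution = "{u. is_distribution u}"
  morphisms pairing Abs_distribution
proof
  show "(\<lambda>_. 0) \<in> {u. is_distribution u}"
    by (auto simp: is_distribution_def intro!: exI[of _ 0])
qed

instantiation torus_distribution :: minus
begin

definition minus_torus_distribution ::
    "torus_distribution \<Rightarrow> torus_distribution \<Rightarrow> torus_distribution" where
  "u - v = Abs_distribution (\<lambda>\<phi>. pairing u \<phi> - pairing v \<phi>)"

instance ..

end

definition dist_deriv :: "torus_distribution \<Rightarrow> torus_distribution" where
  "dist_deriv u = Abs_distribution
     (\<lambda>\<phi>. if \<phi> \<in> test_functions then - pairing u (deriv_fun \<phi>) else 0)"

definition fourier_coeff :: "torus_distribution \<Rightarrow> int \<Rightarrow> complex" where
  "fourier_coeff v n = pairing v (\<lambda>x. exp (- (\<i> * of_int n * of_real x))) / (2 * pi)"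

text \<open>A distribution is determined by its Fourier coefficients, and the sequences that occur as
  Fourier coefficients are exactly those of at most polynomial growth. For other sequences the
  value below is unspecified.\<close>

definition dist_of_coeffs :: "(int \<Rightarrow> complex) \<Rightarrow> torus_distribution" where
  "dist_of_coeffs a = (THE v. \<forall>n. fourier_coeff v n = a n)"


section \<open>Fourier multipliers, products and commutators\<close>

definition fourier_multiplier :: "(int \<Rightarrow> complex) \<Rightarrow> torus_distribution \<Rightarrow> torus_distribution" where
  "fourier_multiplier m v = dist_of_coeffs (\<lambda>n. m n * fourier_coeff v n)"

definition hilbert_transform :: "torus_distribution \<Rightarrow> torus_distribution" where
  "hilbert_transform = fourier_multiplier (\<lambda>n. - \<i> * of_int (sgn n))"

text \<open>Since \<open>0 powr s = 0\<close> for every \<open>s\<close>, the zero mode is always annihilated. This only matters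
  for \<open>s \<le> 0\<close>.\<close>

definition Lambda_pow :: "real \<Rightarrow> torus_distribution \<Rightarrow> torus_distribution" where
  "Lambda_pow s = fourier_multiplier (\<lambda>n. of_real (\<bar>real_of_int n\<bar> powr s))"

definition heat_semigroup :: "real \<Rightarrow> torus_distribution \<Rightarrow> torus_distribution" where
  "heat_semigroup t = fourier_multiplier (\<lambda>n. of_real (exp (- t * \<bar>real_of_int n\<bar> ^ 3)))"

text \<open>The product of two distributions, through the convolution of their Fourier coefficients. It
  is meaningful when the convolution series converge absolutely and grow at most polynomially;
  this covers \<open>u \<in> H\<^sup>r\<close>, \<open>v \<in> H\<^sup>-\<^sup>r\<close> with \<open>r \<ge> 0\<close> (the unique continuous extension of the
  pointwise product), hence \<open>f \<cdot> \<Lambda>\<^sup>3 f\<close> for \<open>f \<in> H\<^sup>9\<^sup>/\<^sup>4\<close>.\<close>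

definition dist_mult :: "torus_distribution \<Rightarrow> torus_distribution \<Rightarrow> torus_distribution" where
  "dist_mult u v =
     dist_of_coeffs (\<lambda>n. \<Sum>\<^sub>\<infinity>k\<in>UNIV. fourier_coeff u (n - k) * fourier_coeff v k)"

definition commutator ::
    "(torus_distribution \<Rightarrow> torus_distribution) \<Rightarrow> (torus_distribution \<Rightarrow> torus_distribution) \<Rightarrow>
     torus_distribution \<Rightarrow> torus_distribution" where
  "commutator A B g = A (B g) - B (A g)"

definition nonlinearity :: "torus_distribution \<Rightarrow> torus_distribution" where
  "nonlinearity f =
     dist_deriv (commutator hilbert_transform (dist_mult f) (Lambda_pow 3 f))"


section \<open>Function spaces\<close>

definition is_L2 :: "torus_distribution \<Rightarrow> bool" where
  "is_L2 v \<longleftrightarrow>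
     (\<exists>h. h \<in> borel_measurable (lebesgue_on {-pi..pi}) \<and>
          integrable (lebesgue_on {-pi..pi}) (\<lambda>x. (norm (h x))\<^sup>2) \<and>
          (\<forall>\<phi>\<in>test_functions.
             pairing v \<phi> = integral\<^sup>L (lebesgue_on {-pi..pi}) (\<lambda>x. h x * \<phi> x)))"

definition Hdot :: "real \<Rightarrow> torus_distribution set" where
  "Hdot s = {v. fourier_coeff v 0 = 0 \<and> is_L2 (Lambda_pow s v)}"

definition Hdot_norm :: "real \<Rightarrow> torus_distribution \<Rightarrow> real" where
  "Hdot_norm s v =
     sqrt (\<Sum>\<^sub>\<infinity>n\<in>UNIV. \<bar>real_of_int n\<bar> powr (2 * s) * (norm (fourier_coeff v n))\<^sup>2)"

text \<open>The Bochner space \<open>L\<^sup>p(I; H\<^sup>s)\<close>, as a set of functions rather than of classes of functions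
  equal almost everywhere. The simple functions witness strong measurability.\<close>

definition Lp_Hdot :: "nat \<Rightarrow> real set \<Rightarrow> real \<Rightarrow> (real \<Rightarrow> torus_distribution) set" where
  "Lp_Hdot p I s =
     {f. (AE t in lebesgue_on I. f t \<in> Hdot s) \<and>
         (\<exists>F :: nat \<Rightarrow> real \<Rightarrow> torus_distribution.
            (\<forall>j. simple_function (lebesgue_on I) (F j) \<and> (\<forall>t\<in>I. F j t \<in> Hdot s)) \<and>
            (AE t in lebesgue_on I. (\<lambda>j. Hdot_norm s (F j t - f t)) \<longlonglongrightarrow> 0)) \<and>
         integrable (lebesgue_on I) (\<lambda>t. Hdot_norm s (f t) ^ p)}"

definition C_Hdot :: "real set \<Rightarrow> real \<Rightarrow> (real \<Rightarrow> torus_distribution) set" where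
  "C_Hdot I s =
     {f. (\<forall>t\<in>I. f t \<in> Hdot s) \<and>
         (\<forall>t\<in>I. ((\<lambda>t'. Hdot_norm s (f t' - f t)) \<longlongrightarrow> 0) (at t within I))}"


section \<open>The integral equation\<close>

text \<open>The Duhamel equation at time \<open>t\<close>, as an identity of distributions; the time integral is a
  weak one, that is, it is evaluated after pairing with test functions.\<close>

definition duhamel ::
    "torus_distribution \<Rightarrow> (real \<Rightarrow> torus_distribution) \<Rightarrow> real \<Rightarrow> bool" where
  "duhamel f0 f t \<longleftrightarrow>
     (\<forall>\<phi>\<in>test_functions.
        integrable (lebesgue_on {0..t})
          (\<lambda>t'. pairing (heat_semigroup (t - t') (nonlinearity (f t'))) \<phi>) \<and>
        pairing (f t) \<phi> =
          pairing (heat_semigroup t f0) \<phi> +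
          integral\<^sup>L (lebesgue_on {0..t})
            (\<lambda>t'. pairing (heat_semigroup (t - t') (nonlinearity (f t'))) \<phi>))"

end

theory Submission
  imports Defs
begin

text \<open>
  In Fourier variables the commutator keeps only the interactions of frequencies \<open>n\<close> and \<open>k\<close> of
  opposite sign, where \<open>\<bar>n - k\<bar> = \<bar>n\<bar> + \<bar>k\<bar>\<close> dominates both. One application of Cauchy-Schwarz therefore
  bounds the nonlinearity from \<open>H\<^sup>9\<^sup>/\<^sup>4 \<times> H\<^sup>9\<^sup>/\<^sup>4\<close> to \<open>L\<^sup>2\<close>. The Duhamel operator maps \<open>L\<^sup>2\<^sub>t L\<^sup>2\<close> to
  \<open>C\<^sub>t H\<^sup>3\<^sup>/\<^sup>2 \<inter> L\<^sup>2\<^sub>t H\<^sup>3\<close>, which by interpolation lies in \<open>L\<^sup>4\<^sub>t H\<^sup>9\<^sup>/\<^sup>4\<close>, so the fixed-point problem is closed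
  in the critical space as soon as the \<open>L\<^sup>4\<^sub>t H\<^sup>9\<^sup>/\<^sup>4\<close> norm of the free evolution is small. That norm is at
  most the \<open>H\<^sup>3\<^sup>/\<^sup>2\<close> norm of the data on the half-line, and it tends to \<open>0\<close> with the length of the interval.

  The symbol of the nonlinearity is nonnegative, so the Picard iteration with data \<open>\<bar>b\<bar>\<close> increases to a
  finite limit whose increments dominate those of the iteration with data \<open>b\<close>. Convergence is thus
  obtained frequency by frequency, by monotone and dominated convergence, without completeness of
  the Bochner space.
\<close>


section \<open>Test functions and trigonometric modes\<close>

text \<open>The nonlinearity carries four derivatives. If a low frequency \<open>n - k\<close> could
  interact with high \<open>n\<close> and \<open>k\<close>, all four would fall on the factor of
  frequency \<open>k\<close>, which has only \<open>9/4\<close>; opposite signs exclude this case.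
  The remaining estimate is scale invariant, so shortening the interval gains no power of its
  length: the existence time found here depends on the datum itself and not only on its norm, and
  uniqueness among large solutions has to come from absolute continuity of the time integral,
  applied on successive short intervals.

  Majorants take values in \<open>ennreal\<close>, so that sums and integrals may be exchanged and
  compared before anything is known to be finite. Finiteness is read off afterwards: for almost
  every time from the \<open>L^4\<close> bound in time, and for every time and frequency from the
  supremum bound of the Duhamel integral. Passing to moduli loses nothing because the norms involved
  depend on the moduli of the coefficients only. Squares and fourth powers of norms replace the
  norms themselves, which avoids roots in \<open>ennreal\<close>.\<close>

definition fmode :: "int \<Rightarrow> real \<Rightarrow> complex" where
  "fmode n x = exp (\<i> * of_int n * of_real x)"

lemma fmode_0 [simp]: "fmode 0 x = 1"
  by (simp add: fmode_def)

lemma fmode_mult: "fmode m x * fmode n x = fmode (m + n) x"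
  by (simp add: fmode_def exp_add [symmetric] algebra_simps)

lemma fmode_at_neg: "fmode n (- x) = fmode (- n) x"
  by (simp add: fmode_def)

lemma fmode_add_arg: "fmode n (x + y) = fmode n x * fmode n y"
  by (simp add: fmode_def exp_add [symmetric] algebra_simps)

lemma norm_fmode [simp]: "norm (fmode n x) = 1"
  using norm_exp_i_times [of "of_int n * x"] by (simp add: fmode_def mult.assoc)

lemma cnj_fmode: "cnj (fmode n x) = fmode (- n) x"
  by (simp add: fmode_def exp_cnj)

lemma fmode_2pi: "fmode n (2 * pi) = 1"
proof -
  have "\<i> * of_int n * of_real (2 * pi) = of_int (2 * n) * (of_real pi * \<i>)"
    by (simp add: algebra_simps)
  then show ?thesis unfolding fmode_def
    using exp_integer_2pi [of "of_int n"] by (simp add: algebra_simps)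
qed

lemma fmode_periodic: "fmode n (x + 2 * pi) = fmode n x"
  by (simp add: fmode_add_arg fmode_2pi)

lemma fmode_has_vector_derivative:
  "(fmode n has_vector_derivative (\<i> * of_int n * fmode n x)) (at x within S)"
proof -
  have "((\<lambda>z. exp (\<i> * of_int n * z)) has_field_derivative
      (\<i> * of_int n * exp (\<i> * of_int n * of_real x))) (at (of_real x))"
    by (auto intro!: derivative_eq_intros)
  moreover have "(of_real has_vector_derivative 1) (at x within S)"
    by (auto intro!: derivative_eq_intros)
  ultimately have "((\<lambda>z. exp (\<i> * of_int n * z)) \<circ> of_real has_vector_derivative
      (1 * (\<i> * of_int n * exp (\<i> * of_int n * of_real x)))) (at x within S)"
    by (intro field_vector_diff_chain_within) (auto intro: has_field_derivative_at_within)
  then show ?thesis by (simp add: fmode_def [abs_def] o_def)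
qed

lemma continuous_on_fmode [continuous_intros]: "continuous_on S (fmode n)"
  unfolding fmode_def by (intro continuous_intros)

lemma cmult_fmode_vector_derivative:
  "((\<lambda>x. c * fmode n x) has_vector_derivative (c * (\<i> * of_int n) * fmode n x)) (at x within S)"
  using has_vector_derivative_mult_right [OF fmode_has_vector_derivative [of n x S], of c]
  by (simp add: mult.assoc)

lemma deriv_fun_cmult_fmode:
  "deriv_fun (\<lambda>x. c * fmode n x) = (\<lambda>x. c * (\<i> * of_int n) * fmode n x)"
  unfolding deriv_fun_def
  by (rule ext, rule vector_derivative_at, rule cmult_fmode_vector_derivative)

lemma deriv_fun_funpow_fmode:
  "(deriv_fun ^^ k) (\<lambda>x. c * fmode n x) = (\<lambda>x. c * (\<i> * of_int n) ^ k * fmode n x)"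
proof (induction k)
  case (Suc k)
  then show ?case
    using deriv_fun_cmult_fmode [of "c * (\<i> * of_int n) ^ k" n] by (simp add: algebra_simps)
qed simp

lemma cmult_fmode_test_function: "(\<lambda>x. c * fmode n x) \<in> test_functions"
proof -
  have "(\<lambda>x. c * (\<i> * of_int n) ^ k * fmode n x) differentiable (at x)" for k x
    using cmult_fmode_vector_derivative by (rule differentiableI_vector)
  then show ?thesis
    by (simp add: test_functions_def deriv_fun_funpow_fmode fmode_periodic)
qed

lemma fmode_test_function: "fmode n \<in> test_functions"
  using cmult_fmode_test_function [of 1 n] by simp

lemma test_functions_periodic: "\<phi> \<in> test_functions \<Longrightarrow> \<phi> (x + 2 * pi) = \<phi> x"
  by (simp add: test_functions_def)

lemma test_functions_differentiable: "\<phi> \<in> test_functions \<Longrightarrow> \<phi> differentiable (at x)"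
  unfolding test_functions_def using funpow_0 by (metis (mono_tags, lifting) mem_Collect_eq)

lemma test_functions_derivative:
  "\<phi> \<in> test_functions \<Longrightarrow> (\<phi> has_vector_derivative deriv_fun \<phi> x) (at x within S)"
  by (metis deriv_fun_def has_vector_derivative_at_within test_functions_differentiable
      vector_derivative_works)

lemma test_functions_continuous: "\<phi> \<in> test_functions \<Longrightarrow> continuous_on S \<phi>"
  by (metis continuous_at_imp_continuous_on differentiable_imp_continuous_within
      test_functions_differentiable)

lemma deriv_fun_test_function:
  assumes "\<phi> \<in> test_functions" shows "deriv_fun \<phi> \<in> test_functions"
proof -
  have per: "deriv_fun \<phi> (x + 2 * pi) = deriv_fun \<phi> x" for x
  proof -
    have "((\<phi> \<circ> (\<lambda>x. x + 2 * pi)) has_vector_derivative (1 *\<^sub>R deriv_fun \<phi> (x + 2 * pi))) (at x)"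
      by (rule vector_diff_chain_at)
        (auto intro!: derivative_eq_intros test_functions_derivative assms)
    moreover have "\<phi> \<circ> (\<lambda>x. x + 2 * pi) = \<phi>"
      using test_functions_periodic [OF assms] by auto
    ultimately show ?thesis
      using vector_derivative_at by (fastforce simp: deriv_fun_def)
  qed
  have "(deriv_fun ^^ k) (deriv_fun \<phi>) differentiable (at x)" for k x
  proof -
    have "(deriv_fun ^^ Suc k) \<phi> differentiable (at x)"
      using assms unfolding test_functions_def by blast
    then show ?thesis by (simp only: funpow_Suc_right o_apply)
  qed
  with per show ?thesis by (simp add: test_functions_def)
qed

lemma deriv_fun_funpow_test_function:
  "\<phi> \<in> test_functions \<Longrightarrow> (deriv_fun ^^ k) \<phi> \<in> test_functions"
  by (induction k) (simp_all add: deriv_fun_test_function)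

lemma test_functions_funpow_lincomb:
  assumes "\<phi> \<in> test_functions" "\<psi> \<in> test_functions"
  shows "(deriv_fun ^^ k) (\<lambda>x. c * \<phi> x + d * \<psi> x) =
    (\<lambda>x. c * (deriv_fun ^^ k) \<phi> x + d * (deriv_fun ^^ k) \<psi> x)"
proof (induction k)
  case (Suc k)
  have "deriv_fun (\<lambda>x. c * (deriv_fun ^^ k) \<phi> x + d * (deriv_fun ^^ k) \<psi> x) =
    (\<lambda>x. c * deriv_fun ((deriv_fun ^^ k) \<phi>) x + d * deriv_fun ((deriv_fun ^^ k) \<psi>) x)"
    unfolding deriv_fun_def [of "\<lambda>x. c * (deriv_fun ^^ k) \<phi> x + d * (deriv_fun ^^ k) \<psi> x"]
    by (intro ext vector_derivative_at has_vector_derivative_add has_vector_derivative_mult_right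
        test_functions_derivative deriv_fun_funpow_test_function assms)
  with Suc show ?case by simp
qed simp

lemma test_functions_lincomb:
  assumes "\<phi> \<in> test_functions" "\<psi> \<in> test_functions"
  shows "(\<lambda>x. c * \<phi> x + d * \<psi> x) \<in> test_functions"
proof -
  have "(\<lambda>x. c * (deriv_fun ^^ k) \<phi> x + d * (deriv_fun ^^ k) \<psi> x) differentiable (at x)" for k x
    by (intro differentiable_add differentiable_mult differentiable_const
        test_functions_differentiable deriv_fun_funpow_test_function assms)
  then show ?thesis
    using assms by (simp add: test_functions_def test_functions_funpow_lincomb [OF assms])
qed

lemma test_functions_add:
  "\<phi> \<in> test_functions \<Longrightarrow> \<psi> \<in> test_functions \<Longrightarrow> (\<lambda>x. \<phi> x + \<psi> x) \<in> test_functions"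
  using test_functions_lincomb [of \<phi> \<psi> 1 1] by simp

lemma test_functions_cmult:
  "\<phi> \<in> test_functions \<Longrightarrow> (\<lambda>x. c * \<phi> x) \<in> test_functions"
  using test_functions_lincomb [of \<phi> \<phi> c 0] by simp

lemma test_functions_diff:
  "\<phi> \<in> test_functions \<Longrightarrow> \<psi> \<in> test_functions \<Longrightarrow> (\<lambda>x. \<phi> x - \<psi> x) \<in> test_functions"
  using test_functions_lincomb [of \<phi> \<psi> 1 "-1"] by simp

lemma test_functions_funpow_diff:
  assumes "\<phi> \<in> test_functions" "\<psi> \<in> test_functions"
  shows "(deriv_fun ^^ k) (\<lambda>x. \<phi> x - \<psi> x) = (\<lambda>x. (deriv_fun ^^ k) \<phi> x - (deriv_fun ^^ k) \<psi> x)"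
  using test_functions_funpow_lincomb [OF assms, of k 1 "-1"] by simp

lemma zero_test_function: "(\<lambda>x. 0) \<in> test_functions"
  using cmult_fmode_test_function [of 0 0] by simp

section \<open>Periodic reduction and the sup norm\<close>

lemma periodic_shift_int:
  fixes \<phi> :: "real \<Rightarrow> complex"
  assumes "\<And>x. \<phi> (x + 2 * pi) = \<phi> x"
  shows "\<phi> (x + 2 * pi * of_int k) = \<phi> x"
proof (induction k rule: int_induct [where k = 0])
  case (step1 i)
  then show ?case using assms [of "x + 2 * pi * of_int i"] by (simp add: algebra_simps)
next
  case (step2 i)
  then show ?case using assms [of "x + 2 * pi * of_int (i - 1)"] by (simp add: algebra_simps)
qed simp

lemma reduce_mod_2pi:
  obtains k :: int where "x + 2 * pi * of_int k \<in> {-pi..pi}"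
proof
  define k where "k = - \<lfloor>(x + pi) / (2 * pi)\<rfloor>"
  have "of_int (- k) \<le> (x + pi) / (2 * pi)" "(x + pi) / (2 * pi) < of_int (- k) + 1"
    unfolding k_def by simp_all
  then show "x + 2 * pi * of_int k \<in> {-pi..pi}"
    by (simp add: field_simps)
qed

text \<open>The \<open>SUP\<close> of an unbounded set of reals is unspecified, so every use of
  \<open>sup_norm\<close> rests on this. Periodicity reduces the range to one compact
  period.\<close>

lemma test_functions_bdd:
  assumes "\<phi> \<in> test_functions" shows "bdd_above (range (\<lambda>x. norm (\<phi> x)))"
proof -
  have "compact ((\<lambda>x. norm (\<phi> x)) ` {-pi..pi})"
    by (intro compact_continuous_image continuous_intros test_functions_continuous assms) simp
  then have "bdd_above ((\<lambda>x. norm (\<phi> x)) ` {-pi..pi})"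
    by (simp add: bounded_imp_bdd_above compact_imp_bounded)
  moreover have "range (\<lambda>x. norm (\<phi> x)) \<subseteq> (\<lambda>x. norm (\<phi> x)) ` {-pi..pi}"
  proof clarify
    fix x
    obtain k where k: "x + 2 * pi * of_int k \<in> {-pi..pi}" by (rule reduce_mod_2pi)
    then show "norm (\<phi> x) \<in> (\<lambda>x. norm (\<phi> x)) ` {-pi..pi}"
      using periodic_shift_int [of \<phi> x k] test_functions_periodic [OF assms]
      by (metis (mono_tags, lifting) image_eqI)
  qed
  ultimately show ?thesis by (rule bdd_above_mono)
qed

lemma norm_le_sup_norm: "\<phi> \<in> test_functions \<Longrightarrow> norm (\<phi> x) \<le> sup_norm \<phi>"
  unfolding sup_norm_def by (rule cSUP_upper) (auto intro: test_functions_bdd)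

lemma sup_norm_nonneg: "\<phi> \<in> test_functions \<Longrightarrow> 0 \<le> sup_norm \<phi>"
  using norm_le_sup_norm norm_ge_zero order_trans by blast

lemma sup_norm_le: "(\<And>x. norm (\<phi> x) \<le> B) \<Longrightarrow> sup_norm \<phi> \<le> B"
  unfolding sup_norm_def by (rule cSUP_least) auto


section \<open>Fourier coefficients of functions on the torus\<close>

abbreviation torus_measure :: "real measure" where
  "torus_measure \<equiv> lebesgue_on {-pi..pi}"

definition torus_coeff :: "(real \<Rightarrow> complex) \<Rightarrow> int \<Rightarrow> complex" where
  "torus_coeff h n = (LINT x|torus_measure. h x * fmode (- n) x) / (2 * pi)"

lemma continuous_torus_integrable:
  fixes h :: "real \<Rightarrow> 'b::euclidean_space"
  shows "continuous_on UNIV h \<Longrightarrow> integrable torus_measure h"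
  by (rule continuous_imp_integrable_real) (rule continuous_on_subset, auto)

lemma continuous_torus_measurable:
  fixes h :: "real \<Rightarrow> 'b::euclidean_space"
  shows "continuous_on UNIV h \<Longrightarrow> h \<in> borel_measurable torus_measure"
  by (rule borel_measurable_integrable) (rule continuous_torus_integrable)

lemma fmode_measurable [measurable]: "fmode n \<in> borel_measurable torus_measure"
  by (intro continuous_torus_measurable continuous_on_fmode)

lemma integrable_mult_bounded:
  fixes h g :: "'a \<Rightarrow> complex"
  assumes "integrable M h" "g \<in> borel_measurable M" "\<And>x. norm (g x) \<le> C"
  shows "integrable M (\<lambda>x. h x * g x)"
proof (rule Bochner_Integration.integrable_bound)
  show "integrable M (\<lambda>x. of_real C * h x)" using assms by simp
  have "norm (h x * g x) \<le> norm (of_real C * h x)" for x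
    unfolding norm_mult by (subst mult.commute, rule mult_right_mono)
      (use assms(3) [of x] in simp_all)
  then show "AE x in M. norm (h x * g x) \<le> norm (of_real C * h x)" by simp
qed (use assms in measurable)

lemma integral_torus_FTC:
  assumes "\<And>x. (\<Phi> has_vector_derivative h x) (at x)" "continuous_on UNIV h"
  shows "(LINT x|torus_measure. h x) = (\<Phi> pi - \<Phi> (- pi) :: complex)"
proof -
  have "integral\<^sup>L torus_measure h = integral {-pi..pi} h"
    by (rule lebesgue_integral_eq_integral) (auto intro: continuous_torus_integrable assms)
  also have "\<dots> = \<Phi> pi - \<Phi> (- pi)"
    by (rule integral_unique, rule fundamental_theorem_of_calculus)
      (auto intro: has_vector_derivative_at_within assms)
  finally show ?thesis .
qed

lemma periodic_at_pi: "(\<And>x. \<Phi> (x + 2 * pi) = \<Phi> x) \<Longrightarrow> \<Phi> pi = (\<Phi> (- pi) :: complex)"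
proof -
  assume "\<And>x. \<Phi> (x + 2 * pi) = \<Phi> x"
  from this [of "- pi"] show ?thesis by simp
qed

lemma integral_deriv_fun_eq_0:
  assumes "\<phi> \<in> test_functions" shows "(LINT x|torus_measure. deriv_fun \<phi> x) = 0"
proof -
  have "(LINT x|torus_measure. deriv_fun \<phi> x) = \<phi> pi - \<phi> (- pi)"
    by (rule integral_torus_FTC)
      (auto intro: test_functions_derivative test_functions_continuous deriv_fun_test_function assms)
  then show ?thesis
    using periodic_at_pi [of \<phi>] test_functions_periodic [OF assms] by simp
qed

lemma integral_fmode: "(LINT x|torus_measure. fmode n x) = (if n = 0 then 2 * pi else 0)"
proof (cases "n = 0")
  case True
  then show ?thesis by (simp add: measure_restrict_space scaleR_conv_of_real)
next
  case False
  \<comment> \<open>A nonzero mode is the derivative of a periodic function.\<close>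
  have "deriv_fun (\<lambda>x. 1 / (\<i> * of_int n) * fmode n x) = fmode n"
    using False by (simp only: deriv_fun_cmult_fmode) (simp add: field_simps)
  with integral_deriv_fun_eq_0 [OF cmult_fmode_test_function [of "1 / (\<i> * of_int n)" n]] False
  show ?thesis by simp
qed

lemma torus_coeff_lincomb_fmode:
  assumes "finite F"
  shows "torus_coeff (\<lambda>x. \<Sum>n\<in>F. c n * fmode n x) m = (if m \<in> F then c m else 0)"
proof -
  have "(LINT x|torus_measure. (\<Sum>n\<in>F. c n * fmode n x) * fmode (- m) x) =
    (LINT x|torus_measure. (\<Sum>n\<in>F. c n * fmode (n - m) x))"
    by (simp add: sum_distrib_right mult.assoc fmode_mult)
  also have "\<dots> = (\<Sum>n\<in>F. LINT x|torus_measure. c n * fmode (n - m) x)"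
    by (intro Bochner_Integration.integral_sum continuous_torus_integrable continuous_intros)
  also have "\<dots> = (\<Sum>n\<in>F. if n = m then c n * (2 * pi) else 0)"
    by (intro sum.cong) (auto simp: integral_fmode)
  finally show ?thesis
    using assms by (simp add: torus_coeff_def sum.delta)
qed

text \<open>Integration by parts: the product of \<phi> and the mode is periodic, so its derivative
  integrates to zero over a period.\<close>

lemma torus_coeff_deriv_fun:
  assumes "\<phi> \<in> test_functions"
  shows "torus_coeff (deriv_fun \<phi>) n = \<i> * of_int n * torus_coeff \<phi> n"
proof -
  let ?D = "\<lambda>x. \<phi> x * (\<i> * of_int (- n) * fmode (- n) x) + deriv_fun \<phi> x * fmode (- n) x"
  have c: "continuous_on UNIV \<phi>" "continuous_on UNIV (deriv_fun \<phi>)"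
    by (intro test_functions_continuous deriv_fun_test_function assms)+
  have "(LINT x|torus_measure. ?D x) = (\<lambda>x. \<phi> x * fmode (- n) x) pi - (\<lambda>x. \<phi> x * fmode (- n) x) (- pi)"
    by (rule integral_torus_FTC)
      (intro has_vector_derivative_mult fmode_has_vector_derivative test_functions_derivative
        continuous_intros c assms)+
  also have "\<dots> = 0"
    using periodic_at_pi [of "\<lambda>x. \<phi> x * fmode (- n) x"] test_functions_periodic [OF assms]
    by (simp add: fmode_periodic)
  also have "(LINT x|torus_measure. ?D x) =
      (LINT x|torus_measure. (- \<i> * of_int n) * (\<phi> x * fmode (- n) x)) +
      (LINT x|torus_measure. deriv_fun \<phi> x * fmode (- n) x)"
    by (subst Bochner_Integration.integral_add [symmetric])
      (auto intro!: continuous_torus_integrable continuous_intros c simp: algebra_simps)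
  finally have "(LINT x|torus_measure. deriv_fun \<phi> x * fmode (- n) x) =
      \<i> * of_int n * (LINT x|torus_measure. \<phi> x * fmode (- n) x)"
    by (simp add: add_eq_0_iff)
  then show ?thesis by (simp add: torus_coeff_def)
qed

lemma torus_coeff_deriv_fun_funpow:
  "\<phi> \<in> test_functions \<Longrightarrow>
    torus_coeff ((deriv_fun ^^ k) \<phi>) n = (\<i> * of_int n) ^ k * torus_coeff \<phi> n"
  by (induction k) (simp_all add: torus_coeff_deriv_fun deriv_fun_funpow_test_function)

lemma norm_torus_integral_le:
  fixes h :: "real \<Rightarrow> complex"
  assumes "\<And>x. norm (h x) \<le> B"
  shows "norm (LINT x|torus_measure. h x) \<le> 2 * pi * B"
proof (cases "integrable torus_measure h")
  case True
  have "norm (LINT x|torus_measure. h x) \<le> (LINT x|torus_measure. norm (h x))"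
    by (rule integral_norm_bound)
  also have "\<dots> \<le> (LINT x|torus_measure. B)"
    by (intro integral_mono continuous_torus_integrable continuous_intros assms
        Bochner_Integration.integrable_norm True)
  also have "\<dots> = 2 * pi * B" by (simp add: measure_restrict_space)
  finally show ?thesis .
next
  case False
  \<comment> \<open>The Bochner integral of a nonintegrable function is \<open>0\<close>, so the
    claim reduces to nonnegativity of \<open>B\<close>.\<close>
  have "0 \<le> B" using assms norm_ge_zero order_trans by blast
  with False show ?thesis by (simp add: not_integrable_integral_eq)
qed

lemma norm_torus_coeff_le:
  assumes "\<And>x. norm (h x) \<le> B" shows "norm (torus_coeff h n) \<le> B"
  using norm_torus_integral_le [of "\<lambda>x. h x * fmode (- n) x" B] assms
  by (simp add: torus_coeff_def norm_mult norm_divide field_simps)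

lemma norm_torus_coeff_decay:
  assumes "\<phi> \<in> test_functions"
  shows "\<bar>of_int n\<bar> ^ k * norm (torus_coeff \<phi> n) \<le> sup_norm ((deriv_fun ^^ k) \<phi>)"
  using norm_torus_coeff_le [of "(deriv_fun ^^ k) \<phi>" _ n]
    norm_le_sup_norm deriv_fun_funpow_test_function [OF assms, of k]
  by (simp add: torus_coeff_deriv_fun_funpow [OF assms] norm_mult norm_power)

section \<open>Parseval for trigonometric polynomials and Bessel's inequality\<close>

lemma parseval_trig:
  assumes "finite F"
  shows "(LINT x|torus_measure. (norm (\<Sum>n\<in>F. c n * fmode n x))\<^sup>2) =
    2 * pi * (\<Sum>n\<in>F. (norm (c n))\<^sup>2)"
proof -
  let ?S = "\<lambda>x. \<Sum>n\<in>F. c n * fmode n x"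
  have "complex_of_real (LINT x|torus_measure. (norm (?S x))\<^sup>2) =
      (LINT x|torus_measure. ?S x * cnj (?S x))"
    by (simp only: integral_complex_of_real [symmetric] complex_norm_square)
  also have "\<dots> = (LINT x|torus_measure. (\<Sum>m\<in>F. cnj (c m) * (?S x * fmode (- m) x)))"
    by (intro Bochner_Integration.integral_cong) (simp_all add: sum_distrib_left cnj_fmode mult_ac)
  also have "\<dots> = (\<Sum>m\<in>F. LINT x|torus_measure. cnj (c m) * (?S x * fmode (- m) x))"
    by (intro Bochner_Integration.integral_sum continuous_torus_integrable continuous_intros)
  also have "\<dots> = (\<Sum>m\<in>F. cnj (c m) * (2 * pi * torus_coeff ?S m))"
    by (simp add: torus_coeff_def)
  also have "\<dots> = (\<Sum>m\<in>F. 2 * pi * (c m * cnj (c m)))"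
    by (intro sum.cong) (simp_all add: torus_coeff_lincomb_fmode assms)
  also have "\<dots> = complex_of_real (2 * pi * (\<Sum>n\<in>F. (norm (c n))\<^sup>2))"
    by (simp only: sum_distrib_left of_real_mult of_real_sum complex_norm_square)
  finally show ?thesis by (simp only: of_real_eq_iff)
qed

lemma square_integrable_imp_integrable:
  fixes h :: "real \<Rightarrow> complex"
  assumes [measurable]: "h \<in> borel_measurable torus_measure"
    and "integrable torus_measure (\<lambda>x. (norm (h x))\<^sup>2)"
  shows "integrable torus_measure h"
proof (rule Bochner_Integration.integrable_bound)
  show "integrable torus_measure (\<lambda>x. 1 + (norm (h x))\<^sup>2)"
    by (intro Bochner_Integration.integrable_add assms continuous_torus_integrable continuous_intros)
  have "norm z \<le> 1 + (norm z)\<^sup>2" for z :: complex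
    using sum_squares_bound [of 1 "norm z"] norm_ge_zero [of z]
    by (simp add: power2_eq_square) (smt (verit) norm_ge_zero)
  then show "AE x in torus_measure. norm (h x) \<le> norm (1 + (norm (h x))\<^sup>2)" by auto
qed measurable

text \<open>The squared distance from \<open>h\<close> to its partial sum is nonnegative. Up to the
  factor \<open>2 * pi\<close>, the cross term subtracts twice the sum of the squared coefficients
  and the square of the partial sum adds one copy back.\<close>

lemma bessel_inequality:
  fixes h :: "real \<Rightarrow> complex"
  assumes m [measurable]: "h \<in> borel_measurable torus_measure"
    and sq: "integrable torus_measure (\<lambda>x. (norm (h x))\<^sup>2)" and "finite F"
  shows "2 * pi * (\<Sum>n\<in>F. (norm (torus_coeff h n))\<^sup>2) \<le> (LINT x|torus_measure. (norm (h x))\<^sup>2)"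
proof -
  let ?c = "torus_coeff h"
  let ?S = "\<lambda>x. \<Sum>n\<in>F. ?c n * fmode n x"
  have hi: "integrable torus_measure h" by (rule square_integrable_imp_integrable) fact+
  have he: "integrable torus_measure (\<lambda>x. h x * fmode n x)" for n
    by (rule integrable_mult_bounded [OF hi]) auto
  have hS: "integrable torus_measure (\<lambda>x. \<Sum>n\<in>F. cnj (?c n) * (h x * fmode (- n) x))"
    by (intro Bochner_Integration.integrable_sum) (auto intro: he)
  have S: "integrable torus_measure (\<lambda>x. (norm (?S x))\<^sup>2)"
    by (intro continuous_torus_integrable continuous_intros)
  have cross: "h x * cnj (?S x) = (\<Sum>n\<in>F. cnj (?c n) * (h x * fmode (- n) x))" for x
    by (simp add: sum_distrib_left cnj_fmode mult_ac)
  have "(LINT x|torus_measure. h x * cnj (?S x)) =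
      (\<Sum>n\<in>F. LINT x|torus_measure. cnj (?c n) * (h x * fmode (- n) x))"
    unfolding cross by (intro Bochner_Integration.integral_sum) (auto intro: he)
  also have "\<dots> = (\<Sum>n\<in>F. 2 * pi * (?c n * cnj (?c n)))"
    by (intro sum.cong) (simp_all add: torus_coeff_def)
  also have "\<dots> = complex_of_real (2 * pi * (\<Sum>n\<in>F. (norm (?c n))\<^sup>2))"
    by (simp only: sum_distrib_left of_real_mult of_real_sum complex_norm_square)
  finally have c: "(LINT x|torus_measure. Re (h x * cnj (?S x))) = 2 * pi * (\<Sum>n\<in>F. (norm (?c n))\<^sup>2)"
    using hS by (subst integral_Re) (simp_all only: cross Re_complex_of_real)
  have re: "integrable torus_measure (\<lambda>x. Re (h x * cnj (?S x)))"
    unfolding cross using hS by (rule integrable_Re)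
  have ex: "(norm (h x - ?S x))\<^sup>2 = (norm (h x))\<^sup>2 - 2 * Re (h x * cnj (?S x)) + (norm (?S x))\<^sup>2" for x
    by (simp only: cmod_power2 minus_complex.simps times_complex.simps cnj.simps)
      (simp add: power2_eq_square algebra_simps)
  have "0 \<le> (LINT x|torus_measure. (norm (h x - ?S x))\<^sup>2)" by simp
  also have "\<dots> = (LINT x|torus_measure. (norm (h x))\<^sup>2) - 2 * (2 * pi * (\<Sum>n\<in>F. (norm (?c n))\<^sup>2))
      + 2 * pi * (\<Sum>n\<in>F. (norm (?c n))\<^sup>2)"
    unfolding ex using re sq S
    by (simp only: Bochner_Integration.integral_add Bochner_Integration.integral_diff
        Bochner_Integration.integrable_diff Bochner_Integration.integrable_mult_right
        Bochner_Integration.integral_mult_right c parseval_trig [OF \<open>finite F\<close>])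
  finally show ?thesis by simp
qed


section \<open>Fourier inversion\<close>

text \<open>\<open>has_sum\<close> is unordered, whereas partial sums of Fourier series are taken
  over symmetric intervals; this limit of filters turns the first into the second.\<close>

lemma filterlim_symmetric_intervals:
  "filterlim (\<lambda>N::nat. {- int N..int N}) (finite_subsets_at_top UNIV) sequentially"
  unfolding filterlim_finite_subsets_at_top
proof safe
  fix X :: "int set" assume "finite X"
  show "\<forall>\<^sub>F N in sequentially. finite {- int N..int N} \<and> X \<subseteq> {- int N..int N} \<and> {- int N..int N} \<subseteq> UNIV"
    using eventually_ge_at_top [of "Max (insert 0 ((\<lambda>n. nat \<bar>n\<bar>) ` X))"]
  proof eventually_elim
    case (elim N)
    have "n \<in> {- int N..int N}" if "n \<in> X" for n
    proof -
      have "nat \<bar>n\<bar> \<le> N"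
        using elim that \<open>finite X\<close> by (auto simp: Max_le_iff)
      then show ?thesis by auto
    qed
    then show ?case by auto
  qed
qed

lemma has_sum_imp_symmetric_limit:
  "(f has_sum S) UNIV \<Longrightarrow> (\<lambda>N::nat. \<Sum>n\<in>{- int N..int N}. f n) \<longlonglongrightarrow> S"
  unfolding has_sum_def by (rule filterlim_compose [OF _ filterlim_symmetric_intervals])

lemma square_integrable_torus_coeff_summable:
  fixes h :: "real \<Rightarrow> complex"
  assumes "h \<in> borel_measurable torus_measure" "integrable torus_measure (\<lambda>x. (norm (h x))\<^sup>2)"
  shows "(\<lambda>n. (norm (torus_coeff h n))\<^sup>2) summable_on UNIV"
proof (rule nonneg_bdd_above_summable_on)
  show "bdd_above (sum (\<lambda>n. (norm (torus_coeff h n))\<^sup>2) ` {F. F \<subseteq> UNIV \<and> finite F})"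
  proof (rule bdd_aboveI2)
    fix F :: "int set" assume "F \<in> {F. F \<subseteq> UNIV \<and> finite F}"
    then show "(\<Sum>n\<in>F. (norm (torus_coeff h n))\<^sup>2) \<le> (LINT x|torus_measure. (norm (h x))\<^sup>2) / (2 * pi)"
      using bessel_inequality [OF assms, of F] by (simp add: field_simps)
  qed
qed simp

text \<open>The indices \<open>int N\<close> and \<open>- int N - 1\<close> are the two ends that
  survive in \<open>telescope_int\<close>.\<close>

lemma summable_on_int_imp_tendsto_0:
  fixes f :: "int \<Rightarrow> real"
  assumes "f summable_on UNIV"
  shows "(\<lambda>N. f (int N)) \<longlonglongrightarrow> 0" "(\<lambda>N. f (- int N - 1)) \<longlonglongrightarrow> 0"
proof -
  have "(f \<circ> int) summable_on UNIV"
    using summable_on_subset [OF assms, of "range int"] by (simp add: summable_on_reindex)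
  then show "(\<lambda>N. f (int N)) \<longlonglongrightarrow> 0"
    by (auto dest!: summable_on_imp_summable summable_LIMSEQ_zero simp: o_def)
  have "inj (\<lambda>N. - int N - 1)" by (auto simp: inj_def)
  then have "(f \<circ> (\<lambda>N. - int N - 1)) summable_on UNIV"
    using summable_on_subset [OF assms, of "range (\<lambda>N. - int N - 1)"] by (simp add: summable_on_reindex)
  then show "(\<lambda>N. f (- int N - 1)) \<longlonglongrightarrow> 0"
    by (auto dest!: summable_on_imp_summable summable_LIMSEQ_zero simp: o_def)
qed

text \<open>Compares arc and chord over one period centred at \<open>0\<close>. Small angles use the
  imaginary part \<open>sin\<close>, larger ones the real part \<open>1 - cos\<close>. The constant
  is far from sharp.\<close>

lemma norm_fmode_minus_1_ge:
  assumes "\<bar>x\<bar> \<le> pi" shows "\<bar>x\<bar> \<le> 2 * pi * norm (fmode 1 x - 1)"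
proof -
  have e: "fmode 1 x = cis x" by (simp add: fmode_def cis_conv_exp)
  define y where "y = \<bar>x\<bar>"
  have y: "0 \<le> y" "y \<le> pi" using assms by (auto simp: y_def)
  have re: "1 - cos y \<le> norm (fmode 1 x - 1)"
    using abs_Re_le_cmod [of "fmode 1 x - 1"] by (auto simp: e y_def)
  have im: "sin y \<le> norm (fmode 1 x - 1)"
    using abs_Im_le_cmod [of "fmode 1 x - 1"] by (auto simp: e y_def abs_if split: if_splits)
  show ?thesis
  \<comment> \<open>At \<open>pi / 3\<close> the cosine equals \<open>1 / 2\<close>: below it the
    mean value theorem gives \<open>sin y \<ge> y / 2\<close>, above it
    \<open>1 - cos y \<ge> 1 / 2\<close>.\<close>
  proof (cases "y \<le> pi / 3")
    case True
    show ?thesis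
    proof (cases "y = 0")
      case False
      then obtain z where z: "0 < z" "z < y" "sin y - sin 0 = (y - 0) * cos z"
        using MVT2 [of 0 y sin cos] y(1) by (auto intro: DERIV_sin)
      have "cos (pi / 3) \<le> cos z"
        using True z(1,2) by (intro cos_monotone_0_pi_le) auto
      then have "y * (1 / 2) \<le> y * cos z"
        using y(1) by (intro mult_left_mono) (auto simp: cos_60)
      then have "y \<le> 2 * norm (fmode 1 x - 1)"
        using z(3) im by simp
      also have "\<dots> \<le> 2 * pi * norm (fmode 1 x - 1)"
        using pi_gt3 by (intro mult_right_mono) auto
      finally show ?thesis by (simp add: y_def)
    qed (simp add: y_def)
  next
    case False
    have "cos y \<le> cos (pi / 3)"
      using False y by (intro cos_monotone_0_pi_le) auto
    then have "1 \<le> 2 * norm (fmode 1 x - 1)"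
      using re by (simp add: cos_60)
    then have "pi * 1 \<le> pi * (2 * norm (fmode 1 x - 1))"
      by (intro mult_left_mono) auto
    also have "\<dots> = 2 * pi * norm (fmode 1 x - 1)" by simp
    finally show ?thesis using assms by linarith
  qed
qed

text \<open>The increment is measured by the chord instead of \<open>\<bar>x - x0\<bar>\<close>
  because the chord is periodic, so a bound over one period holds on the whole line. It bounds the
  quotient on which the inversion formula rests.\<close>

lemma test_function_increment_bound:
  assumes "\<phi> \<in> test_functions"
  obtains C where "\<And>x. norm (\<phi> x - \<phi> x0) \<le> C * norm (fmode 1 (x - x0) - 1)"
proof
  fix x
  obtain k where k: "x - x0 + 2 * pi * of_int k \<in> {-pi..pi}" by (rule reduce_mod_2pi)
  define y where "y = x + 2 * pi * of_int k"
  have y1: "\<phi> y = \<phi> x"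
    unfolding y_def by (rule periodic_shift_int) (rule test_functions_periodic [OF assms])
  have y2: "fmode 1 (y - x0) = fmode 1 (x - x0)"
    using periodic_shift_int [of "fmode 1" "x - x0" k] fmode_periodic [of 1]
    by (simp add: y_def algebra_simps)
  have "norm (\<phi> y - \<phi> x0) \<le> sup_norm (deriv_fun \<phi>) * norm (y - x0)"
    by (rule differentiable_bound [of UNIV \<phi> "\<lambda>x h. h *\<^sub>R deriv_fun \<phi> x"])
      (use test_functions_derivative [OF assms] norm_le_sup_norm [OF deriv_fun_test_function [OF assms]]
        in \<open>auto simp: has_vector_derivative_def onorm_scaleR_left bounded_linear_ident onorm_id\<close>)
  also have "\<dots> \<le> sup_norm (deriv_fun \<phi>) * (2 * pi * norm (fmode 1 (y - x0) - 1))"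
    using norm_fmode_minus_1_ge [of "y - x0"] k
    by (intro mult_left_mono sup_norm_nonneg deriv_fun_test_function assms)
      (auto simp: y_def algebra_simps)
  finally show "norm (\<phi> x - \<phi> x0) \<le> (sup_norm (deriv_fun \<phi>) * (2 * pi)) * norm (fmode 1 (x - x0) - 1)"
    unfolding y1 y2 by (simp only: mult.assoc)
qed

lemma telescope_int:
  fixes c :: "int \<Rightarrow> 'a::ab_group_add"
  shows "(\<Sum>n\<in>{- int N..int N}. c (n - 1) - c n) = c (- int N - 1) - c (int N)"
proof (induction N)
  case (Suc N)
  have "{- int (Suc N)..int (Suc N)} = insert (- int (Suc N)) (insert (int (Suc N)) {- int N..int N})"
    by auto
  moreover have "c (- 1 - int N) = c (- int N - 1)"
    by (rule arg_cong [of _ _ c]) simp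
  ultimately show ?case using Suc by (simp add: algebra_simps)
qed simp

text \<open>Writing \<open>\<phi> - \<phi> x0 = (fmode 1 (\<cdot> - x0) - 1) * \<psi>\<close> with \<open>\<psi>\<close> bounded makes the partial
  sums at \<open>x0\<close> telescope, so that Bessel's inequality for \<open>\<psi>\<close> suffices.\<close>

lemma fourier_inversion_symmetric:
  assumes \<phi>: "\<phi> \<in> test_functions"
  shows "(\<lambda>N::nat. \<Sum>n\<in>{- int N..int N}. torus_coeff \<phi> n * fmode n x0) \<longlonglongrightarrow> \<phi> x0"
proof -
  obtain C where C: "norm (\<phi> x - \<phi> x0) \<le> C * norm (fmode 1 (x - x0) - 1)" for x
    using test_function_increment_bound [OF \<phi>] by blast
  define \<psi> where "\<psi> = (\<lambda>x. (\<phi> x - \<phi> x0) / (fmode 1 (x - x0) - 1))"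
  have \<psi>_le: "norm (\<psi> x) \<le> \<bar>C\<bar>" for x
  proof (cases "fmode 1 (x - x0) = 1")
    case False
    have "norm (\<psi> x) \<le> C"
      using False C [of x] by (simp add: \<psi>_def norm_divide divide_le_eq)
    then show ?thesis by simp
  qed (simp add: \<psi>_def)
  \<comment> \<open>Where the chord vanishes, \<open>C\<close> forces
    \<open>\<phi> x = \<phi> x0\<close>, so the value \<open>0\<close> that division by zero gives
    to \<open>\<psi>\<close> there is harmless.\<close>
  have \<psi>_eq: "\<phi> x = \<phi> x0 + \<psi> x * (fmode 1 (x - x0) - 1)" for x
    using C [of x] by (auto simp: \<psi>_def)
  have [measurable]: "\<phi> \<in> borel_measurable torus_measure"
    by (intro continuous_torus_measurable test_functions_continuous \<phi>)
  have [measurable]: "(\<lambda>x. fmode 1 (x - x0)) \<in> borel_measurable torus_measure"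
    by (rule continuous_torus_measurable, rule continuous_on_compose2 [OF continuous_on_fmode [of UNIV]])
      (auto intro!: continuous_intros)
  have \<psi>_meas [measurable]: "\<psi> \<in> borel_measurable torus_measure"
    unfolding \<psi>_def by measurable
  have int1: "integrable torus_measure (\<lambda>x. 1 :: complex)" "integrable torus_measure (\<lambda>x. 1 :: real)"
    by (intro continuous_torus_integrable continuous_intros)+
  have \<psi>_int: "integrable torus_measure (\<lambda>x. \<psi> x * fmode n x)" for n
    using integrable_mult_bounded [OF int1(1), of "\<lambda>x. \<psi> x * fmode n x" "\<bar>C\<bar>"] \<psi>_le
    by (simp add: norm_mult)
  have "integrable torus_measure (\<lambda>x. (norm (\<psi> x))\<^sup>2)"
  proof (rule Bochner_Integration.integrable_bound)
    show "integrable torus_measure (\<lambda>x. \<bar>C\<bar>\<^sup>2 * 1)" using int1(2) by simp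
    show "AE x in torus_measure. norm ((norm (\<psi> x))\<^sup>2) \<le> norm (\<bar>C\<bar>\<^sup>2 * 1)"
      using power_mono [OF \<psi>_le norm_ge_zero, of _ 2] by (intro AE_I2) simp
  qed measurable
  then have "(\<lambda>n. (norm (torus_coeff \<psi> n))\<^sup>2) summable_on UNIV"
    by (intro square_integrable_torus_coeff_summable \<psi>_meas)
  note lim = summable_on_int_imp_tendsto_0 [OF this]
  \<comment> \<open>With the phase included, multiplying \<open>\<psi>\<close> by the translated
    mode becomes the shift from \<open>n\<close> to \<open>n - 1\<close> of a single sequence, so
    the terms of the series become its differences.\<close>
  define c where "c = (\<lambda>n. fmode n x0 * torus_coeff \<psi> n)"
  have norm_c: "norm (c n) = sqrt ((norm (torus_coeff \<psi> n))\<^sup>2)" for n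
    by (simp add: c_def norm_mult)
  have c_lim: "(\<lambda>N. c (- int N - 1)) \<longlonglongrightarrow> 0" "(\<lambda>N. c (int N)) \<longlonglongrightarrow> 0"
    using tendsto_real_sqrt [OF lim(2)] tendsto_real_sqrt [OF lim(1)]
    unfolding norm_c [symmetric] by (auto intro: tendsto_norm_zero_cancel)
  have step: "torus_coeff \<phi> n * fmode n x0 = (if n = 0 then \<phi> x0 else 0) + (c (n - 1) - c n)" for n
  proof -
    have "\<phi> x * fmode (- n) x = \<phi> x0 * fmode (- n) x +
        (fmode (- 1) x0 * (\<psi> x * fmode (- (n - 1)) x) - \<psi> x * fmode (- n) x)" for x
    proof -
      have "fmode 1 (x - x0) = fmode 1 x * fmode (- 1) x0"
        using fmode_add_arg [of 1 x "- x0"] by (simp add: fmode_at_neg)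
      moreover have "fmode (1 - n) x = fmode 1 x * fmode (- n) x"
        by (simp add: fmode_mult)
      ultimately show ?thesis by (subst \<psi>_eq) (simp add: algebra_simps)
    qed
    then have "(LINT x|torus_measure. \<phi> x * fmode (- n) x) =
        (LINT x|torus_measure. \<phi> x0 * fmode (- n) x +
        (fmode (- 1) x0 * (\<psi> x * fmode (- (n - 1)) x) - \<psi> x * fmode (- n) x))" by simp
    also have "\<dots> = \<phi> x0 * (if n = 0 then 2 * pi else 0) +
        (fmode (- 1) x0 * (2 * pi * torus_coeff \<psi> (n - 1)) - 2 * pi * torus_coeff \<psi> n)"
      by (subst Bochner_Integration.integral_add Bochner_Integration.integral_diff;
          (intro Bochner_Integration.integrable_diff Bochner_Integration.integrable_mult_right \<psi>_int
            continuous_torus_integrable continuous_intros)?)+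
        (simp add: integral_fmode torus_coeff_def)
    finally have "torus_coeff \<phi> n = (if n = 0 then \<phi> x0 else 0) +
        (fmode (- 1) x0 * torus_coeff \<psi> (n - 1) - torus_coeff \<psi> n)"
      unfolding torus_coeff_def [of \<phi>] by (simp add: field_simps)
    moreover have "fmode n x0 * fmode (- 1) x0 = fmode (n - 1) x0"
      by (simp add: fmode_mult)
    moreover have "((if n = 0 then \<phi> x0 else 0) +
        (fmode (- 1) x0 * torus_coeff \<psi> (n - 1) - torus_coeff \<psi> n)) * fmode n x0 =
        (if n = 0 then \<phi> x0 else 0) +
        ((fmode n x0 * fmode (- 1) x0) * torus_coeff \<psi> (n - 1) - fmode n x0 * torus_coeff \<psi> n)"
      by (simp add: algebra_simps)
    ultimately show ?thesis by (simp only: c_def)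
  qed
  have "(\<Sum>n\<in>{- int N..int N}. torus_coeff \<phi> n * fmode n x0) = \<phi> x0 + (c (- int N - 1) - c (int N))" for N
    unfolding step sum.distrib telescope_int by (simp add: sum.delta)
  moreover have "(\<lambda>N. \<phi> x0 + (c (- int N - 1) - c (int N))) \<longlonglongrightarrow> \<phi> x0 + (0 - 0)"
    by (intro tendsto_intros c_lim)
  ultimately show ?thesis by simp
qed

section \<open>Rapid decay of coefficients and absolutely convergent inversion\<close>

lemma summable_on_int_inverse_square:
  "(\<lambda>n::int. 1 / (1 + \<bar>real_of_int n\<bar>)\<^sup>2) summable_on UNIV"
proof -
  let ?f = "\<lambda>n::int. 1 / (1 + \<bar>real_of_int n\<bar>)\<^sup>2"
  have s: "summable (\<lambda>N. 1 / (1 + real N)\<^sup>2)"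
    using inverse_power_summable [of 2, where 'a = real] summable_Suc_iff [of "\<lambda>n. inverse (real n ^ 2)"]
    by (simp add: inverse_eq_divide)
  then have "(\<lambda>N. 1 / (1 + real N)\<^sup>2) summable_on UNIV"
    by (intro summable_nonneg_imp_summable_on zero_le_divide_1_iff [THEN iffD2] zero_le_power2)
  then have "(?f \<circ> int) summable_on UNIV" "(?f \<circ> (\<lambda>N. - int N)) summable_on UNIV"
    by (simp_all add: o_def)
  then have "?f summable_on range int" "?f summable_on range (\<lambda>N. - int N)"
    by (subst summable_on_reindex; auto simp: inj_def)+
  then have "?f summable_on (range int \<union> range (\<lambda>N. - int N))"
    by (rule summable_on_union)
  also have "range int \<union> range (\<lambda>N. - int N) = UNIV"
  proof -
    have "n \<in> range int \<union> range (\<lambda>N. - int N)" for n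
      by (cases n rule: int_cases2) auto
    then show ?thesis by blast
  qed
  finally show ?thesis .
qed

text \<open>\<open>1 + \<bar>n\<bar>\<close> is at most twice the larger of \<open>1\<close> and
  \<open>\<bar>n\<bar>\<close>, whence \<open>2 ^ k\<close>; the bound of order \<open>0\<close>
  serves the small frequencies and the one of order \<open>k\<close> the large ones.\<close>

lemma torus_coeff_rapid_decay:
  assumes "\<phi> \<in> test_functions"
  shows "(1 + \<bar>of_int n\<bar>) ^ k * norm (torus_coeff \<phi> n) \<le>
    2 ^ k * (sup_norm \<phi> + sup_norm ((deriv_fun ^^ k) \<phi>))"
proof -
  have 1: "norm (torus_coeff \<phi> n) \<le> sup_norm \<phi>"
    using norm_torus_coeff_decay [OF assms, of n 0] by simp
  have 2: "\<bar>of_int n\<bar> ^ k * norm (torus_coeff \<phi> n) \<le> sup_norm ((deriv_fun ^^ k) \<phi>)"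
    by (rule norm_torus_coeff_decay [OF assms])
  have "(1 + \<bar>real_of_int n\<bar>) ^ k \<le> (2 * max 1 \<bar>real_of_int n\<bar>) ^ k"
    by (intro power_mono) (auto simp: max_def)
  also have "\<dots> \<le> 2 ^ k * (1 + \<bar>real_of_int n\<bar> ^ k)"
    by (auto simp: max_def power_mult_distrib)
  finally have "(1 + \<bar>of_int n\<bar>) ^ k * norm (torus_coeff \<phi> n) \<le>
      2 ^ k * (1 + \<bar>real_of_int n\<bar> ^ k) * norm (torus_coeff \<phi> n)"
    by (intro mult_right_mono) auto
  also have "\<dots> = 2 ^ k * (norm (torus_coeff \<phi> n) + \<bar>real_of_int n\<bar> ^ k * norm (torus_coeff \<phi> n))"
    by (simp add: algebra_simps)
  also have "\<dots> \<le> 2 ^ k * (sup_norm \<phi> + sup_norm ((deriv_fun ^^ k) \<phi>))"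
    using 1 2 by (intro mult_left_mono add_mono) auto
  finally show ?thesis .
qed

text \<open>This is the range of \<open>fourier_coeff\<close>, as
  \<open>poly_bounded_fourier_coeff\<close> and \<open>distribution_of_poly_bounded\<close> show.
  Since \<open>dist_of_coeffs\<close> is unspecified elsewhere, each multiplier and each product has
  to meet this condition before its coefficients can be computed.\<close>

definition poly_bounded :: "(int \<Rightarrow> complex) \<Rightarrow> bool" where
  "poly_bounded a \<longleftrightarrow> (\<exists>C N. \<forall>n. norm (a n) \<le> C * (1 + \<bar>of_int n\<bar>) ^ N)"

lemma poly_boundedI: "(\<And>n. norm (a n) \<le> C * (1 + \<bar>of_int n\<bar>) ^ N) \<Longrightarrow> poly_bounded a"
  unfolding poly_bounded_def by blast

text \<open>The constants are uniform in the test function; this is the continuity of the functional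
  defined by \<open>a\<close>.\<close>

lemma poly_bounded_pairing_bound:
  assumes "poly_bounded a"
  obtains C k where "0 \<le> C" "\<And>\<phi>. \<phi> \<in> test_functions \<Longrightarrow>
      (\<lambda>n. norm (torus_coeff \<phi> n * a (- n))) summable_on UNIV \<and>
      (\<Sum>\<^sub>\<infinity>n\<in>UNIV. norm (torus_coeff \<phi> n * a (- n))) \<le> C * (sup_norm \<phi> + sup_norm ((deriv_fun ^^ k) \<phi>))"
proof -
  obtain C N where a: "norm (a n) \<le> C * (1 + \<bar>of_int n\<bar>) ^ N" for n
    using assms unfolding poly_bounded_def by blast
  let ?q = "\<lambda>n::int. 1 / (1 + \<bar>real_of_int n\<bar>)\<^sup>2"
  have C0: "0 \<le> C" using order_trans [OF norm_ge_zero a [of 0]] by simp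
  \<comment> \<open>Decay of order \<open>N + 2\<close> of the test coefficients absorbs the growth
    of \<open>a\<close> and leaves the summable factor \<open>?q\<close>.\<close>
  have *: "norm (torus_coeff \<phi> n * a (- n)) \<le>
      (C * (2 ^ (N + 2) * (sup_norm \<phi> + sup_norm ((deriv_fun ^^ (N + 2)) \<phi>)))) * ?q n"
    if "\<phi> \<in> test_functions" for \<phi> n
  proof -
    have "norm (torus_coeff \<phi> n * a (- n)) \<le> norm (torus_coeff \<phi> n) * (C * (1 + \<bar>of_int n\<bar>) ^ N)"
      using a [of "- n"] by (simp add: norm_mult mult_left_mono)
    also have "\<dots> = C * ((1 + \<bar>of_int n\<bar>) ^ (N + 2) * norm (torus_coeff \<phi> n)) * ?q n"
    proof -
      have "(1 + \<bar>real_of_int n\<bar>)\<^sup>2 * ?q n = 1" by (simp add: add_nonneg_eq_0_iff)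
      then show ?thesis by (simp only: power_add mult_ac)
    qed
    also have "\<dots> \<le> C * (2 ^ (N + 2) * (sup_norm \<phi> + sup_norm ((deriv_fun ^^ (N + 2)) \<phi>))) * ?q n"
      by (intro mult_right_mono mult_left_mono torus_coeff_rapid_decay that C0) auto
    finally show ?thesis by (simp add: mult.assoc)
  qed
  have "(\<lambda>n. norm (torus_coeff \<phi> n * a (- n))) summable_on UNIV \<and>
      (\<Sum>\<^sub>\<infinity>n\<in>UNIV. norm (torus_coeff \<phi> n * a (- n))) \<le>
        C * 2 ^ (N + 2) * infsum ?q UNIV * (sup_norm \<phi> + sup_norm ((deriv_fun ^^ (N + 2)) \<phi>))"
    if "\<phi> \<in> test_functions" for \<phi>
  proof
    show s: "(\<lambda>n. norm (torus_coeff \<phi> n * a (- n))) summable_on UNIV"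
      by (rule summable_on_comparison_test [OF summable_on_cmult_right [OF summable_on_int_inverse_square]])
        (use * [OF that] in auto)
    show "(\<Sum>\<^sub>\<infinity>n\<in>UNIV. norm (torus_coeff \<phi> n * a (- n))) \<le>
        C * 2 ^ (N + 2) * infsum ?q UNIV * (sup_norm \<phi> + sup_norm ((deriv_fun ^^ (N + 2)) \<phi>))"
      using infsum_mono [OF s summable_on_cmult_right [OF summable_on_int_inverse_square] * [OF that]]
      unfolding infsum_cmult_right' by (simp only: mult_ac)
  qed
  moreover have "0 \<le> C * 2 ^ (N + 2) * infsum ?q UNIV"
    by (intro mult_nonneg_nonneg C0 infsum_nonneg) auto
  ultimately show ?thesis using that by blast
qed

text \<open>The bound for the constant sequence \<open>1\<close>, which belongs to a multiple of a
  point mass, yields absolute summability; the unordered sum is then identified through its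
  symmetric partial sums.\<close>

lemma fourier_inversion:
  assumes \<phi>: "\<phi> \<in> test_functions"
  shows "(\<lambda>n. norm (torus_coeff \<phi> n)) summable_on UNIV"
    and "((\<lambda>n. torus_coeff \<phi> n * fmode n x) has_sum \<phi> x) UNIV"
proof -
  have "poly_bounded (\<lambda>_. 1)" by (rule poly_boundedI [of _ 1 0]) auto
  then have "(\<lambda>n. norm (torus_coeff \<phi> n * 1)) summable_on UNIV"
  proof (rule poly_bounded_pairing_bound)
    fix C k
    assume "\<And>\<phi>. \<phi> \<in> test_functions \<Longrightarrow>
      (\<lambda>n. norm (torus_coeff \<phi> n * 1)) summable_on UNIV \<and>
      (\<Sum>\<^sub>\<infinity>n\<in>UNIV. norm (torus_coeff \<phi> n * 1)) \<le> C * (sup_norm \<phi> + sup_norm ((deriv_fun ^^ k) \<phi>))"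
    from this [OF \<phi>] show ?thesis by (rule conjunct1)
  qed
  then show s: "(\<lambda>n. norm (torus_coeff \<phi> n)) summable_on UNIV" by simp
  then have "(\<lambda>n. torus_coeff \<phi> n * fmode n x) summable_on UNIV"
    by (intro abs_summable_summable [where f = "\<lambda>n. torus_coeff \<phi> n * fmode n x"]) (simp add: norm_mult)
  then have "((\<lambda>n. torus_coeff \<phi> n * fmode n x) has_sum
      (\<Sum>\<^sub>\<infinity>n\<in>UNIV. torus_coeff \<phi> n * fmode n x)) UNIV" by (rule has_sum_infsum)
  moreover from has_sum_imp_symmetric_limit [OF this]
  have "(\<Sum>\<^sub>\<infinity>n\<in>UNIV. torus_coeff \<phi> n * fmode n x) = \<phi> x"
    using fourier_inversion_symmetric [OF \<phi>] LIMSEQ_unique by blast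
  ultimately show "((\<lambda>n. torus_coeff \<phi> n * fmode n x) has_sum \<phi> x) UNIV" by simp
qed


section \<open>Distributions and their Fourier coefficients\<close>

text \<open>The tail of the norms does not involve the phases, so for a Fourier series this
  remainder is uniform in \<open>x\<close>.\<close>

lemma norm_has_sum_remainder_le:
  fixes f :: "'a \<Rightarrow> complex"
  assumes "(f has_sum S) UNIV" "(\<lambda>n. norm (f n)) summable_on UNIV" "finite F"
  shows "norm (S - sum f F) \<le> (\<Sum>\<^sub>\<infinity>n\<in>UNIV. norm (f n)) - (\<Sum>n\<in>F. norm (f n))"
proof -
  have "((\<lambda>n. norm (f n)) has_sum (\<Sum>\<^sub>\<infinity>n\<in>UNIV. norm (f n)) - (\<Sum>n\<in>F. norm (f n))) (UNIV - F)"
    by (rule has_sum_Diff) (use assms in auto)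
  moreover have "(f has_sum S - sum f F) (UNIV - F)"
    by (rule has_sum_Diff) (use assms in auto)
  ultimately show ?thesis by (rule norm_has_sum_bound)
qed

lemma pairing_is_distribution: "is_distribution (pairing v)"
  using pairing [of v] by simp

lemma pairing_add:
  "\<phi> \<in> test_functions \<Longrightarrow> \<psi> \<in> test_functions \<Longrightarrow>
    pairing v (\<lambda>x. \<phi> x + \<psi> x) = pairing v \<phi> + pairing v \<psi>"
  using pairing_is_distribution [of v] unfolding is_distribution_def by blast

lemma pairing_cmult: "\<phi> \<in> test_functions \<Longrightarrow> pairing v (\<lambda>x. c * \<phi> x) = c * pairing v \<phi>"
  using pairing_is_distribution [of v] unfolding is_distribution_def by blast

lemma pairing_not_test: "\<phi> \<notin> test_functions \<Longrightarrow> pairing v \<phi> = 0"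
  using pairing_is_distribution [of v] unfolding is_distribution_def by blast

lemma pairing_diff:
  assumes "\<phi> \<in> test_functions" "\<psi> \<in> test_functions"
  shows "pairing v (\<lambda>x. \<phi> x - \<psi> x) = pairing v \<phi> - pairing v \<psi>"
  using pairing_add [OF assms(1) test_functions_cmult [OF assms(2), of "-1"], of v]
    pairing_cmult [OF assms(2), of v "-1"] by simp

lemma pairing_continuous:
  obtains C N where "0 \<le> C"
    "\<And>\<phi>. \<phi> \<in> test_functions \<Longrightarrow> norm (pairing v \<phi>) \<le> C * (\<Sum>k\<le>N. sup_norm ((deriv_fun ^^ k) \<phi>))"
proof -
  obtain C N where CN: "\<And>\<phi>. \<phi> \<in> test_functions \<Longrightarrow>
      norm (pairing v \<phi>) \<le> C * (\<Sum>k\<le>N. sup_norm ((deriv_fun ^^ k) \<phi>))"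
    using pairing_is_distribution [of v] unfolding is_distribution_def by blast
  show ?thesis
  proof
    show "norm (pairing v \<phi>) \<le> max 0 C * (\<Sum>k\<le>N. sup_norm ((deriv_fun ^^ k) \<phi>))"
      if "\<phi> \<in> test_functions" for \<phi>
      by (rule order_trans [OF CN [OF that]], rule mult_right_mono)
        (auto intro!: sum_nonneg sup_norm_nonneg deriv_fun_funpow_test_function that)
  qed simp
qed

lemma trig_poly_test_function:
  assumes "finite F" shows "(\<lambda>x. \<Sum>n\<in>F. c n * fmode n x) \<in> test_functions"
  using assms by (induction F) (simp_all add: zero_test_function test_functions_add
      cmult_fmode_test_function)

lemma pairing_trig_poly:
  assumes "finite F"
  shows "pairing v (\<lambda>x. \<Sum>n\<in>F. c n * fmode n x) = (\<Sum>n\<in>F. c n * pairing v (fmode n))"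
  using assms
proof (induction F)
  case empty
  then show ?case using pairing_cmult [OF zero_test_function, of v 0] by simp
next
  case (insert m F)
  then show ?case
    by (simp add: pairing_add cmult_fmode_test_function trig_poly_test_function
        pairing_cmult fmode_test_function)
qed

lemma deriv_fun_funpow_trig_poly:
  assumes "finite F"
  shows "(deriv_fun ^^ k) (\<lambda>x. \<Sum>n\<in>F. c n * fmode n x) =
    (\<lambda>x. \<Sum>n\<in>F. (\<i> * of_int n) ^ k * c n * fmode n x)"
  using assms
proof (induction F)
  case empty
  then show ?case using deriv_fun_funpow_fmode [of k 0 0] by simp
next
  case (insert m F)
  then show ?case
    using test_functions_funpow_lincomb [OF cmult_fmode_test_function [of "c m" m]
        trig_poly_test_function [OF insert(1), of c], of k 1 1]
    by (simp add: deriv_fun_funpow_fmode mult_ac)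
qed

lemma fourier_coeff_eq: "fourier_coeff v n = pairing v (fmode (- n)) / (2 * pi)"
  by (simp add: fourier_coeff_def fmode_def [abs_def])

lemma pairing_fmode: "pairing v (fmode n) = 2 * pi * fourier_coeff v (- n)"
  by (simp add: fourier_coeff_eq)

text \<open>The derivative of order \<open>k\<close> of a mode has size
  \<open>\<bar>n\<bar> ^ k\<close>, so continuity of the functional, tested on modes, is polynomial
  growth of the coefficients.\<close>

lemma poly_bounded_fourier_coeff: "poly_bounded (fourier_coeff v)"
proof -
  obtain C N where C: "0 \<le> C" "\<And>\<phi>. \<phi> \<in> test_functions \<Longrightarrow>
      norm (pairing v \<phi>) \<le> C * (\<Sum>k\<le>N. sup_norm ((deriv_fun ^^ k) \<phi>))"
    using pairing_continuous [of v] by blast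
  have "norm (fourier_coeff v n) \<le> C * real (Suc N) * (1 + \<bar>real_of_int n\<bar>) ^ N" for n
  proof -
    have s: "sup_norm ((deriv_fun ^^ k) (fmode (- n))) \<le> (1 + \<bar>real_of_int n\<bar>) ^ N" if "k \<le> N" for k
    proof (rule sup_norm_le)
      fix x
      have "norm ((deriv_fun ^^ k) (fmode (- n)) x) = \<bar>real_of_int n\<bar> ^ k"
        using deriv_fun_funpow_fmode [of k 1 "- n"] by (simp add: norm_mult norm_power)
      also have "\<dots> \<le> (1 + \<bar>real_of_int n\<bar>) ^ k" by (intro power_mono) auto
      also have "\<dots> \<le> (1 + \<bar>real_of_int n\<bar>) ^ N" by (intro power_increasing that) auto
      finally show "norm ((deriv_fun ^^ k) (fmode (- n)) x) \<le> (1 + \<bar>real_of_int n\<bar>) ^ N" .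
    qed
    have "norm (fourier_coeff v n) \<le> norm (pairing v (fmode (- n)))"
      using pi_gt3 by (simp add: fourier_coeff_eq norm_divide divide_le_eq mult_le_cancel_left1)
    also have "\<dots> \<le> C * (\<Sum>k\<le>N. sup_norm ((deriv_fun ^^ k) (fmode (- n))))"
      by (rule C(2) [OF fmode_test_function])
    also have "\<dots> \<le> C * (\<Sum>k\<le>N. (1 + \<bar>real_of_int n\<bar>) ^ N)"
      by (intro mult_left_mono sum_mono s C(1)) auto
    finally show ?thesis by simp
  qed
  then show ?thesis by (rule poly_boundedI)
qed

lemma pairing_summable:
  assumes "poly_bounded a" "\<phi> \<in> test_functions"
  shows "(\<lambda>n. norm (torus_coeff \<phi> n * a (- n))) summable_on UNIV"
  using assms(1)
proof (rule poly_bounded_pairing_bound)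
  fix C k
  assume "\<And>\<phi>. \<phi> \<in> test_functions \<Longrightarrow>
    (\<lambda>n. norm (torus_coeff \<phi> n * a (- n))) summable_on UNIV \<and>
    (\<Sum>\<^sub>\<infinity>n\<in>UNIV. norm (torus_coeff \<phi> n * a (- n))) \<le> C * (sup_norm \<phi> + sup_norm ((deriv_fun ^^ k) \<phi>))"
  from this [OF assms(2)] show ?thesis by (rule conjunct1)
qed

text \<open>The Fourier series of a test function converges uniformly together with all its
  derivatives; \<open>r k M\<close> bounds the remainder of the derivative of order
  \<open>k\<close>. Continuity of the functional then lets the pairing pass to the limit. From here
  on distributions can be handled through their coefficients.\<close>

lemma pairing_has_sum:
  assumes \<phi>: "\<phi> \<in> test_functions"
  shows "((\<lambda>n. torus_coeff \<phi> n * fourier_coeff v (- n)) has_sum (pairing v \<phi> / (2 * pi))) UNIV"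
proof -
  let ?f = "\<lambda>n. torus_coeff \<phi> n * fourier_coeff v (- n)"
  let ?I = "\<lambda>M::nat. {- int M..int M}"
  define S where "S = (\<lambda>M x. \<Sum>n\<in>?I M. torus_coeff \<phi> n * fmode n x)"
  define r where "r = (\<lambda>k M. (\<Sum>\<^sub>\<infinity>n\<in>UNIV. norm (torus_coeff ((deriv_fun ^^ k) \<phi>) n)) -
    (\<Sum>n\<in>?I M. norm (torus_coeff ((deriv_fun ^^ k) \<phi>) n)))"
  obtain C N where C: "0 \<le> C" "\<And>\<phi>. \<phi> \<in> test_functions \<Longrightarrow>
      norm (pairing v \<phi>) \<le> C * (\<Sum>k\<le>N. sup_norm ((deriv_fun ^^ k) \<phi>))"
    using pairing_continuous [of v] by blast
  have S_test: "S M \<in> test_functions" for M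
    unfolding S_def by (rule trig_poly_test_function) simp
  have sup_le: "sup_norm ((deriv_fun ^^ k) (\<lambda>x. \<phi> x - S M x)) \<le> r k M" for k M
  proof (rule sup_norm_le)
    fix x
    have D: "(deriv_fun ^^ k) \<phi> \<in> test_functions"
      by (rule deriv_fun_funpow_test_function [OF \<phi>])
    have "(deriv_fun ^^ k) (\<lambda>x. \<phi> x - S M x) x =
        (deriv_fun ^^ k) \<phi> x - (\<Sum>n\<in>?I M. torus_coeff ((deriv_fun ^^ k) \<phi>) n * fmode n x)"
      unfolding test_functions_funpow_diff [OF \<phi> S_test] unfolding S_def
      by (subst deriv_fun_funpow_trig_poly) (simp_all add: torus_coeff_deriv_fun_funpow \<phi>)
    also have "norm \<dots> \<le> (\<Sum>\<^sub>\<infinity>n\<in>UNIV. norm (torus_coeff ((deriv_fun ^^ k) \<phi>) n * fmode n x)) -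
        (\<Sum>n\<in>?I M. norm (torus_coeff ((deriv_fun ^^ k) \<phi>) n * fmode n x))"
      by (rule norm_has_sum_remainder_le)
        (use fourier_inversion [OF D] in \<open>simp_all add: norm_mult\<close>)
    finally show "norm ((deriv_fun ^^ k) (\<lambda>x. \<phi> x - S M x) x) \<le> r k M"
      by (simp add: r_def norm_mult)
  qed
  have r_lim: "(\<lambda>M. r k M) \<longlonglongrightarrow> 0" for k
  proof -
    have "(\<lambda>M. \<Sum>n\<in>?I M. norm (torus_coeff ((deriv_fun ^^ k) \<phi>) n)) \<longlonglongrightarrow>
        (\<Sum>\<^sub>\<infinity>n\<in>UNIV. norm (torus_coeff ((deriv_fun ^^ k) \<phi>) n))"
      by (intro has_sum_imp_symmetric_limit has_sum_infsum fourier_inversion(1)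
          deriv_fun_funpow_test_function \<phi>)
    from tendsto_diff [OF tendsto_const this] show ?thesis
      unfolding r_def by (metis diff_self)
  qed
  have "(\<lambda>M. pairing v \<phi> - pairing v (S M)) \<longlonglongrightarrow> 0"
  proof (rule Lim_null_comparison)
    show "\<forall>\<^sub>F M in sequentially. norm (pairing v \<phi> - pairing v (S M)) \<le> C * (\<Sum>k\<le>N. r k M)"
    proof (rule always_eventually, rule allI)
      fix M
      have "norm (pairing v (\<lambda>x. \<phi> x - S M x)) \<le> C * (\<Sum>k\<le>N. sup_norm ((deriv_fun ^^ k) (\<lambda>x. \<phi> x - S M x)))"
        by (rule C(2) [OF test_functions_diff [OF \<phi> S_test]])
      also have "\<dots> \<le> C * (\<Sum>k\<le>N. r k M)"
        by (intro mult_left_mono sum_mono sup_le C(1))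
      finally show "norm (pairing v \<phi> - pairing v (S M)) \<le> C * (\<Sum>k\<le>N. r k M)"
        by (simp add: pairing_diff [OF \<phi> S_test])
    qed
    have "(\<lambda>M. C * (\<Sum>k\<le>N. r k M)) \<longlonglongrightarrow> C * (\<Sum>k\<le>N. 0)"
      by (intro tendsto_intros r_lim)
    then show "(\<lambda>M. C * (\<Sum>k\<le>N. r k M)) \<longlonglongrightarrow> 0" by simp
  qed
  moreover have "pairing v (S M) = 2 * pi * (\<Sum>n\<in>?I M. ?f n)" for M
    unfolding S_def by (subst pairing_trig_poly) (simp_all add: pairing_fmode sum_distrib_left mult_ac)
  ultimately have "(\<lambda>M. (pairing v \<phi> - (pairing v \<phi> - 2 * pi * (\<Sum>n\<in>?I M. ?f n))) / (2 * pi))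
      \<longlonglongrightarrow> (pairing v \<phi> - 0) / (2 * pi)"
    by (intro tendsto_intros) auto
  then have lim: "(\<lambda>M. \<Sum>n\<in>?I M. ?f n) \<longlonglongrightarrow> pairing v \<phi> / (2 * pi)" by simp
  have "?f summable_on UNIV"
    by (rule abs_summable_summable, rule pairing_summable [OF poly_bounded_fourier_coeff \<phi>])
  then have "(?f has_sum infsum ?f UNIV) UNIV" by (rule has_sum_infsum)
  moreover from has_sum_imp_symmetric_limit [OF this] lim
  have "infsum ?f UNIV = pairing v \<phi> / (2 * pi)" by (rule LIMSEQ_unique)
  ultimately show ?thesis by simp
qed

lemma torus_distribution_eqI:
  assumes "\<And>n. fourier_coeff u n = fourier_coeff v n" shows "u = v"
proof -
  have "pairing u \<phi> = pairing v \<phi>" for \<phi>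
  proof (cases "\<phi> \<in> test_functions")
    case True
    have "pairing u \<phi> / (2 * pi) = pairing v \<phi> / (2 * pi)"
      using pairing_has_sum [OF True, of u] pairing_has_sum [OF True, of v]
      unfolding assms by (rule has_sum_unique)
    then show ?thesis by simp
  qed (simp add: pairing_not_test)
  then show ?thesis using pairing_inject by blast
qed

lemma torus_coeff_lincomb:
  assumes "\<phi> \<in> test_functions" "\<psi> \<in> test_functions"
  shows "torus_coeff (\<lambda>x. c * \<phi> x + d * \<psi> x) n = c * torus_coeff \<phi> n + d * torus_coeff \<psi> n"
proof -
  have "integrable torus_measure (\<lambda>x. \<xi> x * fmode (- n) x)" if "\<xi> \<in> test_functions" for \<xi>
    by (intro continuous_torus_integrable continuous_intros test_functions_continuous that)
  then have "(LINT x|torus_measure. c * (\<phi> x * fmode (- n) x) + d * (\<psi> x * fmode (- n) x)) =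
      c * (LINT x|torus_measure. \<phi> x * fmode (- n) x) + d * (LINT x|torus_measure. \<psi> x * fmode (- n) x)"
    using assms by simp
  then show ?thesis by (simp add: torus_coeff_def algebra_simps add_divide_distrib)
qed

lemma distribution_of_poly_bounded:
  assumes "poly_bounded a"
  obtains v where "\<And>n. fourier_coeff v n = a n"
proof -
  let ?g = "\<lambda>\<phi> n. torus_coeff \<phi> n * a (- n)"
  \<comment> \<open>The formula is forced by \<open>pairing_has_sum\<close>; off the test functions
    the normalisation in \<open>is_distribution\<close> prescribes \<open>0\<close>.\<close>
  define u where "u = (\<lambda>\<phi>. if \<phi> \<in> test_functions then 2 * pi * infsum (?g \<phi>) UNIV else 0)"
  have abs: "(\<lambda>n. norm (?g \<phi> n)) summable_on UNIV" if "\<phi> \<in> test_functions" for \<phi>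
    by (rule pairing_summable [OF assms that])
  have sm: "?g \<phi> summable_on UNIV" if "\<phi> \<in> test_functions" for \<phi>
    by (rule abs_summable_summable [OF abs [OF that]])
  have lin: "infsum (?g (\<lambda>x. c * \<phi> x + d * \<psi> x)) UNIV = c * infsum (?g \<phi>) UNIV + d * infsum (?g \<psi>) UNIV"
    if "\<phi> \<in> test_functions" "\<psi> \<in> test_functions" for \<phi> \<psi> c d
  proof -
    have "infsum (?g (\<lambda>x. c * \<phi> x + d * \<psi> x)) UNIV = (\<Sum>\<^sub>\<infinity>n\<in>UNIV. c * ?g \<phi> n + d * ?g \<psi> n)"
      by (simp add: torus_coeff_lincomb that algebra_simps)
    also have "\<dots> = (\<Sum>\<^sub>\<infinity>n\<in>UNIV. c * ?g \<phi> n) + (\<Sum>\<^sub>\<infinity>n\<in>UNIV. d * ?g \<psi> n)"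
      by (intro infsum_add summable_on_cmult_right sm that)
    finally show ?thesis by (simp only: infsum_cmult_right')
  qed
  have "is_distribution u"
    unfolding is_distribution_def
  proof (intro conjI allI ballI impI)
    show "u \<phi> = 0" if "\<phi> \<notin> test_functions" for \<phi> using that by (simp add: u_def)
    show "u (\<lambda>x. \<phi> x + \<psi> x) = u \<phi> + u \<psi>" if "\<phi> \<in> test_functions" "\<psi> \<in> test_functions" for \<phi> \<psi>
      using lin [OF that, of 1 1] that by (simp add: u_def test_functions_add algebra_simps)
    show "u (\<lambda>x. c * \<phi> x) = c * u \<phi>" if "\<phi> \<in> test_functions" for c \<phi>
      using lin [OF that that, of c 0] that by (simp add: u_def test_functions_cmult algebra_simps)
    from assms show "\<exists>C N. \<forall>\<phi>\<in>test_functions. norm (u \<phi>) \<le> C * (\<Sum>k\<le>N. sup_norm ((deriv_fun ^^ k) \<phi>))"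
    proof (rule poly_bounded_pairing_bound)
      fix C :: real and k
      assume C: "0 \<le> C" and bd: "\<And>\<phi>. \<phi> \<in> test_functions \<Longrightarrow>
        (\<lambda>n. norm (?g \<phi> n)) summable_on UNIV \<and>
        (\<Sum>\<^sub>\<infinity>n\<in>UNIV. norm (?g \<phi> n)) \<le> C * (sup_norm \<phi> + sup_norm ((deriv_fun ^^ k) \<phi>))"
      have "norm (u \<phi>) \<le> (2 * pi * C * 2) * (\<Sum>j\<le>k. sup_norm ((deriv_fun ^^ j) \<phi>))"
        if "\<phi> \<in> test_functions" for \<phi>
      proof -
        have nn: "0 \<le> sup_norm ((deriv_fun ^^ j) \<phi>)" for j
          by (intro sup_norm_nonneg deriv_fun_funpow_test_function that)
        have "norm (u \<phi>) \<le> 2 * pi * (\<Sum>\<^sub>\<infinity>n\<in>UNIV. norm (?g \<phi> n))"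
          using norm_infsum_bound [OF abs [OF that]] that by (simp add: u_def norm_mult)
        also have "\<dots> \<le> 2 * pi * (C * (sup_norm \<phi> + sup_norm ((deriv_fun ^^ k) \<phi>)))"
          using bd [OF that] by (intro mult_left_mono) auto
        also have "\<dots> \<le> 2 * pi * (C * ((\<Sum>j\<le>k. sup_norm ((deriv_fun ^^ j) \<phi>)) + (\<Sum>j\<le>k. sup_norm ((deriv_fun ^^ j) \<phi>))))"
          using member_le_sum [of 0 "{..k}" "\<lambda>j. sup_norm ((deriv_fun ^^ j) \<phi>)"]
            member_le_sum [of k "{..k}" "\<lambda>j. sup_norm ((deriv_fun ^^ j) \<phi>)"] nn
          by (intro mult_left_mono add_mono C) auto
        finally show ?thesis by (simp add: mult_ac)
      qed
      then show ?thesis by blast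
    qed
  qed
  then have u: "pairing (Abs_distribution u) = u" by (simp add: Abs_distribution_inverse)
  have "fourier_coeff (Abs_distribution u) n = a n" for n
  proof -
    have "torus_coeff (fmode (- n)) m = (if m = - n then 1 else 0)" for m
      using torus_coeff_lincomb_fmode [of "{- n}" "\<lambda>_. 1" m] by simp
    then have "infsum (?g (fmode (- n))) UNIV = infsum (\<lambda>m. if m = - n then a n else 0) UNIV"
      by (intro infsum_cong) auto
    also have "\<dots> = infsum (\<lambda>m. a n) {- n}"
      by (rule infsum_cong_neutral) auto
    finally show ?thesis
      unfolding fourier_coeff_eq u by (simp add: u_def fmode_test_function)
  qed
  with that show ?thesis by blast
qed

text \<open>Existence by \<open>distribution_of_poly_bounded\<close> and uniqueness by
  \<open>torus_distribution_eqI\<close> make the description in \<open>dist_of_coeffs\<close> well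
  defined.\<close>

lemma fourier_coeff_dist_of_coeffs:
  assumes "poly_bounded a" shows "fourier_coeff (dist_of_coeffs a) n = a n"
proof -
  obtain v where v: "\<And>n. fourier_coeff v n = a n"
    using distribution_of_poly_bounded [OF assms] by blast
  have "\<forall>n. fourier_coeff (dist_of_coeffs a) n = a n"
    unfolding dist_of_coeffs_def
    by (rule theI [of _ v]) (auto simp: v intro: torus_distribution_eqI)
  then show ?thesis by blast
qed

section \<open>Fourier coefficients of multipliers, differences and derivatives\<close>

lemma poly_bounded_mult:
  assumes "poly_bounded a" "poly_bounded b" shows "poly_bounded (\<lambda>n. a n * b n)"
proof -
  obtain C N D M where a: "norm (a n) \<le> C * (1 + \<bar>of_int n\<bar>) ^ N"
    and b: "norm (b n) \<le> D * (1 + \<bar>of_int n\<bar>) ^ M" for n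
    using assms unfolding poly_bounded_def by blast
  have "0 \<le> C" using order_trans [OF norm_ge_zero a [of 0]] by simp
  then have "norm (a n * b n) \<le> (C * (1 + \<bar>of_int n\<bar>) ^ N) * (D * (1 + \<bar>of_int n\<bar>) ^ M)" for n
    unfolding norm_mult by (intro mult_mono a b) auto
  then show ?thesis
    by (intro poly_boundedI [of _ "C * D" "N + M"]) (simp add: power_add mult_ac)
qed

lemma fourier_coeff_multiplier:
  assumes "poly_bounded m"
  shows "fourier_coeff (fourier_multiplier m v) n = m n * fourier_coeff v n"
  unfolding fourier_multiplier_def
  by (intro fourier_coeff_dist_of_coeffs poly_bounded_mult assms poly_bounded_fourier_coeff)

lemma fourier_coeff_hilbert:
  "fourier_coeff (hilbert_transform v) n = - \<i> * of_int (sgn n) * fourier_coeff v n"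
  unfolding hilbert_transform_def
  by (subst fourier_coeff_multiplier, rule poly_boundedI [of _ 1 0]) (auto simp: norm_mult sgn_if)

lemma fourier_coeff_Lambda_pow:
  "fourier_coeff (Lambda_pow s v) n = of_real (\<bar>real_of_int n\<bar> powr s) * fourier_coeff v n"
  unfolding Lambda_pow_def
proof (subst fourier_coeff_multiplier)
  have "\<bar>real_of_int n\<bar> powr s \<le> (1 + \<bar>real_of_int n\<bar>) ^ nat \<lceil>\<bar>s\<bar>\<rceil>" for n
  proof (cases "n = 0")
    case False
    then have "\<bar>real_of_int n\<bar> powr s \<le> \<bar>real_of_int n\<bar> powr \<bar>s\<bar>"
      by (intro powr_mono) auto
    also have "\<dots> \<le> (1 + \<bar>real_of_int n\<bar>) powr \<bar>s\<bar>" by (intro powr_mono2) auto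
    also have "\<dots> \<le> (1 + \<bar>real_of_int n\<bar>) powr (real (nat \<lceil>\<bar>s\<bar>\<rceil>))"
      by (intro powr_mono) (auto intro: real_nat_ceiling_ge)
    also have "\<dots> = (1 + \<bar>real_of_int n\<bar>) ^ nat \<lceil>\<bar>s\<bar>\<rceil>"
      by (rule powr_realpow) (simp add: add_pos_nonneg)
    finally show ?thesis .
  qed simp
  then show "poly_bounded (\<lambda>n. complex_of_real (\<bar>real_of_int n\<bar> powr s))"
    by (intro poly_boundedI [of _ 1 "nat \<lceil>\<bar>s\<bar>\<rceil>"]) simp
qed simp

text \<open>At negative times the symbol outgrows every polynomial, hence the restriction on
  \<open>t\<close>; in the Duhamel formula all elapsed times are nonnegative.\<close>

lemma fourier_coeff_heat_semigroup:
  assumes "0 \<le> t"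
  shows "fourier_coeff (heat_semigroup t v) n = of_real (exp (- t * \<bar>real_of_int n\<bar> ^ 3)) * fourier_coeff v n"
  unfolding heat_semigroup_def
  by (subst fourier_coeff_multiplier, rule poly_boundedI [of _ 1 0]) (use assms in auto)

text \<open>\<open>Abs_distribution\<close> can be undone only on actual distributions. The
  difference is recognised as one by building a distribution \<open>w\<close> with the expected
  coefficients and comparing pairings; \<open>dist_deriv\<close> is treated in the same way.\<close>

lemma fourier_coeff_minus: "fourier_coeff (u - v) n = fourier_coeff u n - fourier_coeff v n"
proof -
  obtain w where w: "fourier_coeff w n = fourier_coeff u n - fourier_coeff v n" for n
  proof (rule distribution_of_poly_bounded)
    obtain C N D M where a: "norm (fourier_coeff u n) \<le> C * (1 + \<bar>of_int n\<bar>) ^ N"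
      and b: "norm (fourier_coeff v n) \<le> D * (1 + \<bar>of_int n\<bar>) ^ M" for n
      using poly_bounded_fourier_coeff unfolding poly_bounded_def by blast
    have C: "0 \<le> C" using order_trans [OF norm_ge_zero a [of 0]] by simp
    have D: "0 \<le> D" using order_trans [OF norm_ge_zero b [of 0]] by simp
    show "poly_bounded (\<lambda>n. fourier_coeff u n - fourier_coeff v n)"
    proof (rule poly_boundedI)
      fix n :: int
      have "norm (fourier_coeff u n - fourier_coeff v n) \<le>
          C * (1 + \<bar>of_int n\<bar>) ^ N + D * (1 + \<bar>of_int n\<bar>) ^ M"
        by (intro order_trans [OF norm_triangle_ineq4] add_mono a b)
      also have "\<dots> \<le> C * (1 + \<bar>of_int n\<bar>) ^ (N + M) + D * (1 + \<bar>of_int n\<bar>) ^ (N + M)"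
        by (intro add_mono mult_left_mono power_increasing C D) auto
      finally show "norm (fourier_coeff u n - fourier_coeff v n) \<le> (C + D) * (1 + \<bar>of_int n\<bar>) ^ (N + M)"
        by (simp add: algebra_simps)
    qed
  qed blast
  have "pairing w \<phi> = pairing u \<phi> - pairing v \<phi>" for \<phi>
  proof (cases "\<phi> \<in> test_functions")
    case True
    have "((\<lambda>n. torus_coeff \<phi> n * fourier_coeff w (- n)) has_sum
        (pairing u \<phi> / (2 * pi) - pairing v \<phi> / (2 * pi))) UNIV"
      using has_sum_add [OF pairing_has_sum [OF True, of u]
          has_sum_uminusI [OF pairing_has_sum [OF True, of v]]]
      by (simp add: w algebra_simps)
    with pairing_has_sum [OF True, of w]
    have "pairing w \<phi> / (2 * pi) = pairing u \<phi> / (2 * pi) - pairing v \<phi> / (2 * pi)"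
      by (rule has_sum_unique)
    then show ?thesis by (simp add: field_simps)
  qed (simp add: pairing_not_test)
  then have "(\<lambda>\<phi>. pairing u \<phi> - pairing v \<phi>) = pairing w" by (simp add: fun_eq_iff)
  then have "u - v = w" by (simp add: minus_torus_distribution_def pairing_inverse)
  with w show ?thesis by simp
qed

lemma fourier_coeff_dist_deriv: "fourier_coeff (dist_deriv u) n = \<i> * of_int n * fourier_coeff u n"
proof -
  obtain w where w: "fourier_coeff w n = \<i> * of_int n * fourier_coeff u n" for n
  proof (rule distribution_of_poly_bounded)
    show "poly_bounded (\<lambda>n. \<i> * of_int n * fourier_coeff u n)"
      by (rule poly_bounded_mult [OF poly_boundedI [of _ 1 1] poly_bounded_fourier_coeff])
        (simp add: norm_mult)
  qed blast
  have "pairing w \<phi> = - pairing u (deriv_fun \<phi>)" if "\<phi> \<in> test_functions" for \<phi>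
  proof -
    have "((\<lambda>n. torus_coeff \<phi> n * fourier_coeff w (- n)) has_sum
        - (pairing u (deriv_fun \<phi>) / (2 * pi))) UNIV"
      using pairing_has_sum [OF deriv_fun_test_function [OF that], of u]
      by (subst has_sum_uminus [symmetric]) (simp add: w torus_coeff_deriv_fun that algebra_simps)
    with pairing_has_sum [OF that, of w]
    have "pairing w \<phi> / (2 * pi) = - (pairing u (deriv_fun \<phi>) / (2 * pi))"
      by (rule has_sum_unique)
    then show ?thesis by (simp add: field_simps)
  qed
  then have "(\<lambda>\<phi>. if \<phi> \<in> test_functions then - pairing u (deriv_fun \<phi>) else 0) = pairing w"
    by (auto simp: fun_eq_iff pairing_not_test)
  then have "dist_deriv u = w" by (simp add: dist_deriv_def pairing_inverse)
  with w show ?thesis by simp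
qed


section \<open>Riesz-Fischer and the spaces \<open>Hdot\<close>\<close>

lemma integral_trig_poly_mult:
  assumes "finite F" and \<phi>: "\<phi> \<in> test_functions"
  shows "(LINT x|torus_measure. (\<Sum>n\<in>F. c n * fmode n x) * \<phi> x) =
    2 * pi * (\<Sum>n\<in>F. c n * torus_coeff \<phi> (- n))"
proof -
  have "(LINT x|torus_measure. (\<Sum>n\<in>F. c n * fmode n x) * \<phi> x) =
      (LINT x|torus_measure. (\<Sum>n\<in>F. c n * (\<phi> x * fmode n x)))"
    by (simp add: sum_distrib_left sum_distrib_right mult_ac)
  also have "\<dots> = (\<Sum>n\<in>F. LINT x|torus_measure. c n * (\<phi> x * fmode n x))"
    by (intro Bochner_Integration.integral_sum continuous_torus_integrable continuous_intros
        test_functions_continuous \<phi>)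
  also have "\<dots> = (\<Sum>n\<in>F. 2 * pi * (c n * torus_coeff \<phi> (- n)))"
    by (intro sum.cong refl) (simp add: torus_coeff_def)
  finally show ?thesis by (simp add: sum_distrib_left)
qed

lemma torus_L1_le_L2:
  fixes h :: "real \<Rightarrow> complex"
  assumes h: "continuous_on UNIV h"
  shows "(LINT x|torus_measure. norm (h x)) \<le>
    sqrt (2 * pi * (LINT x|torus_measure. (norm (h x))\<^sup>2))"
proof -
  let ?A = "LINT x|torus_measure. norm (h x)" and ?B = "LINT x|torus_measure. (norm (h x))\<^sup>2"
  \<comment> \<open>\<open>m\<close> is the mean of \<open>norm h\<close>; the inequality is the
    nonnegativity of the variance.\<close>
  define m where "m = ?A / (2 * pi)"
  have i: "integrable torus_measure (\<lambda>x. norm (h x))" "integrable torus_measure (\<lambda>x. (norm (h x))\<^sup>2)"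
    "integrable torus_measure (\<lambda>x. 1 :: real)"
    by (intro continuous_torus_integrable continuous_intros h)+
  have "0 \<le> (LINT x|torus_measure. (norm (h x) - m)\<^sup>2)" by simp
  also have "\<dots> = (LINT x|torus_measure. (norm (h x))\<^sup>2 - (2 * m) * norm (h x) + m\<^sup>2 * 1)"
    by (simp add: power2_diff algebra_simps)
  also have "\<dots> = ?B - (2 * m) * ?A + m\<^sup>2 * (2 * pi)"
    using i by (simp add: measure_restrict_space)
  also have "\<dots> = ?B - ?A\<^sup>2 / (2 * pi)"
    by (simp add: m_def power2_eq_square field_simps)
  finally have "?A\<^sup>2 \<le> 2 * pi * ?B" by (simp add: field_simps)
  then show ?thesis by (rule real_le_rsqrt)
qed

text \<open>Squared tails of size \<open>(1 / 4) ^ k\<close> make the \<open>L^2\<close> norms of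
  the blocks between successive radii decay like \<open>(1 / 2) ^ k\<close>, which is summable.
  \<open>Q\<close> is antitone in \<open>k\<close>, so its least witness is monotone.\<close>

lemma ell2_tail_subsequence:
  fixes a :: "int \<Rightarrow> complex"
  assumes "(\<lambda>n. (norm (a n))\<^sup>2) summable_on UNIV"
  obtains r :: "nat \<Rightarrow> nat" where "mono r" "\<And>k. k \<le> r k"
    "\<And>k F. finite F \<Longrightarrow> F \<inter> {- int (r k)..int (r k)} = {} \<Longrightarrow> (\<Sum>n\<in>F. (norm (a n))\<^sup>2) \<le> (1 / 4) ^ k"
proof -
  let ?f = "\<lambda>n. (norm (a n))\<^sup>2"
  define Q where "Q = (\<lambda>k N. k \<le> N \<and> (\<forall>F. finite F \<longrightarrow> F \<inter> {- int N..int N} = {} \<longrightarrow> sum ?f F \<le> (1 / 4) ^ k))"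
  have ex: "\<exists>N. Q k N" for k
  proof -
    have "(\<lambda>N::nat. sum ?f {- int N..int N}) \<longlonglongrightarrow> infsum ?f UNIV"
      by (intro has_sum_imp_symmetric_limit has_sum_infsum assms)
    then have "\<forall>\<^sub>F N in sequentially. infsum ?f UNIV - (1 / 4) ^ k < sum ?f {- int N..int N}"
      by (rule order_tendstoD) simp
    then have "\<forall>\<^sub>F N in sequentially. k \<le> N \<and> infsum ?f UNIV - (1 / 4) ^ k < sum ?f {- int N..int N}"
      using eventually_ge_at_top [of k] by eventually_elim simp
    then obtain N where N: "k \<le> N" "infsum ?f UNIV - (1 / 4) ^ k < sum ?f {- int N..int N}"
      by (auto simp: eventually_sequentially)
    have "sum ?f F \<le> (1 / 4) ^ k" if "finite F" "F \<inter> {- int N..int N} = {}" for F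
    proof -
      have "sum ?f F + sum ?f {- int N..int N} = sum ?f (F \<union> {- int N..int N})"
        by (rule sum.union_disjoint [symmetric]) (use that in auto)
      also have "\<dots> \<le> infsum ?f UNIV"
        by (rule finite_sum_le_infsum) (use that assms in auto)
      finally show ?thesis using N by simp
    qed
    with N show ?thesis by (auto simp: Q_def)
  qed
  have Q_mono: "Q k N" if "Q (Suc k) N" for k N
  proof -
    have "(1 / 4 :: real) ^ Suc k \<le> (1 / 4) ^ k" by simp
    with that show ?thesis unfolding Q_def by (meson Suc_leD order_trans)
  qed
  define r where "r = (\<lambda>k. LEAST N. Q k N)"
  have r: "Q k (r k)" for k unfolding r_def by (rule LeastI_ex [OF ex])
  have "mono r"
    unfolding mono_iff_le_Suc using Q_mono r by (auto simp: r_def intro: Least_le)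
  moreover have "k \<le> r k" for k using r unfolding Q_def by blast
  moreover have "(\<Sum>n\<in>F. (norm (a n))\<^sup>2) \<le> (1 / 4) ^ k"
    if "finite F" "F \<inter> {- int (r k)..int (r k)} = {}" for k F
    using r [of k] that unfolding Q_def by blast
  ultimately show ?thesis by (rule that)
qed

text \<open>Along the subsequence the increments of the partial sums are summable in \<open>L\<^sup>1\<close>, so the
  partial sums converge almost everywhere; Fatou's lemma gives the square integrability.\<close>

lemma riesz_fischer:
  fixes a :: "int \<Rightarrow> complex"
  assumes a: "(\<lambda>n. (norm (a n))\<^sup>2) summable_on UNIV"
  obtains h where "h \<in> borel_measurable torus_measure"
    "integrable torus_measure (\<lambda>x. (norm (h x))\<^sup>2)"
    "\<And>(\<phi> :: real \<Rightarrow> complex) (S :: complex).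
      \<phi> \<in> test_functions \<Longrightarrow> ((\<lambda>n. torus_coeff \<phi> n * a (- n)) has_sum S) UNIV \<Longrightarrow>
      (LINT x|torus_measure. h x * \<phi> x) = 2 * pi * S"
proof -
  obtain r :: "nat \<Rightarrow> nat" where r: "mono r" "\<And>k. k \<le> r k"
    and tail: "\<And>k F. finite F \<Longrightarrow> F \<inter> {- int (r k)..int (r k)} = {} \<Longrightarrow>
      (\<Sum>n\<in>F. (norm (a n))\<^sup>2) \<le> (1 / 4) ^ k"
    using ell2_tail_subsequence [OF a] by blast
  define J where "J = (\<lambda>k. {- int (r k)..int (r k)})"
  have J_mono: "J k \<subseteq> J (Suc k)" and J_fin: "finite (J k)" for k
    using monoD [OF r(1), of k "Suc k"] by (auto simp: J_def)
  define S where "S = (\<lambda>k x. \<Sum>n\<in>J k. a n * fmode n x)"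
  define g where "g = (\<lambda>k x. \<Sum>n\<in>J (Suc k) - J k. a n * fmode n x)"
  have S_cont: "continuous_on UNIV (S k)" and g_cont: "continuous_on UNIV (g k)" for k
    unfolding S_def g_def by (intro continuous_intros)+
  have S_Suc: "S (Suc k) x = S k x + g k x" for k x
    unfolding S_def g_def using sum.subset_diff [OF J_mono J_fin] by (simp add: add.commute)
  have S_eq: "S k x = S 0 x + (\<Sum>j<k. g j x)" for k x
    by (induction k) (simp_all add: S_Suc)
  have g_L1: "(LINT x|torus_measure. norm (g k x)) \<le> (2 * pi) * (1 / 2) ^ k" for k
  proof -
    have "(LINT x|torus_measure. (norm (g k x))\<^sup>2) = 2 * pi * (\<Sum>n\<in>J (Suc k) - J k. (norm (a n))\<^sup>2)"
      unfolding g_def by (rule parseval_trig) (simp add: J_fin)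
    also have "\<dots> \<le> 2 * pi * (1 / 4) ^ k"
      by (intro mult_left_mono tail) (auto simp: J_def)
    finally have "sqrt (2 * pi * (LINT x|torus_measure. (norm (g k x))\<^sup>2)) \<le> sqrt (2 * pi * (2 * pi * (1 / 4) ^ k))"
      by (intro real_sqrt_le_mono mult_left_mono) auto
    also have "2 * pi * (2 * pi * (1 / 4) ^ k) = ((2 * pi) * (1 / 2) ^ k)\<^sup>2"
      by (simp add: power2_eq_square power_mult_distrib [symmetric] algebra_simps)
    finally show ?thesis using torus_L1_le_L2 [OF g_cont, of k] by simp
  qed
  have geo: "summable (\<lambda>k. C * (1 / 2 :: real) ^ k)" for C
    by (intro summable_mult summable_geometric) simp
  have g_int: "integrable torus_measure (g k)" for k
    by (rule continuous_torus_integrable [OF g_cont])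
  have L1: "summable (\<lambda>k. LINT x|torus_measure. norm (g k x))"
    by (rule summable_comparison_test' [OF geo [of "2 * pi"], of 0]) (use g_L1 in simp)
  have ae: "AE x in torus_measure. summable (\<lambda>k. norm (g k x))"
  proof -
    have "(\<integral>\<^sup>+x. (\<Sum>k. ennreal (norm (g k x))) \<partial>torus_measure) = (\<Sum>k. \<integral>\<^sup>+x. ennreal (norm (g k x)) \<partial>torus_measure)"
      by (rule nn_integral_suminf) (use borel_measurable_integrable [OF g_int] in measurable)
    also have "\<dots> = (\<Sum>k. ennreal (LINT x|torus_measure. norm (g k x)))"
      by (subst nn_integral_eq_integral) (use g_int in auto)
    also have "\<dots> = ennreal (\<Sum>k. LINT x|torus_measure. norm (g k x))"
      by (rule suminf_ennreal2 [OF _ L1]) simp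
    finally have "(\<integral>\<^sup>+x. (\<Sum>k. ennreal (norm (g k x))) \<partial>torus_measure) \<noteq> \<infinity>" by simp
    then have "AE x in torus_measure. (\<Sum>k. ennreal (norm (g k x))) \<noteq> \<infinity>"
      by (rule nn_integral_PInf_AE [rotated]) (use borel_measurable_integrable [OF g_int] in measurable)
    then show ?thesis
      by eventually_elim (rule summable_suminf_not_top, simp_all)
  qed
  define h where "h = (\<lambda>x. S 0 x + (\<Sum>k. g k x))"
  have S_int: "integrable torus_measure (S k)" for k
    by (rule continuous_torus_integrable [OF S_cont])
  have h_int: "integrable torus_measure h"
    unfolding h_def by (rule Bochner_Integration.integrable_add [OF S_int integrable_suminf [OF g_int ae L1]])
  then have h_meas: "h \<in> borel_measurable torus_measure" by (rule borel_measurable_integrable)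
  have lim: "AE x in torus_measure. (\<lambda>k. S k x) \<longlonglongrightarrow> h x"
    using ae
  proof eventually_elim
    case (elim x)
    then have "(\<lambda>k. \<Sum>j<k. g j x) \<longlonglongrightarrow> (\<Sum>k. g k x)"
      by (rule summable_LIMSEQ [OF summable_norm_cancel])
    then have "(\<lambda>k. S 0 x + (\<Sum>j<k. g j x)) \<longlonglongrightarrow> h x"
      unfolding h_def by (intro tendsto_intros)
    moreover have "(\<lambda>k. S k x) = (\<lambda>k. S 0 x + (\<Sum>j<k. g j x))"
      by (rule ext) (rule S_eq)
    ultimately show ?case by (simp only:)
  qed
  have sq: "integrable torus_measure (\<lambda>x. (norm (h x))\<^sup>2)"
  proof (rule integrableI_bounded)
    have "(\<integral>\<^sup>+x. ennreal (norm ((norm (h x))\<^sup>2)) \<partial>torus_measure) =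
        (\<integral>\<^sup>+x. liminf (\<lambda>k. ennreal ((norm (S k x))\<^sup>2)) \<partial>torus_measure)"
    proof (rule nn_integral_cong_AE, use lim in eventually_elim)
      fix x assume "(\<lambda>k. S k x) \<longlonglongrightarrow> h x"
      then have "(\<lambda>k. ennreal ((norm (S k x))\<^sup>2)) \<longlonglongrightarrow> ennreal ((norm (h x))\<^sup>2)"
        by (intro tendsto_intros)
      from lim_imp_Liminf [OF trivial_limit_sequentially this]
      show "ennreal (norm ((norm (h x))\<^sup>2)) = liminf (\<lambda>k. ennreal ((norm (S k x))\<^sup>2))"
        by simp
    qed
    also have "\<dots> \<le> liminf (\<lambda>k. \<integral>\<^sup>+x. ennreal ((norm (S k x))\<^sup>2) \<partial>torus_measure)"
      by (rule nn_integral_liminf) (use borel_measurable_integrable [OF S_int] in measurable)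
    also have "\<dots> \<le> ennreal (2 * pi * (\<Sum>\<^sub>\<infinity>n\<in>UNIV. (norm (a n))\<^sup>2))"
    proof (rule order_trans [OF Liminf_le_Limsup Limsup_bounded], simp, rule always_eventually, rule allI)
      fix k
      have "(\<integral>\<^sup>+x. ennreal ((norm (S k x))\<^sup>2) \<partial>torus_measure) =
          ennreal (LINT x|torus_measure. (norm (S k x))\<^sup>2)"
        by (rule nn_integral_eq_integral)
          (auto intro!: continuous_torus_integrable continuous_intros S_cont)
      also have "(LINT x|torus_measure. (norm (S k x))\<^sup>2) = 2 * pi * (\<Sum>n\<in>J k. (norm (a n))\<^sup>2)"
        unfolding S_def by (rule parseval_trig [OF J_fin])
      also have "ennreal \<dots> \<le> ennreal (2 * pi * (\<Sum>\<^sub>\<infinity>n\<in>UNIV. (norm (a n))\<^sup>2))"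
        by (intro ennreal_leI mult_left_mono finite_sum_le_infsum a J_fin) auto
      finally show "(\<integral>\<^sup>+x. ennreal ((norm (S k x))\<^sup>2) \<partial>torus_measure) \<le>
        ennreal (2 * pi * (\<Sum>\<^sub>\<infinity>n\<in>UNIV. (norm (a n))\<^sup>2))" .
    qed
    finally show "(\<integral>\<^sup>+x. ennreal (norm ((norm (h x))\<^sup>2)) \<partial>torus_measure) < \<infinity>"
      by (simp add: order_le_less_trans)
  qed (use h_meas in measurable)
  \<comment> \<open>\<open>h\<close> is expanded as the first partial sum plus the blocks
    \<open>g j\<close>, since it is the blocks that are summable in \<open>L^1\<close>; after
    integration the finite sums are recombined into the coefficients with index in
    \<open>J k\<close>.\<close>
  have pair: "(LINT x|torus_measure. h x * \<phi> x) = 2 * pi * s"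
    if \<phi>: "\<phi> \<in> test_functions" and s: "((\<lambda>n. torus_coeff \<phi> n * a (- n)) has_sum s) UNIV"
    for \<phi> :: "real \<Rightarrow> complex" and s :: complex
  proof -
    have mb: "integrable torus_measure (\<lambda>x. u x * \<phi> x)" if "integrable torus_measure u" for u
      by (rule integrable_mult_bounded [OF that _ norm_le_sup_norm [OF \<phi>]])
        (intro continuous_torus_measurable test_functions_continuous \<phi>)
    have nle: "norm (g k x * \<phi> x) \<le> sup_norm \<phi> * norm (g k x)" for k x
      unfolding norm_mult
      by (subst mult.commute) (intro mult_right_mono norm_le_sup_norm [OF \<phi>] norm_ge_zero)
    have ae': "AE x in torus_measure. summable (\<lambda>k. norm (g k x * \<phi> x))"
      using ae by eventually_elim (auto simp: norm_mult intro: summable_mult2)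
    have L1': "summable (\<lambda>k. LINT x|torus_measure. norm (g k x * \<phi> x))"
    proof (rule summable_comparison_test' [OF summable_mult [OF L1, of "sup_norm \<phi>"], of 0])
      fix k
      have "(LINT x|torus_measure. norm (g k x * \<phi> x)) \<le> (LINT x|torus_measure. sup_norm \<phi> * norm (g k x))"
        by (intro integral_mono Bochner_Integration.integrable_norm mb g_int
            Bochner_Integration.integrable_mult_right nle)
      then show "norm (LINT x|torus_measure. norm (g k x * \<phi> x)) \<le> sup_norm \<phi> * (LINT x|torus_measure. norm (g k x))"
        by simp
    qed
    have "(\<lambda>k. LINT x|torus_measure. g k x * \<phi> x) sums (LINT x|torus_measure. (\<Sum>k. g k x * \<phi> x))"
      by (rule sums_integral [OF mb [OF g_int] ae' L1'])
    then have "(\<lambda>k. (LINT x|torus_measure. S 0 x * \<phi> x) + (\<Sum>j<k. LINT x|torus_measure. g j x * \<phi> x)) \<longlonglongrightarrow>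
        (LINT x|torus_measure. S 0 x * \<phi> x) + (LINT x|torus_measure. (\<Sum>k. g k x * \<phi> x))"
      unfolding sums_def by (intro tendsto_intros)
    moreover have "(LINT x|torus_measure. S 0 x * \<phi> x) + (\<Sum>j<k. LINT x|torus_measure. g j x * \<phi> x) =
        2 * pi * (\<Sum>n\<in>J k. torus_coeff \<phi> (- n) * a n)" for k
    proof -
      have "(LINT x|torus_measure. S k x * \<phi> x) =
          (LINT x|torus_measure. S 0 x * \<phi> x + (\<Sum>j<k. g j x * \<phi> x))"
        by (subst S_eq) (simp only: distrib_right sum_distrib_right)
      also have "\<dots> = (LINT x|torus_measure. S 0 x * \<phi> x) + (\<Sum>j<k. LINT x|torus_measure. g j x * \<phi> x)"
        by (simp add: mb S_int g_int)
      finally show ?thesis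
        unfolding S_def using integral_trig_poly_mult [OF J_fin [of k] \<phi>, of a] by (simp add: mult.commute)
    qed
    moreover have "(LINT x|torus_measure. S 0 x * \<phi> x) + (LINT x|torus_measure. (\<Sum>k. g k x * \<phi> x)) =
        (LINT x|torus_measure. h x * \<phi> x)"
    proof -
      have "(LINT x|torus_measure. S 0 x * \<phi> x) + (LINT x|torus_measure. (\<Sum>k. g k x * \<phi> x)) =
          (LINT x|torus_measure. S 0 x * \<phi> x + (\<Sum>k. g k x * \<phi> x))"
        by (rule Bochner_Integration.integral_add [symmetric, OF mb [OF S_int] integrable_suminf [OF mb [OF g_int] ae' L1']])
      also have "\<dots> = (LINT x|torus_measure. h x * \<phi> x)"
      proof (rule integral_cong_AE)
        show "AE x in torus_measure. S 0 x * \<phi> x + (\<Sum>k. g k x * \<phi> x) = h x * \<phi> x"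
          using ae
        proof eventually_elim
          case (elim x)
          then have "summable (\<lambda>k. g k x)" by (rule summable_norm_cancel)
          then show ?case by (simp add: h_def distrib_right suminf_mult2)
        qed
      qed (intro borel_measurable_integrable Bochner_Integration.integrable_add mb S_int h_int
          integrable_suminf [OF mb [OF g_int] ae' L1'])+
      finally show ?thesis .
    qed
    ultimately have "(\<lambda>k. 2 * pi * (\<Sum>n\<in>J k. torus_coeff \<phi> (- n) * a n)) \<longlonglongrightarrow> (LINT x|torus_measure. h x * \<phi> x)"
      by simp
    moreover have "(\<lambda>k. 2 * pi * (\<Sum>n\<in>J k. torus_coeff \<phi> (- n) * a n)) \<longlonglongrightarrow> 2 * pi * s"
    proof -
      have "((\<lambda>n. torus_coeff \<phi> (- n) * a n) has_sum s) UNIV"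
        using s by (subst has_sum_reindex_bij_witness [of _ uminus uminus]) auto
      then have "(\<lambda>N::nat. \<Sum>n\<in>{- int N..int N}. torus_coeff \<phi> (- n) * a n) \<longlonglongrightarrow> s"
        by (rule has_sum_imp_symmetric_limit)
      then have "(\<lambda>k. \<Sum>n\<in>J k. torus_coeff \<phi> (- n) * a n) \<longlonglongrightarrow> s"
        unfolding J_def
        by (rule filterlim_compose) (rule filterlim_at_top_mono [OF filterlim_ident always_eventually], use r(2) in simp)
      then show ?thesis by (intro tendsto_intros)
    qed
    ultimately show ?thesis by (rule LIMSEQ_unique)
  qed
  from that [OF h_meas sq pair] show ?thesis .
qed

text \<open>Bessel's inequality gives one direction and \<open>riesz_fischer\<close> the other; its
  density represents \<open>v\<close> by \<open>pairing_has_sum\<close>.\<close>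

lemma is_L2_iff: "is_L2 v \<longleftrightarrow> (\<lambda>n. (norm (fourier_coeff v n))\<^sup>2) summable_on UNIV"
proof
  assume "is_L2 v"
  then obtain h where h: "h \<in> borel_measurable torus_measure"
      "integrable torus_measure (\<lambda>x. (norm (h x))\<^sup>2)"
    and p: "\<And>\<phi>. \<phi> \<in> test_functions \<Longrightarrow> pairing v \<phi> = (LINT x|torus_measure. h x * \<phi> x)"
    unfolding is_L2_def by blast
  have "fourier_coeff v = torus_coeff h"
    by (simp add: fun_eq_iff fourier_coeff_eq torus_coeff_def p fmode_test_function)
  with square_integrable_torus_coeff_summable [OF h]
  show "(\<lambda>n. (norm (fourier_coeff v n))\<^sup>2) summable_on UNIV" by simp
next
  assume "(\<lambda>n. (norm (fourier_coeff v n))\<^sup>2) summable_on UNIV"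
  from riesz_fischer [OF this] obtain h where "h \<in> borel_measurable torus_measure"
    "integrable torus_measure (\<lambda>x. (norm (h x))\<^sup>2)"
    and p: "\<And>(\<phi> :: real \<Rightarrow> complex) (S :: complex). \<phi> \<in> test_functions \<Longrightarrow>
      ((\<lambda>n. torus_coeff \<phi> n * fourier_coeff v (- n)) has_sum S) UNIV \<Longrightarrow>
      (LINT x|torus_measure. h x * \<phi> x) = 2 * pi * S"
    by blast
  moreover have "pairing v \<phi> = (LINT x|torus_measure. h x * \<phi> x)" if "\<phi> \<in> test_functions" for \<phi>
    using p [OF that pairing_has_sum [OF that]] by simp
  ultimately show "is_L2 v" unfolding is_L2_def by blast
qed

lemma Hdot_iff:
  "v \<in> Hdot s \<longleftrightarrow> fourier_coeff v 0 = 0 \<and>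
    (\<lambda>n. \<bar>real_of_int n\<bar> powr (2 * s) * (norm (fourier_coeff v n))\<^sup>2) summable_on UNIV"
proof -
  have "(norm (fourier_coeff (Lambda_pow s v) n))\<^sup>2 =
      \<bar>real_of_int n\<bar> powr (2 * s) * (norm (fourier_coeff v n))\<^sup>2" for n
  proof -
    have "\<bar>real_of_int n\<bar> powr (2 * s) = (\<bar>real_of_int n\<bar> powr s)\<^sup>2"
      by (simp only: mult_2 powr_add power2_eq_square)
    then show ?thesis
      by (simp only: fourier_coeff_Lambda_pow norm_mult power_mult_distrib norm_of_real power2_abs)
  qed
  then show ?thesis by (simp add: Hdot_def is_L2_iff)
qed


section \<open>Weighted sequence norms and the bilinear estimate\<close>

text \<open>Sums over the integers are written as integrals against counting measure, so that
  monotone convergence, Cauchy-Schwarz and Tonelli apply to frequencies and times alike, without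
  prior summability.\<close>

abbreviation zsum :: "(int \<Rightarrow> ennreal) \<Rightarrow> ennreal" where
  "zsum f \<equiv> \<integral>\<^sup>+n. f n \<partial>count_space UNIV"

text \<open>Enumerating the integers reduces measurability and Tonelli to the corresponding facts
  for series.\<close>

lemma zsum_eq_suminf: "zsum f = (\<Sum>i. f (int_decode i))"
  using nn_integral_bij_count_space [OF bij_int_decode, of f]
  by (simp add: nn_integral_count_space_nat)

lemma zsum_measurable [measurable]:
  assumes [measurable]: "\<And>n. (\<lambda>x. f x n) \<in> borel_measurable M"
  shows "(\<lambda>x. zsum (f x)) \<in> borel_measurable M"
  unfolding zsum_eq_suminf by measurable

lemma nn_integral_zsum:
  assumes [measurable]: "\<And>n. (\<lambda>x. f x n) \<in> borel_measurable M"
  shows "(\<integral>\<^sup>+x. zsum (f x) \<partial>M) = zsum (\<lambda>n. \<integral>\<^sup>+x. f x n \<partial>M)"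
  unfolding zsum_eq_suminf by (rule nn_integral_suminf) measurable

lemma zsum_swap: "zsum (\<lambda>m. zsum (f m)) = zsum (\<lambda>n. zsum (\<lambda>m. f m n))"
  by (rule nn_integral_zsum) simp

lemma zsum_shift: "zsum (\<lambda>n. f (n + k)) = zsum f"
  by (rule nn_integral_bij_count_space) (rule bij_plus_right)

lemma zsum_term_le: "f n \<le> zsum f"
proof -
  have "(\<integral>\<^sup>+k. f n * indicator {n} k \<partial>count_space UNIV) \<le> zsum f"
    by (rule nn_integral_mono) (simp add: indicator_def)
  then show ?thesis by (simp add: nn_integral_cmult_indicator)
qed

text \<open>\<open>lam\<close> plays two parts: it is the symbol of \<open>\<Lambda>^3\<close>,
  hence the decay rate in time, and it is the weight of the squared norm of \<open>H^(3/2)\<close>.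
  The weights of \<open>H^(9/4)\<close> and \<open>H^3\<close> are \<open>wgt\<close> and the square
  of \<open>lam\<close>.\<close>

definition lam :: "int \<Rightarrow> real" where "lam n = \<bar>real_of_int n\<bar> ^ 3"

definition wgt :: "int \<Rightarrow> real" where "wgt n = sqrt (lam n) * lam n"

lemma lam_nonneg [simp]: "0 \<le> lam n" and lam_0 [simp]: "lam 0 = 0"
  by (simp_all add: lam_def)

lemma lam_ge_1: "n \<noteq> 0 \<Longrightarrow> 1 \<le> lam n"
  unfolding lam_def by (rule one_le_power) linarith

lemma lam_pos: "n \<noteq> 0 \<Longrightarrow> 0 < lam n"
  using lam_ge_1 [of n] by linarith

lemma wgt_nonneg [simp]: "0 \<le> wgt n" and wgt_0 [simp]: "wgt 0 = 0"
  by (simp_all add: wgt_def)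

lemma wgt_pos: "n \<noteq> 0 \<Longrightarrow> 0 < wgt n"
  using lam_pos [of n] by (simp add: wgt_def)

lemma lam_powr: "lam n = \<bar>real_of_int n\<bar> powr 3"
  by (simp add: lam_def)

lemma wgt_powr: "wgt n = \<bar>real_of_int n\<bar> powr (9 / 2)"
proof -
  have "sqrt (lam n) = \<bar>real_of_int n\<bar> powr (3 / 2)"
    unfolding lam_powr by (subst powr_half_sqrt [symmetric]) (simp_all only: powr_powr powr_ge_zero, simp)
  then have "wgt n = \<bar>real_of_int n\<bar> powr (3 / 2) * \<bar>real_of_int n\<bar> powr 3"
    by (simp only: wgt_def lam_powr)
  also have "\<dots> = \<bar>real_of_int n\<bar> powr (9 / 2)"
    by (subst powr_add [symmetric]) simp
  finally show ?thesis .
qed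

definition wsq :: "(int \<Rightarrow> real) \<Rightarrow> (int \<Rightarrow> ennreal) \<Rightarrow> ennreal" where
  "wsq \<phi> v = zsum (\<lambda>n. ennreal (\<phi> n) * (v n)\<^sup>2)"

lemma wsq_measurable [measurable]:
  assumes [measurable]: "\<And>n. (\<lambda>x. v x n) \<in> borel_measurable M"
  shows "(\<lambda>x. wsq \<phi> (v x)) \<in> borel_measurable M"
  unfolding wsq_def by measurable

lemma wsq_mono: "(\<And>n. u n \<le> v n) \<Longrightarrow> wsq \<phi> u \<le> wsq \<phi> v"
  unfolding wsq_def by (intro nn_integral_mono mult_left_mono power_mono) auto

lemma ennreal_add_power2_le: "(x + y)\<^sup>2 \<le> 2 * (x\<^sup>2 + y\<^sup>2)" for x y :: ennreal
proof -
  have "(x + y)\<^sup>2 \<le> 2 * (x\<^sup>2 + y\<^sup>2)" if "x < top" "y < top"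
  proof -
    obtain a b where ab: "x = ennreal a" "y = ennreal b" "0 \<le> a" "0 \<le> b"
      using \<open>x < top\<close> \<open>y < top\<close> by (metis ennreal_cases less_irrefl)
    have "(a + b)\<^sup>2 \<le> 2 * (a\<^sup>2 + b\<^sup>2)"
      using sum_squares_bound [of a b] by (simp add: power2_sum)
    moreover have "(x + y)\<^sup>2 = ennreal ((a + b)\<^sup>2)"
      using ab by (subst ennreal_power [symmetric]) simp_all
    moreover have "2 * (x\<^sup>2 + y\<^sup>2) = ennreal (2 * (a\<^sup>2 + b\<^sup>2))"
      using ab by (simp add: ennreal_mult ennreal_power)
    ultimately show ?thesis by (simp only: ennreal_leI)
  qed
  moreover have "2 * (x\<^sup>2 + y\<^sup>2) = top" if "\<not> (x < top \<and> y < top)"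
    using that by (auto simp: not_less top_unique ennreal_mult_top)
  ultimately show ?thesis by (metis top_greatest)
qed

lemma wsq_add_le: "wsq \<phi> (\<lambda>n. u n + v n) \<le> 2 * (wsq \<phi> u + wsq \<phi> v)"
proof -
  have "wsq \<phi> (\<lambda>n. u n + v n) \<le> zsum (\<lambda>n. 2 * (ennreal (\<phi> n) * (u n)\<^sup>2 + ennreal (\<phi> n) * (v n)\<^sup>2))"
    unfolding wsq_def
  proof (rule nn_integral_mono)
    fix n
    show "ennreal (\<phi> n) * (u n + v n)\<^sup>2 \<le> 2 * (ennreal (\<phi> n) * (u n)\<^sup>2 + ennreal (\<phi> n) * (v n)\<^sup>2)"
      using mult_left_mono [OF ennreal_add_power2_le [of "u n" "v n"], of "ennreal (\<phi> n)"]
      by (simp add: algebra_simps)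
  qed
  also have "\<dots> = 2 * (wsq \<phi> u + wsq \<phi> v)"
    unfolding wsq_def by (simp add: nn_integral_cmult nn_integral_add)
  finally show ?thesis .
qed

text \<open>The weight \<open>wgt\<close> is the geometric mean of \<open>lam\<close> and \<open>lam\<^sup>2\<close>: this is the interpolation of
  \<open>H\<^sup>9\<^sup>/\<^sup>4\<close> between \<open>H\<^sup>3\<^sup>/\<^sup>2\<close> and \<open>H\<^sup>3\<close>.\<close>

lemma wsq_interpolation: "(wsq wgt v)\<^sup>2 \<le> wsq lam v * wsq (\<lambda>n. (lam n)\<^sup>2) v"
proof -
  have "wsq wgt v = zsum (\<lambda>n. (ennreal (sqrt (lam n)) * v n) * (ennreal (lam n) * v n))"
    unfolding wsq_def wgt_def by (simp add: ennreal_mult power2_eq_square mult_ac)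
  moreover have "(\<dots>)\<^sup>2 \<le> zsum (\<lambda>n. (ennreal (sqrt (lam n)) * v n)\<^sup>2) * zsum (\<lambda>n. (ennreal (lam n) * v n)\<^sup>2)"
    by (rule Cauchy_Schwarz_nn_integral) simp_all
  moreover have "(ennreal (sqrt (lam n)) * v n)\<^sup>2 = ennreal (lam n) * (v n)\<^sup>2" for n
    by (simp add: power_mult_distrib ennreal_power)
  moreover have "(ennreal (lam n) * v n)\<^sup>2 = ennreal ((lam n)\<^sup>2) * (v n)\<^sup>2" for n
    by (simp add: power_mult_distrib ennreal_power)
  ultimately show ?thesis unfolding wsq_def by simp
qed

text \<open>The symbol \<open>n * (sgn n - sgn k) * \<bar>k\<bar>^3\<close> of the nonlinearity,
  written so that its sign and support are visible. The factor \<open>2\<close> is the difference of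
  two opposite signs; if \<open>n\<close> or \<open>k\<close> is \<open>0\<close>, the symbol
  vanishes as well.\<close>

definition nlker :: "int \<Rightarrow> int \<Rightarrow> real" where
  "nlker n k = (if n * k < 0 then 2 * \<bar>real_of_int n\<bar> * \<bar>real_of_int k\<bar> ^ 3 else 0)"

lemma nlker_nonneg [simp]: "0 \<le> nlker n k"
  by (simp add: nlker_def)

lemma nlker_0 [simp]: "nlker 0 k = 0" "nlker n 0 = 0"
  by (simp_all add: nlker_def)

text \<open>The two arguments are separate because differences of solutions are estimated by
  \<open>nle\<close> applied to a difference and a solution.\<close>

definition nle :: "(int \<Rightarrow> ennreal) \<Rightarrow> (int \<Rightarrow> ennreal) \<Rightarrow> int \<Rightarrow> ennreal" where
  "nle u v n = zsum (\<lambda>k. ennreal (nlker n k) * (u (n - k) * v k))"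

lemma nle_0 [simp]: "nle u v 0 = 0"
  by (simp add: nle_def)

lemma nle_measurable [measurable]:
  assumes [measurable]: "\<And>n. (\<lambda>x. u x n) \<in> borel_measurable M" "\<And>n. (\<lambda>x. v x n) \<in> borel_measurable M"
  shows "(\<lambda>x. nle (u x) (v x) n) \<in> borel_measurable M"
  unfolding nle_def by measurable

lemma nle_mono:
  "(\<And>n. u n \<le> u' n) \<Longrightarrow> (\<And>n. v n \<le> v' n) \<Longrightarrow> nle u v n \<le> nle u' v' n"
  unfolding nle_def by (intro nn_integral_mono mult_left_mono mult_mono) auto

text \<open>In terms of \<open>m = n - k\<close>, opposite signs mean
  \<open>\<bar>m\<bar> = \<bar>n\<bar> + \<bar>k\<bar>\<close>. After the weight of exponent
  \<open>- 9/2\<close> the frequency \<open>k\<close> keeps the exponent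
  \<open>6 - 9/2 = 3/2\<close>; since this is nonnegative, both \<open>\<bar>k\<bar>\<close> and
  \<open>\<bar>n\<bar>\<close> may be replaced by \<open>\<bar>m\<bar>\<close>.\<close>

lemma nlker_weighted_le:
  "(nlker (m + k) k)\<^sup>2 * \<bar>real_of_int k\<bar> powr (- 9 / 2) \<le>
    4 * \<bar>real_of_int m\<bar> powr (7 / 2) * indicator {- \<bar>m\<bar>..\<bar>m\<bar>} k"
proof (cases "(m + k) * k < 0")
  case True
  then have k: "k \<noteq> 0" "\<bar>k\<bar> \<le> \<bar>m\<bar>" "\<bar>m + k\<bar> \<le> \<bar>m\<bar>" by (auto simp: mult_less_0_iff)
  then have kr: "\<bar>real_of_int k\<bar> \<le> \<bar>real_of_int m\<bar>" "\<bar>real_of_int (m + k)\<bar> \<le> \<bar>real_of_int m\<bar>" by linarith+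
  have "(nlker (m + k) k)\<^sup>2 * \<bar>real_of_int k\<bar> powr (- 9 / 2) =
      4 * \<bar>real_of_int (m + k)\<bar>\<^sup>2 * (\<bar>real_of_int k\<bar> ^ 6 * \<bar>real_of_int k\<bar> powr (- 9 / 2))"
    using True by (simp add: nlker_def power_mult_distrib flip: power_mult)
  also have "\<bar>real_of_int k\<bar> ^ 6 = \<bar>real_of_int k\<bar> powr 6" by simp
  also have "\<bar>real_of_int k\<bar> powr 6 * \<bar>real_of_int k\<bar> powr (- 9 / 2) = \<bar>real_of_int k\<bar> powr (3 / 2)"
    by (subst powr_add [symmetric]) simp
  also have "4 * \<bar>real_of_int (m + k)\<bar>\<^sup>2 * \<bar>real_of_int k\<bar> powr (3 / 2) \<le>
      4 * \<bar>real_of_int m\<bar>\<^sup>2 * \<bar>real_of_int m\<bar> powr (3 / 2)"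
    using kr by (intro mult_mono power_mono powr_mono2) auto
  also have "\<bar>real_of_int m\<bar>\<^sup>2 = \<bar>real_of_int m\<bar> powr 2" by simp
  also have "4 * \<bar>real_of_int m\<bar> powr 2 * \<bar>real_of_int m\<bar> powr (3 / 2) = 4 * \<bar>real_of_int m\<bar> powr (7 / 2)"
    by (subst mult.assoc, subst powr_add [symmetric]) simp
  finally show ?thesis using k by (simp add: indicator_def abs_le_iff)
qed (simp add: nlker_def)

text \<open>At most \<open>2 * \<bar>m\<bar> + 1 \<le> 3 * \<bar>m\<bar>\<close> frequencies
  contribute, which raises the exponent from \<open>7/2\<close> to \<open>9/2\<close> and gives
  \<open>12 = 4 * 3\<close>.\<close>

lemma zsum_nlker_weighted_le:
  "zsum (\<lambda>k. ennreal ((nlker (m + k) k)\<^sup>2 * \<bar>real_of_int k\<bar> powr (- 9 / 2))) \<le> ennreal (12 * wgt m)"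
proof (cases "m = 0")
  case True
  have "nlker k k = 0" for k by (simp add: nlker_def not_less)
  with True show ?thesis by simp
next
  case False
  have "zsum (\<lambda>k. ennreal ((nlker (m + k) k)\<^sup>2 * \<bar>real_of_int k\<bar> powr (- 9 / 2))) \<le>
      zsum (\<lambda>k. ennreal (4 * \<bar>real_of_int m\<bar> powr (7 / 2)) * indicator {- \<bar>m\<bar>..\<bar>m\<bar>} k)"
  proof (rule nn_integral_mono)
    fix k
    show "ennreal ((nlker (m + k) k)\<^sup>2 * \<bar>real_of_int k\<bar> powr (- 9 / 2)) \<le>
      ennreal (4 * \<bar>real_of_int m\<bar> powr (7 / 2)) * indicator {- \<bar>m\<bar>..\<bar>m\<bar>} k"
      using ennreal_leI [OF nlker_weighted_le [of m k]]
      by (rule order_trans) (simp add: indicator_def)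
  qed
  also have "\<dots> = ennreal (4 * \<bar>real_of_int m\<bar> powr (7 / 2)) * ennreal (real_of_int (2 * \<bar>m\<bar> + 1))"
    by (simp add: nn_integral_cmult_indicator ennreal_of_nat_eq_real_of_nat)
  also have "\<dots> = ennreal (4 * \<bar>real_of_int m\<bar> powr (7 / 2) * real_of_int (2 * \<bar>m\<bar> + 1))"
    by (simp add: ennreal_mult)
  also have "\<dots> \<le> ennreal (4 * \<bar>real_of_int m\<bar> powr (7 / 2) * (3 * \<bar>real_of_int m\<bar> powr 1))"
  proof (intro ennreal_leI mult_left_mono)
    have "1 \<le> \<bar>m\<bar>" using False by linarith
    then have "1 \<le> \<bar>real_of_int m\<bar>" by linarith
    then show "real_of_int (2 * \<bar>m\<bar> + 1) \<le> 3 * \<bar>real_of_int m\<bar> powr 1" by simp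
  qed simp
  also have "4 * \<bar>real_of_int m\<bar> powr (7 / 2) * (3 * \<bar>real_of_int m\<bar> powr 1) =
      12 * (\<bar>real_of_int m\<bar> powr (7 / 2) * \<bar>real_of_int m\<bar> powr 1)" by (simp only: mult_ac)
  also have "\<bar>real_of_int m\<bar> powr (7 / 2) * \<bar>real_of_int m\<bar> powr 1 = wgt m"
    unfolding wgt_powr powr_add [symmetric] by simp
  finally show ?thesis .
qed

text \<open>Cauchy-Schwarz in \<open>k\<close> puts the whole kernel on the factor \<open>u\<close>, whose frequency
  \<open>m = n - k\<close> dominates \<open>n\<close> and \<open>k\<close> on the support \<open>n * k < 0\<close>.\<close>

lemma nle_bilinear_estimate: "zsum (\<lambda>n. (nle u v n)\<^sup>2) \<le> 12 * wsq wgt u * wsq wgt v"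
proof -
  define c where "c = (\<lambda>n k. (nlker n k)\<^sup>2 * \<bar>real_of_int k\<bar> powr (- 9 / 2))"
  have "(nle u v n)\<^sup>2 \<le> zsum (\<lambda>k. ennreal (c n k) * (u (n - k))\<^sup>2) * wsq wgt v" for n
  proof -
    let ?f = "\<lambda>k. ennreal (nlker n k * \<bar>real_of_int k\<bar> powr (- 9 / 4)) * u (n - k)"
    let ?g = "\<lambda>k. ennreal (\<bar>real_of_int k\<bar> powr (9 / 4)) * v k"
    \<comment> \<open>The inserted weights cancel except at \<open>k = 0\<close>, where the kernel
      itself vanishes.\<close>
    have "ennreal (nlker n k) * (u (n - k) * v k) = ?f k * ?g k" for k
    proof (cases "k = 0")
      case False
      then have "\<bar>real_of_int k\<bar> powr (- 9 / 4) * \<bar>real_of_int k\<bar> powr (9 / 4) = 1"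
        by (simp flip: powr_add)
      then have "ennreal (nlker n k) =
          ennreal (nlker n k * \<bar>real_of_int k\<bar> powr (- 9 / 4)) * ennreal (\<bar>real_of_int k\<bar> powr (9 / 4))"
        by (simp add: mult.assoc flip: ennreal_mult)
      then show ?thesis by (simp add: mult_ac)
    qed simp
    then have "nle u v n = zsum (\<lambda>k. ?f k * ?g k)" by (simp add: nle_def)
    moreover have "(zsum (\<lambda>k. ?f k * ?g k))\<^sup>2 \<le> zsum (\<lambda>k. (?f k)\<^sup>2) * zsum (\<lambda>k. (?g k)\<^sup>2)"
      by (rule Cauchy_Schwarz_nn_integral) simp_all
    moreover have "(?f k)\<^sup>2 = ennreal (c n k) * (u (n - k))\<^sup>2" for k
      unfolding power_mult_distrib c_def
      by (simp add: ennreal_power power_mult_distrib power2_eq_square [of "_ powr _"] flip: powr_add)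
    moreover have "(?g k)\<^sup>2 = ennreal (wgt k) * (v k)\<^sup>2" for k
      unfolding power_mult_distrib wgt_powr
      by (simp add: ennreal_power power2_eq_square [of "_ powr _"] flip: powr_add)
    ultimately show ?thesis unfolding wsq_def by simp
  qed
  then have "zsum (\<lambda>n. (nle u v n)\<^sup>2) \<le> zsum (\<lambda>n. zsum (\<lambda>k. ennreal (c n k) * (u (n - k))\<^sup>2) * wsq wgt v)"
    by (intro nn_integral_mono)
  also have "\<dots> = zsum (\<lambda>n. zsum (\<lambda>k. ennreal (c n k) * (u (n - k))\<^sup>2)) * wsq wgt v"
    by (rule nn_integral_multc) simp
  also have "zsum (\<lambda>n. zsum (\<lambda>k. ennreal (c n k) * (u (n - k))\<^sup>2)) =
      zsum (\<lambda>k. zsum (\<lambda>n. ennreal (c n k) * (u (n - k))\<^sup>2))" by (rule zsum_swap)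
  also have "\<dots> = zsum (\<lambda>k. zsum (\<lambda>m. ennreal (c (m + k) k) * (u m)\<^sup>2))"
  proof (rule nn_integral_cong)
    fix k
    show "zsum (\<lambda>n. ennreal (c n k) * (u (n - k))\<^sup>2) = zsum (\<lambda>m. ennreal (c (m + k) k) * (u m)\<^sup>2)"
      using zsum_shift [of "\<lambda>n. ennreal (c n k) * (u (n - k))\<^sup>2" k] by simp
  qed
  also have "\<dots> = zsum (\<lambda>m. zsum (\<lambda>k. ennreal (c (m + k) k) * (u m)\<^sup>2))" by (rule zsum_swap)
  also have "\<dots> = zsum (\<lambda>m. zsum (\<lambda>k. ennreal (c (m + k) k)) * (u m)\<^sup>2)"
    by (intro nn_integral_cong nn_integral_multc) simp
  also have "\<dots> \<le> zsum (\<lambda>m. ennreal (12 * wgt m) * (u m)\<^sup>2)"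
    unfolding c_def by (intro nn_integral_mono mult_right_mono zsum_nlker_weighted_le) simp
  also have "\<dots> = 12 * wsq wgt u"
    unfolding wsq_def by (simp add: ennreal_mult mult.assoc nn_integral_cmult)
  finally show ?thesis by (simp add: mult_right_mono)
qed


section \<open>Parabolic smoothing\<close>

lemma sigma_finite_lebesgue_on:
  assumes "I \<in> sets lebesgue" shows "sigma_finite_measure (lebesgue_on I :: real measure)"
proof -
  obtain A :: "real set set" where A: "countable A" "A \<subseteq> sets lborel" "\<Union>A = space lborel"
      "\<forall>a\<in>A. emeasure lborel a \<noteq> \<infinity>"
    using lborel.sigma_finite_countable by blast
  have "sigma_finite_measure (lebesgue :: real measure)"
  proof
    show "\<exists>A. countable A \<and> A \<subseteq> sets lebesgue \<and> \<Union>A = space (lebesgue :: real measure) \<and>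
        (\<forall>a\<in>A. emeasure lebesgue a \<noteq> \<infinity>)"
      using A by (intro exI [of _ A]) auto
  qed
  then show ?thesis using assms by (intro sigma_finite_measure_restrict_space) simp_all
qed

lemma nn_integral_exp_half_line:
  assumes "0 < l"
  shows "(\<integral>\<^sup>+x. (if 0 \<le> x then ennreal (exp (- (l * x))) else 0) \<partial>lborel) = ennreal (1 / l)"
proof -
  have "(\<integral>\<^sup>+x. ennreal (exp (- (l * x))) * indicator {0..} x \<partial>lborel) = ennreal (0 - (- exp (- (l * 0)) / l))"
  proof (rule nn_integral_FTC_atLeast)
    show "((\<lambda>x. - exp (- (l * x)) / l) has_real_derivative exp (- (l * x))) (at x)" for x
      using assms by (auto intro!: derivative_eq_intros)
    have "((\<lambda>x. - (exp (- (l * x)) / l)) \<longlongrightarrow> - (0 / l)) at_top"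
    proof (intro tendsto_intros)
      have "filterlim (\<lambda>x. l * x) at_top at_top"
        using assms by (intro filterlim_tendsto_pos_mult_at_top [OF tendsto_const] filterlim_ident)
      then have "filterlim (\<lambda>x. - (l * x)) at_bot at_top"
        by (simp add: filterlim_uminus_at_top)
      then show "((\<lambda>x. exp (- (l * x))) \<longlongrightarrow> 0) at_top"
        by (rule filterlim_compose [OF exp_at_bot])
      show "l \<noteq> 0" using assms by simp
    qed
    then show "((\<lambda>x. - exp (- (l * x)) / l) \<longlongrightarrow> 0) at_top" by simp
  qed simp_all
  moreover have "ennreal (exp (- (l * x))) * indicator {0..} x = (if 0 \<le> x then ennreal (exp (- (l * x))) else 0)" for x
    by (simp add: indicator_def)
  ultimately show ?thesis by simp
qed

text \<open>Extension by \<open>0\<close> to \<open>s > t\<close> lets the Duhamel integral run over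
  the whole of \<open>I\<close> for every \<open>t\<close>, so that Tonelli applies to the pair of
  times.\<close>

definition hk :: "int \<Rightarrow> real \<Rightarrow> real \<Rightarrow> ennreal" where
  "hk n t s = (if s \<le> t then ennreal (exp (- (lam n * (t - s)))) else 0)"

lemma hk_le_1: "hk n t s \<le> 1"
  by (simp add: hk_def ennreal_le_1)

lemma hk_measurable_left [measurable]: "(\<lambda>t. hk n t s) \<in> borel_measurable borel"
  and hk_measurable_right [measurable]: "hk n t \<in> borel_measurable borel"
  unfolding hk_def by measurable

lemma lam_hk_integral_right_lborel: "ennreal (lam n) * (\<integral>\<^sup>+s. hk n t s \<partial>lborel) \<le> 1"
proof (cases "n = 0")
  case False
  have "(\<integral>\<^sup>+s. hk n t s \<partial>lborel) = ennreal \<bar>- 1\<bar> * (\<integral>\<^sup>+x. hk n t (t + - 1 * x) \<partial>lborel)"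
    by (rule nn_integral_real_affine) simp_all
  also have "\<dots> = (\<integral>\<^sup>+x. (if 0 \<le> x then ennreal (exp (- (lam n * x))) else 0) \<partial>lborel)"
    by (simp add: hk_def cong: if_cong)
  also have "\<dots> = ennreal (1 / lam n)" by (rule nn_integral_exp_half_line [OF lam_pos [OF False]])
  finally show ?thesis
    using lam_pos [OF False] by (simp flip: ennreal_mult)
qed simp

lemma lam_hk_integral_left_lborel: "ennreal (lam n) * (\<integral>\<^sup>+t. hk n t s \<partial>lborel) \<le> 1"
proof (cases "n = 0")
  case False
  have "(\<integral>\<^sup>+t. hk n t s \<partial>lborel) = ennreal \<bar>1\<bar> * (\<integral>\<^sup>+x. hk n (s + 1 * x) s \<partial>lborel)"
    by (rule nn_integral_real_affine) simp_all
  also have "\<dots> = (\<integral>\<^sup>+x. (if 0 \<le> x then ennreal (exp (- (lam n * x))) else 0) \<partial>lborel)"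
    by (simp add: hk_def cong: if_cong)
  also have "\<dots> = ennreal (1 / lam n)" by (rule nn_integral_exp_half_line [OF lam_pos [OF False]])
  finally show ?thesis
    using lam_pos [OF False] by (simp flip: ennreal_mult)
qed simp

lemma nn_integral_lebesgue_on_le:
  assumes "I \<in> sets lebesgue"
  shows "(\<integral>\<^sup>+x. f x \<partial>lebesgue_on I) \<le> (\<integral>\<^sup>+x. f x \<partial>lborel)"
proof -
  have "(\<integral>\<^sup>+x. f x \<partial>lebesgue_on I) = (\<integral>\<^sup>+x. f x * indicator I x \<partial>lebesgue)"
    using assms by (intro nn_integral_restrict_space) simp
  also have "\<dots> \<le> (\<integral>\<^sup>+x. f x \<partial>lebesgue)"
    by (intro nn_integral_mono) (simp add: indicator_def)
  finally show ?thesis by (simp add: nn_integral_completion)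
qed

text \<open>\<open>wsq wgt\<close> is already a square, so this is the fourth power of the norm of
  \<open>L^4\<close> in time with values in \<open>H^(9/4)\<close>.\<close>

definition x4 :: "real measure \<Rightarrow> (real \<Rightarrow> int \<Rightarrow> ennreal) \<Rightarrow> ennreal" where
  "x4 M v = (\<integral>\<^sup>+t. (wsq wgt (v t))\<^sup>2 \<partial>M)"

definition heat_maj :: "(int \<Rightarrow> real) \<Rightarrow> real \<Rightarrow> int \<Rightarrow> ennreal" where
  "heat_maj a t n = ennreal (exp (- (lam n * t)) * a n)"

text \<open>Bounded intervals from \<open>0\<close> and the half-line are treated together. By
  \<open>I_down\<close>, an integral over \<open>I\<close> cut off at \<open>t\<close> is an
  integral over \<open>{0..t}\<close>.\<close>

locale time_interval =
  fixes I :: "real set"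
  assumes I_sets [measurable]: "I \<in> sets lebesgue"
    and I_nonneg: "t \<in> I \<Longrightarrow> 0 \<le> t"
    and I_down: "t \<in> I \<Longrightarrow> {0..t} \<subseteq> I"
begin

abbreviation M :: "real measure" where "M \<equiv> lebesgue_on I"

sublocale sigma_finite_measure M
  by (rule sigma_finite_lebesgue_on [OF I_sets])

lemma space_M [simp]: "space M = I" by simp

lemma borel_measurable_M: "f \<in> borel_measurable borel \<Longrightarrow> f \<in> borel_measurable M"
  by (rule measurable_restrict_space1) (rule measurable_completion, simp)

lemma ident_measurable_M [measurable]: "(\<lambda>x. x) \<in> borel_measurable M"
  by (rule borel_measurable_M) simp

lemma hk_measurable_pair [measurable]:
  "(\<lambda>x. hk n (fst x) (snd x)) \<in> borel_measurable (M \<Otimes>\<^sub>M M)"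
proof -
  have [measurable]: "(\<lambda>x. fst x :: real) \<in> borel_measurable (M \<Otimes>\<^sub>M M)"
    "(\<lambda>x. snd x :: real) \<in> borel_measurable (M \<Otimes>\<^sub>M M)"
    using measurable_compose [OF measurable_fst ident_measurable_M]
      measurable_compose [OF measurable_snd ident_measurable_M] by simp_all
  show ?thesis unfolding hk_def by measurable
qed

lemma hk_measurable_M [measurable]: "hk n t \<in> borel_measurable M" "(\<lambda>t. hk n t s) \<in> borel_measurable M"
  by (rule borel_measurable_M, measurable)+

lemma lam_hk_integral_right: "ennreal (lam n) * (\<integral>\<^sup>+s. hk n t s \<partial>M) \<le> 1"
  by (rule order_trans [OF mult_left_mono [OF nn_integral_lebesgue_on_le [OF I_sets]] lam_hk_integral_right_lborel]) simp

lemma lam_hk_integral_left: "ennreal (lam n) * (\<integral>\<^sup>+t. hk n t s \<partial>M) \<le> 1"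
  by (rule order_trans [OF mult_left_mono [OF nn_integral_lebesgue_on_le [OF I_sets]] lam_hk_integral_left_lborel]) simp

definition duh :: "(real \<Rightarrow> int \<Rightarrow> ennreal) \<Rightarrow> real \<Rightarrow> int \<Rightarrow> ennreal" where
  "duh h t n = (\<integral>\<^sup>+s. hk n t s * h s n \<partial>M)"

lemma duh_measurable [measurable]:
  assumes [measurable]: "(\<lambda>s. h s n) \<in> borel_measurable M"
  shows "(\<lambda>t. duh h t n) \<in> borel_measurable M"
proof -
  have [measurable]: "(\<lambda>x. h (snd x) n) \<in> borel_measurable (M \<Otimes>\<^sub>M M)"
    using measurable_compose [OF measurable_snd assms] by simp
  have "(\<lambda>(t, s). hk n t s * h s n) \<in> borel_measurable (M \<Otimes>\<^sub>M M)"
    unfolding split_beta' by measurable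
  then show ?thesis unfolding duh_def by (rule borel_measurable_nn_integral)
qed

lemma duh_mono: "(\<And>s. s \<in> I \<Longrightarrow> h s n \<le> h' s n) \<Longrightarrow> duh h t n \<le> duh h' t n"
  unfolding duh_def by (intro nn_integral_mono mult_left_mono) auto

text \<open>Cauchy-Schwarz in time: since \<open>hk \<le> 1\<close>, the square of the kernel
  integrates to at most \<open>1 / lam n\<close>. This is the source of the uniform bound in
  \<open>H^(3/2)\<close>.\<close>

lemma duh_sup_estimate:
  assumes [measurable]: "(\<lambda>s. h s n) \<in> borel_measurable M"
  shows "ennreal (lam n) * (duh h t n)\<^sup>2 \<le> (\<integral>\<^sup>+s. (h s n)\<^sup>2 \<partial>M)"
proof -
  have "(duh h t n)\<^sup>2 \<le> (\<integral>\<^sup>+s. (hk n t s)\<^sup>2 \<partial>M) * (\<integral>\<^sup>+s. (h s n)\<^sup>2 \<partial>M)"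
    unfolding duh_def by (rule Cauchy_Schwarz_nn_integral) measurable
  also have "\<dots> \<le> (\<integral>\<^sup>+s. hk n t s \<partial>M) * (\<integral>\<^sup>+s. (h s n)\<^sup>2 \<partial>M)"
  proof (intro mult_right_mono nn_integral_mono)
    fix s show "(hk n t s)\<^sup>2 \<le> hk n t s"
      using mult_left_mono [OF hk_le_1, of "hk n t s"] by (simp add: power2_eq_square)
  qed simp
  finally have "ennreal (lam n) * (duh h t n)\<^sup>2 \<le>
      (ennreal (lam n) * (\<integral>\<^sup>+s. hk n t s \<partial>M)) * (\<integral>\<^sup>+s. (h s n)\<^sup>2 \<partial>M)"
    by (simp add: mult.assoc mult_left_mono)
  also have "\<dots> \<le> 1 * (\<integral>\<^sup>+s. (h s n)\<^sup>2 \<partial>M)"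
    by (intro mult_right_mono lam_hk_integral_right) simp
  finally show ?thesis by simp
qed

text \<open>Schur's test: both marginal integrals of \<open>hk\<close> are at most
  \<open>1 / lam n\<close>. The kernel is split as \<open>r * r\<close>, with \<open>r\<close> its
  square root, so that one factor in Cauchy-Schwarz is a marginal.\<close>

lemma duh_L2_estimate:
  assumes h [measurable]: "(\<lambda>s. h s n) \<in> borel_measurable M"
  shows "(\<integral>\<^sup>+t. ennreal ((lam n)\<^sup>2) * (duh h t n)\<^sup>2 \<partial>M) \<le> (\<integral>\<^sup>+s. (h s n)\<^sup>2 \<partial>M)"
proof -
  define r where "r = (\<lambda>t s. if s \<le> t then ennreal (exp (- (lam n * (t - s)) / 2)) else 0)"
  have r2: "r t s * r t s = hk n t s" for t s
    by (simp add: r_def hk_def flip: ennreal_mult exp_add)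
  have [measurable]: "r t \<in> borel_measurable M" for t
    unfolding r_def by measurable
  have pt: "ennreal ((lam n)\<^sup>2) * (duh h t n)\<^sup>2 \<le> ennreal (lam n) * (\<integral>\<^sup>+s. hk n t s * (h s n)\<^sup>2 \<partial>M)" for t
  proof -
    have "duh h t n = (\<integral>\<^sup>+s. r t s * (r t s * h s n) \<partial>M)"
      unfolding duh_def mult.assoc [symmetric] r2 ..
    also have "\<dots>\<^sup>2 \<le> (\<integral>\<^sup>+s. (r t s)\<^sup>2 \<partial>M) * (\<integral>\<^sup>+s. (r t s * h s n)\<^sup>2 \<partial>M)"
      by (rule Cauchy_Schwarz_nn_integral) measurable
    also have "\<dots> = (\<integral>\<^sup>+s. hk n t s \<partial>M) * (\<integral>\<^sup>+s. hk n t s * (h s n)\<^sup>2 \<partial>M)"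
      unfolding power_mult_distrib unfolding power2_eq_square [of "r _ _"] r2 ..
    finally have "ennreal ((lam n)\<^sup>2) * (duh h t n)\<^sup>2 \<le>
        ennreal ((lam n)\<^sup>2) * ((\<integral>\<^sup>+s. hk n t s \<partial>M) * (\<integral>\<^sup>+s. hk n t s * (h s n)\<^sup>2 \<partial>M))"
      by (rule mult_left_mono) simp
    also have "\<dots> = (ennreal (lam n) * (\<integral>\<^sup>+s. hk n t s \<partial>M)) * (ennreal (lam n) * (\<integral>\<^sup>+s. hk n t s * (h s n)\<^sup>2 \<partial>M))"
      by (simp add: power2_eq_square ennreal_mult mult_ac)
    also have "\<dots> \<le> 1 * (ennreal (lam n) * (\<integral>\<^sup>+s. hk n t s * (h s n)\<^sup>2 \<partial>M))"
      by (intro mult_right_mono lam_hk_integral_right) simp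
    finally show ?thesis by simp
  qed
  interpret P: pair_sigma_finite M M ..
  have h2 [measurable]: "(\<lambda>x. h (snd x) n) \<in> borel_measurable (M \<Otimes>\<^sub>M M)"
    using measurable_compose [OF measurable_snd h] by simp
  have m2: "(\<lambda>(t, s). hk n t s * (h s n)\<^sup>2) \<in> borel_measurable (M \<Otimes>\<^sub>M M)"
    unfolding split_beta' by measurable
  have "(\<integral>\<^sup>+t. ennreal ((lam n)\<^sup>2) * (duh h t n)\<^sup>2 \<partial>M) \<le>
      (\<integral>\<^sup>+t. ennreal (lam n) * (\<integral>\<^sup>+s. hk n t s * (h s n)\<^sup>2 \<partial>M) \<partial>M)"
    by (rule nn_integral_mono) (rule pt)
  also have "\<dots> = ennreal (lam n) * (\<integral>\<^sup>+t. (\<integral>\<^sup>+s. hk n t s * (h s n)\<^sup>2 \<partial>M) \<partial>M)"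
    by (rule nn_integral_cmult) (rule borel_measurable_nn_integral [OF m2])
  also have "(\<integral>\<^sup>+t. (\<integral>\<^sup>+s. hk n t s * (h s n)\<^sup>2 \<partial>M) \<partial>M) =
      (\<integral>\<^sup>+s. (\<integral>\<^sup>+t. hk n t s * (h s n)\<^sup>2 \<partial>M) \<partial>M)"
    using P.Fubini' [OF m2] by simp
  also have "\<dots> = (\<integral>\<^sup>+s. (\<integral>\<^sup>+t. hk n t s \<partial>M) * (h s n)\<^sup>2 \<partial>M)"
    by (intro nn_integral_cong nn_integral_multc) measurable
  also have "ennreal (lam n) * \<dots> = (\<integral>\<^sup>+s. (ennreal (lam n) * (\<integral>\<^sup>+t. hk n t s \<partial>M)) * (h s n)\<^sup>2 \<partial>M)"
  proof -
    have "(\<lambda>(s, t). hk n t s) \<in> borel_measurable (M \<Otimes>\<^sub>M M)"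
      using measurable_compose [OF measurable_pair_swap' hk_measurable_pair] by (simp add: split_beta')
    then have [measurable]: "(\<lambda>s. \<integral>\<^sup>+t. hk n t s \<partial>M) \<in> borel_measurable M"
      by (rule borel_measurable_nn_integral)
    show ?thesis by (subst nn_integral_cmult [symmetric]) (simp_all add: mult.assoc)
  qed
  also have "\<dots> \<le> (\<integral>\<^sup>+s. 1 * (h s n)\<^sup>2 \<partial>M)"
    by (intro nn_integral_mono mult_right_mono lam_hk_integral_left) simp
  finally show ?thesis by simp
qed

text \<open>One of the two factors in \<open>wsq_interpolation\<close> is bounded uniformly in time,
  the other after integration.\<close>

lemma x4_interpolation:
  assumes [measurable]: "\<And>n. (\<lambda>t. v t n) \<in> borel_measurable M"
    and "\<And>t. t \<in> I \<Longrightarrow> wsq lam (v t) \<le> A"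
    and "(\<integral>\<^sup>+t. wsq (\<lambda>n. (lam n)\<^sup>2) (v t) \<partial>M) \<le> B"
  shows "x4 M v \<le> A * B"
proof -
  have "x4 M v \<le> (\<integral>\<^sup>+t. A * wsq (\<lambda>n. (lam n)\<^sup>2) (v t) \<partial>M)"
    unfolding x4_def
    by (intro nn_integral_mono order_trans [OF wsq_interpolation] mult_right_mono) (use assms in auto)
  also have "\<dots> = A * (\<integral>\<^sup>+t. wsq (\<lambda>n. (lam n)\<^sup>2) (v t) \<partial>M)"
    by (rule nn_integral_cmult) measurable
  also have "\<dots> \<le> A * B" using assms by (intro mult_left_mono) auto
  finally show ?thesis .
qed

lemma duh_wsq_lam:
  assumes [measurable]: "\<And>n. (\<lambda>s. h s n) \<in> borel_measurable M"
  shows "wsq lam (duh h t) \<le> (\<integral>\<^sup>+s. zsum (\<lambda>n. (h s n)\<^sup>2) \<partial>M)"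
  by (subst nn_integral_zsum) (auto simp: wsq_def intro!: nn_integral_mono duh_sup_estimate)

lemma duh_wsq_lam2:
  assumes [measurable]: "\<And>n. (\<lambda>s. h s n) \<in> borel_measurable M"
  shows "(\<integral>\<^sup>+t. wsq (\<lambda>n. (lam n)\<^sup>2) (duh h t) \<partial>M) \<le> (\<integral>\<^sup>+s. zsum (\<lambda>n. (h s n)\<^sup>2) \<partial>M)"
  unfolding wsq_def
  by (subst (1 2) nn_integral_zsum) (auto intro!: nn_integral_mono duh_L2_estimate)

lemma x4_duh:
  assumes [measurable]: "\<And>n. (\<lambda>s. h s n) \<in> borel_measurable M"
  shows "x4 M (duh h) \<le> (\<integral>\<^sup>+s. zsum (\<lambda>n. (h s n)\<^sup>2) \<partial>M)\<^sup>2"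
  unfolding power2_eq_square [of "nn_integral _ _"]
  by (intro x4_interpolation duh_wsq_lam duh_wsq_lam2) measurable

lemma heat_maj_measurable [measurable]: "(\<lambda>t. heat_maj a t n) \<in> borel_measurable M"
  unfolding heat_maj_def by (intro borel_measurable_M) measurable

lemma heat_maj_wsq_lam:
  assumes "\<And>n. 0 \<le> a n" "t \<in> I"
  shows "wsq lam (heat_maj a t) \<le> zsum (\<lambda>n. ennreal (lam n * (a n)\<^sup>2))"
  unfolding wsq_def
proof (rule nn_integral_mono)
  fix n
  have "exp (- (lam n * t)) * a n \<le> 1 * a n"
    using I_nonneg [OF assms(2)] assms(1) [of n] by (intro mult_right_mono) auto
  then have "(exp (- (lam n * t)) * a n)\<^sup>2 \<le> (a n)\<^sup>2"
    using assms(1) [of n] by (intro power_mono) auto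
  then have "lam n * (exp (- (lam n * t)) * a n)\<^sup>2 \<le> lam n * (a n)\<^sup>2"
    by (intro mult_left_mono) simp_all
  then show "ennreal (lam n) * (heat_maj a t n)\<^sup>2 \<le> ennreal (lam n * (a n)\<^sup>2)"
    using assms(1) [of n] by (simp add: heat_maj_def ennreal_power ennreal_leI flip: ennreal_mult)
qed

lemma heat_maj_wsq_lam2:
  assumes "\<And>n. 0 \<le> a n"
  shows "(\<integral>\<^sup>+t. wsq (\<lambda>n. (lam n)\<^sup>2) (heat_maj a t) \<partial>M) \<le> zsum (\<lambda>n. ennreal (lam n * (a n)\<^sup>2))"
proof -
  have "(\<integral>\<^sup>+t. ennreal ((lam n)\<^sup>2) * (heat_maj a t n)\<^sup>2 \<partial>M) \<le> ennreal (lam n * (a n)\<^sup>2)" for n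
  proof -
    have "(\<integral>\<^sup>+t. ennreal ((lam n)\<^sup>2) * (heat_maj a t n)\<^sup>2 \<partial>M) \<le>
        (\<integral>\<^sup>+t. ennreal ((lam n)\<^sup>2 * (a n)\<^sup>2) * hk n t 0 \<partial>M)"
    proof (rule nn_integral_mono)
      fix t assume "t \<in> space M"
      then have t: "0 \<le> t" using I_nonneg by simp
      \<comment> \<open>The square of the decay factor is replaced by the factor itself, which is
        the kernel with source time \<open>0\<close>; its time integral cancels one power of
        \<open>lam n\<close>.\<close>
      have "(exp (- (lam n * t)))\<^sup>2 \<le> exp (- (lam n * t))"
        using mult_right_mono [of "exp (- (lam n * t))" 1 "exp (- (lam n * t))"] t
        by (simp add: power2_eq_square)
      then have "(lam n)\<^sup>2 * (exp (- (lam n * t)) * a n)\<^sup>2 \<le> (lam n)\<^sup>2 * (exp (- (lam n * t)) * (a n)\<^sup>2)"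
        unfolding power_mult_distrib by (intro mult_left_mono mult_right_mono) auto
      from ennreal_leI [OF this] show "ennreal ((lam n)\<^sup>2) * (heat_maj a t n)\<^sup>2 \<le> ennreal ((lam n)\<^sup>2 * (a n)\<^sup>2) * hk n t 0"
        using t assms(1) [of n] by (simp add: heat_maj_def hk_def ennreal_power mult_ac flip: ennreal_mult)
    qed
    also have "\<dots> = ennreal ((lam n)\<^sup>2 * (a n)\<^sup>2) * (\<integral>\<^sup>+t. hk n t 0 \<partial>M)"
      by (rule nn_integral_cmult) measurable
    also have "\<dots> = ennreal (lam n * (a n)\<^sup>2) * (ennreal (lam n) * (\<integral>\<^sup>+t. hk n t 0 \<partial>M))"
      by (simp add: power2_eq_square ennreal_mult mult_ac)
    also have "\<dots> \<le> ennreal (lam n * (a n)\<^sup>2) * 1"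
      by (intro mult_left_mono lam_hk_integral_left) simp
    finally show ?thesis by simp
  qed
  then show ?thesis
    unfolding wsq_def by (subst nn_integral_zsum) (auto intro!: nn_integral_mono)
qed

text \<open>The bound is the same for every interval; on the half-line, smallness comes from
  it.\<close>

lemma x4_heat_maj:
  assumes "\<And>n. 0 \<le> a n"
  shows "x4 M (heat_maj a) \<le> (zsum (\<lambda>n. ennreal (lam n * (a n)\<^sup>2)))\<^sup>2"
  unfolding power2_eq_square [of "nn_integral _ _"]
  by (intro x4_interpolation heat_maj_wsq_lam heat_maj_wsq_lam2 assms) measurable

text \<open>\<open>wsq\<close> and \<open>x4\<close> each contain a square, and the losses are
  \<open>2^2\<close> and \<open>2\<close>.\<close>

lemma x4_add:
  assumes [measurable]: "\<And>n. (\<lambda>t. u t n) \<in> borel_measurable M" "\<And>n. (\<lambda>t. v t n) \<in> borel_measurable M"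
  shows "x4 M (\<lambda>t n. u t n + v t n) \<le> 8 * (x4 M u + x4 M v)"
proof -
  have "(wsq wgt (\<lambda>n. u t n + v t n))\<^sup>2 \<le> 8 * ((wsq wgt (u t))\<^sup>2 + (wsq wgt (v t))\<^sup>2)" for t
  proof -
    have "(wsq wgt (\<lambda>n. u t n + v t n))\<^sup>2 \<le> (2 * (wsq wgt (u t) + wsq wgt (v t)))\<^sup>2"
      by (intro power_mono wsq_add_le) simp
    also have "\<dots> = 4 * (wsq wgt (u t) + wsq wgt (v t))\<^sup>2"
      unfolding power_mult_distrib by simp
    also have "\<dots> \<le> 4 * (2 * ((wsq wgt (u t))\<^sup>2 + (wsq wgt (v t))\<^sup>2))"
      by (intro mult_left_mono ennreal_add_power2_le) simp
    finally show ?thesis by (simp add: mult.assoc [symmetric])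
  qed
  then have "x4 M (\<lambda>t n. u t n + v t n) \<le> (\<integral>\<^sup>+t. 8 * ((wsq wgt (u t))\<^sup>2 + (wsq wgt (v t))\<^sup>2) \<partial>M)"
    unfolding x4_def by (intro nn_integral_mono)
  also have "\<dots> = 8 * (x4 M u + x4 M v)"
    unfolding x4_def by (simp add: nn_integral_cmult nn_integral_add)
  finally show ?thesis .
qed

lemma nle_L2:
  assumes [measurable]: "\<And>n. (\<lambda>t. u t n) \<in> borel_measurable M"
  shows "(\<integral>\<^sup>+s. zsum (\<lambda>n. (nle (u s) (u s) n)\<^sup>2) \<partial>M) \<le> 12 * x4 M u"
proof -
  have "(\<integral>\<^sup>+s. zsum (\<lambda>n. (nle (u s) (u s) n)\<^sup>2) \<partial>M) \<le> (\<integral>\<^sup>+s. 12 * (wsq wgt (u s))\<^sup>2 \<partial>M)"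
    using nle_bilinear_estimate by (intro nn_integral_mono) (simp add: power2_eq_square mult.assoc)
  also have "\<dots> = 12 * x4 M u"
    unfolding x4_def by (rule nn_integral_cmult) measurable
  finally show ?thesis .
qed

end


section \<open>The majorant iteration\<close>

context time_interval begin

text \<open>Starting from \<open>0\<close> makes monotonicity in \<open>k\<close> an immediate
  induction, as the right-hand side is monotone in the previous iterate.\<close>

primrec majorant :: "(int \<Rightarrow> real) \<Rightarrow> nat \<Rightarrow> real \<Rightarrow> int \<Rightarrow> ennreal" where
  "majorant a 0 = (\<lambda>t n. 0)"
| "majorant a (Suc k) = (\<lambda>t n. heat_maj a t n + duh (\<lambda>s. nle (majorant a k s) (majorant a k s)) t n)"

lemma majorant_measurable [measurable]: "(\<lambda>t. majorant a k t n) \<in> borel_measurable M"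
proof (induction k arbitrary: n)
  case (Suc k)
  note Suc [measurable]
  show ?case by simp measurable
qed simp

lemma majorant_Suc_mono: "majorant a k t n \<le> majorant a (Suc k) t n"
proof (induction k arbitrary: t n)
  case (Suc k)
  have "duh (\<lambda>s. nle (majorant a k s) (majorant a k s)) t n \<le>
      duh (\<lambda>s. nle (majorant a (Suc k) s) (majorant a (Suc k) s)) t n"
    by (intro duh_mono nle_mono Suc)
  then show ?case
    unfolding majorant.simps(2) [of a k] majorant.simps(2) [of a "Suc k"] by (rule add_left_mono)
qed simp

lemma majorant_incseq: "incseq (\<lambda>k. majorant a k t n)"
  by (rule incseq_SucI) (rule majorant_Suc_mono)

text \<open>With \<open>e\<close> the size of the free evolution, \<open>x4_duh\<close> and
  \<open>nle_L2\<close> bound the next Duhamel term by \<open>(12 * 16 * e)^2 = 36864 * e^2\<close>.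
  This is at most \<open>e\<close> when \<open>e \<le> 1 / 36864\<close>, and then
  \<open>x4_add\<close> returns \<open>8 * (e + e) = 16 * e\<close>.\<close>

lemma x4_majorant:
  assumes small: "x4 M (heat_maj a) \<le> ennreal (1 / 36864)"
  shows "x4 M (majorant a k) \<le> 16 * x4 M (heat_maj a)"
proof (induction k)
  case 0
  have "wsq wgt (\<lambda>n. 0) = 0" by (simp add: wsq_def)
  then show ?case by (simp add: x4_def)
next
  case (Suc k)
  let ?h = "\<lambda>s. nle (majorant a k s) (majorant a k s)"
  obtain e where e: "x4 M (heat_maj a) = ennreal e" "0 \<le> e" "e \<le> 1 / 36864"
    using small by (cases "x4 M (heat_maj a)") (auto simp: top_unique)
  have "x4 M (duh ?h) \<le> (\<integral>\<^sup>+s. zsum (\<lambda>n. (?h s n)\<^sup>2) \<partial>M)\<^sup>2"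
    by (rule x4_duh) measurable
  also have "\<dots> \<le> (12 * x4 M (majorant a k))\<^sup>2"
    by (intro power_mono nle_L2) simp_all
  also have "\<dots> \<le> (12 * (16 * ennreal e))\<^sup>2"
    using Suc e by (intro power_mono mult_left_mono) auto
  also have "12 * (16 * ennreal e) = 192 * ennreal e"
    by (simp add: mult.assoc [symmetric])
  also have "192 * ennreal e = ennreal (192 * e)"
    using e by (simp add: ennreal_mult)
  also have "\<dots>\<^sup>2 = ennreal ((192 * e)\<^sup>2)"
    using e by (simp add: ennreal_power)
  also have "\<dots> \<le> ennreal e"
  proof (rule ennreal_leI)
    have "(192 * e)\<^sup>2 = (36864 * e) * e" by (simp add: power2_eq_square)
    also have "\<dots> \<le> 1 * e" using e by (intro mult_right_mono) auto
    finally show "(192 * e)\<^sup>2 \<le> e" by simp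
  qed
  finally have d: "x4 M (duh ?h) \<le> ennreal e" .
  have "x4 M (majorant a (Suc k)) \<le> 8 * (x4 M (heat_maj a) + x4 M (duh ?h))"
    unfolding majorant.simps by (rule x4_add) measurable
  also have "\<dots> \<le> 8 * (ennreal e + ennreal e)"
    using d e by (intro mult_left_mono add_mono) auto
  also have "\<dots> = 16 * x4 M (heat_maj a)"
    using e by (simp add: mult_2 [symmetric] mult.assoc [symmetric])
  finally show ?case .
qed

definition limit_majorant :: "(int \<Rightarrow> real) \<Rightarrow> real \<Rightarrow> int \<Rightarrow> ennreal" where
  "limit_majorant a t n = (SUP k. majorant a k t n)"

lemma majorant_le_limit: "majorant a k t n \<le> limit_majorant a t n"
  unfolding limit_majorant_def by (rule SUP_upper) simp

lemma limit_majorant_measurable [measurable]: "(\<lambda>t. limit_majorant a t n) \<in> borel_measurable M"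
  unfolding limit_majorant_def by measurable

lemma tendsto_power2_ennreal:
  fixes f :: "nat \<Rightarrow> ennreal"
  assumes "f \<longlonglongrightarrow> l" shows "(\<lambda>k. (f k)\<^sup>2) \<longlonglongrightarrow> l\<^sup>2"
  unfolding power2_eq_square by (intro tendsto_mult_ennreal assms) auto

text \<open>Monotone convergence is applied twice, over frequencies at fixed time and then over
  time.\<close>

lemma x4_limit_majorant:
  assumes "x4 M (heat_maj a) \<le> ennreal (1 / 36864)"
  shows "x4 M (limit_majorant a) \<le> 16 * x4 M (heat_maj a)"
proof -
  have w: "(\<lambda>k. wsq wgt (majorant a k t)) \<longlonglongrightarrow> wsq wgt (limit_majorant a t)"
    and wi: "incseq (\<lambda>k. wsq wgt (majorant a k t))" for t
  proof -
    show "(\<lambda>k. wsq wgt (majorant a k t)) \<longlonglongrightarrow> wsq wgt (limit_majorant a t)"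
      unfolding wsq_def
    proof (rule nn_integral_LIMSEQ)
      show "incseq (\<lambda>k n. ennreal (wgt n) * (majorant a k t n)\<^sup>2)"
        by (intro incseq_SucI le_funI mult_left_mono power_mono majorant_Suc_mono) simp_all
      show "(\<lambda>k. ennreal (wgt n) * (majorant a k t n)\<^sup>2) \<longlonglongrightarrow> ennreal (wgt n) * (limit_majorant a t n)\<^sup>2" for n
        unfolding limit_majorant_def
        by (intro ennreal_tendsto_cmult tendsto_power2_ennreal LIMSEQ_SUP majorant_incseq) simp
    qed simp
    show "incseq (\<lambda>k. wsq wgt (majorant a k t))"
      by (intro incseq_SucI wsq_mono majorant_Suc_mono)
  qed
  have "(\<lambda>k. x4 M (majorant a k)) \<longlonglongrightarrow> x4 M (limit_majorant a)"
    unfolding x4_def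
  proof (rule nn_integral_LIMSEQ)
    show "incseq (\<lambda>k t. (wsq wgt (majorant a k t))\<^sup>2)"
      using wi by (auto simp: incseq_def le_fun_def intro!: power_mono)
    show "(\<lambda>k. (wsq wgt (majorant a k t))\<^sup>2) \<longlonglongrightarrow> (wsq wgt (limit_majorant a t))\<^sup>2" for t
      by (rule tendsto_power2_ennreal [OF w])
  qed measurable
  then show ?thesis
    by (rule LIMSEQ_le_const2) (use x4_majorant [OF assms] in blast)
qed

text \<open>\<open>duh_sup_estimate\<close> turns a bound on a time integral into one at each time;
  at \<open>n = 0\<close> the kernel of the nonlinearity vanishes.\<close>

lemma duh_finite:
  assumes [measurable]: "\<And>n. (\<lambda>t. u t n) \<in> borel_measurable M" and "x4 M u < top"
  shows "duh (\<lambda>s. nle (u s) (u s)) t n < top"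
proof (cases "n = 0")
  case False
  have "ennreal (lam n) * (duh (\<lambda>s. nle (u s) (u s)) t n)\<^sup>2 \<le> (\<integral>\<^sup>+s. (nle (u s) (u s) n)\<^sup>2 \<partial>M)"
    by (rule duh_sup_estimate) measurable
  also have "\<dots> \<le> (\<integral>\<^sup>+s. zsum (\<lambda>n. (nle (u s) (u s) n)\<^sup>2) \<partial>M)"
    by (intro nn_integral_mono zsum_term_le)
  also have "\<dots> \<le> 12 * x4 M u" by (rule nle_L2) measurable
  also have "\<dots> < top" using assms(2) by (simp add: ennreal_mult_less_top)
  finally show ?thesis
    using lam_pos [OF False] by (auto simp: less_top [symmetric] power2_eq_square ennreal_mult_eq_top_iff)
qed (simp add: duh_def)

text \<open>The \<open>L^4\<close> bound alone would give finiteness only for almost every time.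
  Going back through the iteration formula gives it for every \<open>t\<close> and
  \<open>n\<close>.\<close>

lemma limit_majorant_finite:
  assumes "x4 M (heat_maj a) \<le> ennreal (1 / 36864)"
  shows "x4 M (limit_majorant a) < top"
    and "duh (\<lambda>s. nle (limit_majorant a s) (limit_majorant a s)) t n < top"
    and "limit_majorant a t n < top"
proof -
  have "16 * x4 M (heat_maj a) < top"
    using assms by (auto simp: ennreal_mult_less_top intro: order_le_less_trans)
  then show x: "x4 M (limit_majorant a) < top"
    using x4_limit_majorant [OF assms] by (rule order_le_less_trans [rotated])
  show d: "duh (\<lambda>s. nle (limit_majorant a s) (limit_majorant a s)) t n < top"
    by (rule duh_finite [OF _ x]) measurable
  have "majorant a k t n \<le> heat_maj a t n + duh (\<lambda>s. nle (limit_majorant a s) (limit_majorant a s)) t n" for k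
  proof (cases k)
    case (Suc j)
    show ?thesis
      unfolding Suc majorant.simps by (intro add_left_mono duh_mono nle_mono majorant_le_limit)
  qed simp
  then have "limit_majorant a t n \<le> heat_maj a t n + duh (\<lambda>s. nle (limit_majorant a s) (limit_majorant a s)) t n"
    unfolding limit_majorant_def [of a t n] by (intro SUP_least)
  also have "\<dots> < top" using d by (simp add: heat_maj_def)
  finally show "limit_majorant a t n < top" .
qed

lemma wsq_wgt_finite_AE:
  assumes [measurable]: "\<And>n. (\<lambda>t. u t n) \<in> borel_measurable M" and "x4 M u < top"
  shows "AE t in M. wsq wgt (u t) < top"
proof -
  have "AE t in M. (wsq wgt (u t))\<^sup>2 \<noteq> \<infinity>"
    using assms(2) unfolding x4_def by (intro nn_integral_PInf_AE) (auto simp: less_top)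
  then show ?thesis
    by eventually_elim (auto simp: power2_eq_square ennreal_mult_eq_top_iff less_top)
qed

end

lemma nle_finite:
  assumes "wsq wgt u < top" "wsq wgt v < top" shows "nle u v n < top"
proof -
  have "(nle u v n)\<^sup>2 \<le> zsum (\<lambda>n. (nle u v n)\<^sup>2)" by (rule zsum_term_le)
  also have "\<dots> \<le> 12 * wsq wgt u * wsq wgt v" by (rule nle_bilinear_estimate)
  also have "\<dots> < top" using assms by (simp add: ennreal_mult_less_top)
  finally show ?thesis by (auto simp: power2_eq_square ennreal_mult_eq_top_iff less_top [symmetric])
qed

text \<open>The Fourier coefficients of the nonlinearity; \<open>nle\<close> is its majorant.\<close>

definition nlc :: "(int \<Rightarrow> complex) \<Rightarrow> int \<Rightarrow> complex" where
  "nlc u n = (LINT k|count_space UNIV. of_real (nlker n k) * (u (n - k) * u k))"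

lemma norm_nlc_term_le:
  fixes u :: "int \<Rightarrow> complex"
  assumes "\<And>m. ennreal (norm (u m)) \<le> U m"
  shows "ennreal (norm (complex_of_real (nlker n k) * (u (n - k) * u k))) \<le> ennreal (nlker n k) * (U (n - k) * U k)"
  using assms by (auto simp: norm_mult ennreal_mult intro!: mult_left_mono mult_mono)

lemma integrable_nlc:
  assumes "\<And>m. ennreal (norm (u m)) \<le> U m" "nle U U n < top"
  shows "integrable (count_space UNIV) (\<lambda>k. of_real (nlker n k) * (u (n - k) * u k) :: complex)"
proof (rule integrableI_bounded)
  have "zsum (\<lambda>k. ennreal (norm (complex_of_real (nlker n k) * (u (n - k) * u k)))) \<le> nle U U n"
    unfolding nle_def by (intro nn_integral_mono norm_nlc_term_le assms)
  then show "zsum (\<lambda>k. ennreal (norm (complex_of_real (nlker n k) * (u (n - k) * u k)))) < \<infinity>"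
    using assms(2) by (simp add: order_le_less_trans)
qed simp

lemma norm_nlc_le:
  assumes "\<And>m. ennreal (norm (u m)) \<le> U m"
  shows "ennreal (norm (nlc u n)) \<le> nle U U n"
proof (cases "integrable (count_space UNIV) (\<lambda>k. of_real (nlker n k) * (u (n - k) * u k) :: complex)")
  case True
  then have "ennreal (norm (nlc u n)) \<le> zsum (\<lambda>k. ennreal (norm (complex_of_real (nlker n k) * (u (n - k) * u k))))"
    unfolding nlc_def by (rule integral_norm_bound_ennreal)
  also have "\<dots> \<le> nle U U n"
    unfolding nle_def by (intro nn_integral_mono norm_nlc_term_le assms)
  finally show ?thesis .
qed (simp add: nlc_def not_integrable_integral_eq)

text \<open>If a step from \<open>v\<close> to \<open>u\<close> is dominated by the step from
  \<open>V\<close> to \<open>U\<close>, the same holds for the nonlinearities, by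
  \<open>u u - v v = (u - v) u + v (u - v)\<close> and its counterpart for the majorants. Domination
  is written additively because subtraction in \<open>ennreal\<close> is truncated.\<close>

lemma norm_nlc_diff_le:
  assumes u: "\<And>m. ennreal (norm (u m)) \<le> U m" and v: "\<And>m. ennreal (norm (v m)) \<le> V m"
    and d: "\<And>m. ennreal (norm (u m - v m)) + V m \<le> U m" and fin: "nle U U n < top"
  shows "ennreal (norm (nlc u n - nlc v n)) + nle V V n \<le> nle U U n"
proof -
  let ?f = "\<lambda>u k. complex_of_real (nlker n k) * (u (n - k) * u k)"
  have VU: "V m \<le> U m" for m using d [of m] by (rule order_trans [rotated]) simp
  have iu: "integrable (count_space UNIV) (?f u)" by (rule integrable_nlc [OF u fin])
  have "nle V V n \<le> nle U U n" by (intro nle_mono VU)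
  then have iv: "integrable (count_space UNIV) (?f v)"
    by (intro integrable_nlc [OF v]) (use fin in auto)
  have pt: "ennreal (norm (?f u k - ?f v k)) + ennreal (nlker n k) * (V (n - k) * V k) \<le>
      ennreal (nlker n k) * (U (n - k) * U k)" for k
  proof -
    let ?d = "\<lambda>m. ennreal (norm (u m - v m))"
    have "norm (u (n - k) * u k - v (n - k) * v k) \<le>
        norm (u (n - k) - v (n - k)) * norm (u k) + norm (v (n - k)) * norm (u k - v k)"
      using norm_triangle_ineq [of "(u (n - k) - v (n - k)) * u k" "v (n - k) * (u k - v k)"]
      by (simp add: algebra_simps flip: norm_mult)
    then have "ennreal (norm (u (n - k) * u k - v (n - k) * v k)) \<le>
        ?d (n - k) * ennreal (norm (u k)) + ennreal (norm (v (n - k))) * ?d k"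
      by (simp flip: ennreal_mult ennreal_plus)
    also have "\<dots> \<le> ?d (n - k) * U k + V (n - k) * ?d k"
      by (intro add_mono mult_mono u v) auto
    finally have "ennreal (norm (u (n - k) * u k - v (n - k) * v k)) + V (n - k) * V k \<le>
        ?d (n - k) * U k + V (n - k) * (?d k + V k)"
      by (simp add: algebra_simps add_mono)
    also have "\<dots> \<le> ?d (n - k) * U k + V (n - k) * U k"
      by (intro add_left_mono mult_left_mono d) simp
    also have "\<dots> = (?d (n - k) + V (n - k)) * U k" by (simp add: algebra_simps)
    also have "\<dots> \<le> U (n - k) * U k" by (intro mult_right_mono d) simp
    finally have "ennreal (nlker n k) * (ennreal (norm (u (n - k) * u k - v (n - k) * v k)) + V (n - k) * V k) \<le>
        ennreal (nlker n k) * (U (n - k) * U k)" by (rule mult_left_mono) simp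
    moreover have "ennreal (norm (?f u k - ?f v k)) =
        ennreal (nlker n k) * ennreal (norm (u (n - k) * u k - v (n - k) * v k))"
      by (simp add: norm_mult flip: ennreal_mult right_diff_distrib)
    ultimately show ?thesis by (simp add: distrib_left)
  qed
  have "nlc u n - nlc v n = (LINT k|count_space UNIV. ?f u k - ?f v k)"
    unfolding nlc_def by (rule Bochner_Integration.integral_diff [OF iu iv, symmetric])
  then have "ennreal (norm (nlc u n - nlc v n)) + nle V V n \<le>
      zsum (\<lambda>k. ennreal (norm (?f u k - ?f v k))) + zsum (\<lambda>k. ennreal (nlker n k) * (V (n - k) * V k))"
    unfolding nle_def
    using integral_norm_bound_ennreal [OF Bochner_Integration.integrable_diff [OF iu iv]]
    by (intro add_right_mono) simp
  also have "\<dots> = zsum (\<lambda>k. ennreal (norm (?f u k - ?f v k)) + ennreal (nlker n k) * (V (n - k) * V k))"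
    by (rule nn_integral_add [symmetric]) simp_all
  also have "\<dots> \<le> nle U U n"
    unfolding nle_def by (rule nn_integral_mono) (rule pt)
  finally show ?thesis .
qed

text \<open>Dominated convergence in the inner frequency, dominated by the summand of
  \<open>nle U U n\<close>.\<close>

lemma nlc_tendsto:
  assumes "\<And>j m. ennreal (norm (u j m)) \<le> U m" "\<And>m. (\<lambda>j. u j m) \<longlonglongrightarrow> v m"
    and "nle U U n < top" "\<And>m. U m < top"
  shows "(\<lambda>j. nlc (u j) n) \<longlonglongrightarrow> nlc v n"
  unfolding nlc_def
proof (rule integral_dominated_convergence)
  let ?w = "\<lambda>k. enn2real (ennreal (nlker n k) * (U (n - k) * U k))"
  have fin: "ennreal (nlker n k) * (U (n - k) * U k) < top" for k
    using assms(4) by (simp add: ennreal_mult_less_top)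
  have w: "ennreal (norm (?w k)) = ennreal (nlker n k) * (U (n - k) * U k)" for k
    using fin [of k] by simp
  show "integrable (count_space UNIV) ?w"
  proof (rule integrableI_bounded)
    show "zsum (\<lambda>k. ennreal (norm (?w k))) < \<infinity>"
      unfolding w using assms(3) by (simp add: nle_def)
  qed simp
  show "AE k in count_space UNIV. norm (complex_of_real (nlker n k) * (u j (n - k) * u j k)) \<le> ?w k" for j
  proof (rule AE_I2)
    fix k
    have "ennreal (norm (complex_of_real (nlker n k) * (u j (n - k) * u j k))) \<le> ennreal (?w k)"
      using norm_nlc_term_le [of "u j" U n k, OF assms(1)] fin [of k] by (simp add: less_top)
    then show "norm (complex_of_real (nlker n k) * (u j (n - k) * u j k)) \<le> ?w k"
      by (simp add: ennreal_le_iff)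
  qed
  show "AE k in count_space UNIV. (\<lambda>j. complex_of_real (nlker n k) * (u j (n - k) * u j k))
      \<longlonglongrightarrow> complex_of_real (nlker n k) * (v (n - k) * v k)"
    by (intro AE_I2 tendsto_intros assms(2))
qed simp_all


section \<open>The Picard iteration\<close>

definition hkr :: "int \<Rightarrow> real \<Rightarrow> real \<Rightarrow> real" where
  "hkr n t s = (if s \<le> t then exp (- (lam n * (t - s))) else 0)"

lemma hk_hkr: "hk n t s = ennreal (hkr n t s)"
  by (simp add: hk_def hkr_def)

lemma hkr_nonneg [simp]: "0 \<le> hkr n t s"
  by (simp add: hkr_def)

lemma nlc_measurable [measurable]:
  assumes [measurable]: "\<And>n. (\<lambda>s. u s n) \<in> borel_measurable M"
  shows "(\<lambda>s. nlc (u s) n) \<in> borel_measurable M"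
proof -
  have "(\<lambda>x. complex_of_real (nlker n (snd x)) * (u (fst x) (n - snd x) * u (fst x) (snd x)))
      \<in> borel_measurable (M \<Otimes>\<^sub>M count_space UNIV)"
  proof (rule measurable_compose_countable [where g = snd and N = borel and
        f = "\<lambda>k x. complex_of_real (nlker n k) * (u (fst x) (n - k) * u (fst x) k)"])
    show "(\<lambda>x. complex_of_real (nlker n k) * (u (fst x) (n - k) * u (fst x) k))
        \<in> borel_measurable (M \<Otimes>\<^sub>M count_space UNIV)" for k :: int
      by measurable
  qed measurable
  then show ?thesis
    unfolding nlc_def
    by (intro sigma_finite_measure.borel_measurable_lebesgue_integral
        sigma_finite_measure_count_space) (simp add: split_beta')
qed

context time_interval begin

lemma hkr_measurable_pair [measurable]:
  "(\<lambda>x. hkr n (fst x) (snd x)) \<in> borel_measurable (M \<Otimes>\<^sub>M M)"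
proof -
  have [measurable]: "(\<lambda>x. fst x :: real) \<in> borel_measurable (M \<Otimes>\<^sub>M M)"
    "(\<lambda>x. snd x :: real) \<in> borel_measurable (M \<Otimes>\<^sub>M M)"
    using measurable_compose [OF measurable_fst ident_measurable_M]
      measurable_compose [OF measurable_snd ident_measurable_M] by simp_all
  show ?thesis unfolding hkr_def by measurable
qed

lemma hkr_measurable_M [measurable]: "hkr n t \<in> borel_measurable M"
  unfolding hkr_def by measurable

definition duhc :: "(real \<Rightarrow> int \<Rightarrow> complex) \<Rightarrow> real \<Rightarrow> int \<Rightarrow> complex" where
  "duhc h t n = (LINT s|M. of_real (hkr n t s) * h s n)"

lemma duhc_measurable [measurable]:
  assumes [measurable]: "(\<lambda>s. h s n) \<in> borel_measurable M"
  shows "(\<lambda>t. duhc h t n) \<in> borel_measurable M"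
proof -
  have [measurable]: "(\<lambda>x. h (snd x) n) \<in> borel_measurable (M \<Otimes>\<^sub>M M)"
    using measurable_compose [OF measurable_snd assms] by simp
  have "(\<lambda>(t, s). complex_of_real (hkr n t s) * h s n) \<in> borel_measurable (M \<Otimes>\<^sub>M M)"
    unfolding split_beta' by measurable
  then show ?thesis unfolding duhc_def by (rule borel_measurable_lebesgue_integral)
qed

lemma duhc_integrable:
  fixes h :: "real \<Rightarrow> int \<Rightarrow> complex"
  assumes [measurable]: "(\<lambda>s. h s n) \<in> borel_measurable M"
    and "AE s in M. ennreal (norm (h s n)) \<le> H s n" "duh H t n < top"
  shows "integrable M (\<lambda>s. of_real (hkr n t s) * h s n)"
proof (rule integrableI_bounded)
  have "(\<integral>\<^sup>+s. ennreal (norm (complex_of_real (hkr n t s) * h s n)) \<partial>M) \<le> duh H t n"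
    unfolding duh_def hk_hkr
    by (rule nn_integral_mono_AE, use assms(2) in eventually_elim)
      (simp add: norm_mult ennreal_mult mult_left_mono)
  then show "(\<integral>\<^sup>+s. ennreal (norm (complex_of_real (hkr n t s) * h s n)) \<partial>M) < \<infinity>"
    using assms(3) by (simp add: order_le_less_trans)
qed measurable

text \<open>A nonintegrable integrand makes \<open>duhc\<close> equal to \<open>0\<close>, so no
  integrability is assumed. The hypothesis is almost everywhere because bounds on the nonlinearity
  may fail at exceptional times.\<close>

lemma norm_duhc_le:
  assumes "AE s in M. ennreal (norm (h s n)) \<le> H s n"
  shows "ennreal (norm (duhc h t n)) \<le> duh H t n"
proof (cases "integrable M (\<lambda>s. of_real (hkr n t s) * h s n)")
  case True
  then have "ennreal (norm (duhc h t n)) \<le> (\<integral>\<^sup>+s. ennreal (norm (complex_of_real (hkr n t s) * h s n)) \<partial>M)"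
    unfolding duhc_def by (rule integral_norm_bound_ennreal)
  also have "\<dots> \<le> duh H t n"
    unfolding duh_def hk_hkr
    by (rule nn_integral_mono_AE, use assms in eventually_elim)
      (simp add: norm_mult ennreal_mult mult_left_mono)
  finally show ?thesis .
qed (simp add: duhc_def not_integrable_integral_eq)

lemma norm_duhc_diff_le:
  assumes [measurable]: "(\<lambda>s. h s n) \<in> borel_measurable M" "(\<lambda>s. h' s n) \<in> borel_measurable M"
      "(\<lambda>s. H' s n) \<in> borel_measurable M"
    and h: "AE s in M. ennreal (norm (h s n)) \<le> H s n"
    and h': "AE s in M. ennreal (norm (h' s n)) \<le> H' s n"
    and d: "AE s in M. ennreal (norm (h s n - h' s n)) + H' s n \<le> H s n"
    and fin: "duh H t n < top"
  shows "ennreal (norm (duhc h t n - duhc h' t n)) + duh H' t n \<le> duh H t n"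
proof -
  have "duh H' t n \<le> duh H t n"
    unfolding duh_def
  proof (rule nn_integral_mono_AE, use d in eventually_elim)
    fix s assume "ennreal (norm (h s n - h' s n)) + H' s n \<le> H s n"
    then have "H' s n \<le> H s n" by (rule order_trans [rotated]) simp
    then show "hk n t s * H' s n \<le> hk n t s * H s n" by (rule mult_left_mono) simp
  qed
  then have fin': "duh H' t n < top" using fin by simp
  have "duhc h t n - duhc h' t n = (LINT s|M. of_real (hkr n t s) * h s n - of_real (hkr n t s) * h' s n)"
    unfolding duhc_def
    by (rule Bochner_Integration.integral_diff [OF duhc_integrable [of h n H t] duhc_integrable [of h' n H' t], symmetric])
      (use h h' fin fin' in \<open>simp_all\<close>)
  also have "\<dots> = duhc (\<lambda>s n. h s n - h' s n) t n"
    by (simp add: duhc_def right_diff_distrib)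
  finally have "ennreal (norm (duhc h t n - duhc h' t n)) + duh H' t n \<le>
      duh (\<lambda>s n. ennreal (norm (h s n - h' s n))) t n + duh H' t n"
    by (simp add: norm_duhc_le add_right_mono)
  also have "\<dots> = (\<integral>\<^sup>+s. hk n t s * ennreal (norm (h s n - h' s n)) + hk n t s * H' s n \<partial>M)"
    unfolding duh_def by (rule nn_integral_add [symmetric]) measurable
  also have "\<dots> \<le> duh H t n"
    unfolding duh_def
    by (rule nn_integral_mono_AE, use d in eventually_elim)
      (simp add: distrib_left [symmetric] mult_left_mono)
  finally show ?thesis .
qed

primrec picard :: "(int \<Rightarrow> complex) \<Rightarrow> nat \<Rightarrow> real \<Rightarrow> int \<Rightarrow> complex" where
  "picard b 0 = (\<lambda>t n. 0)"
| "picard b (Suc k) = (\<lambda>t n. of_real (exp (- (lam n * t))) * b n + duhc (\<lambda>s. nlc (picard b k s)) t n)"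

lemma picard_measurable [measurable]: "(\<lambda>t. picard b k t n) \<in> borel_measurable M"
proof (induction k arbitrary: n)
  case (Suc k)
  note Suc [measurable]
  show ?case by simp measurable
qed simp

lemma norm_heat_term: "ennreal (norm (complex_of_real (exp (- (lam n * t))) * b n)) = heat_maj (\<lambda>n. norm (b n)) t n"
  by (simp add: heat_maj_def norm_mult)

lemma norm_picard_le: "ennreal (norm (picard b k t n)) \<le> majorant (\<lambda>n. norm (b n)) k t n"
proof (induction k arbitrary: t n)
  case (Suc k)
  have "ennreal (norm (picard b (Suc k) t n)) \<le>
      ennreal (norm (of_real (exp (- (lam n * t))) * b n) + norm (duhc (\<lambda>s. nlc (picard b k s)) t n))"
    unfolding picard.simps by (intro ennreal_leI norm_triangle_ineq)
  also have "\<dots> = heat_maj (\<lambda>n. norm (b n)) t n + ennreal (norm (duhc (\<lambda>s. nlc (picard b k s)) t n))"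
    unfolding norm_heat_term [symmetric] by (rule ennreal_plus) simp_all
  also have "\<dots> \<le> majorant (\<lambda>n. norm (b n)) (Suc k) t n"
    unfolding majorant.simps by (intro add_left_mono norm_duhc_le AE_I2 norm_nlc_le Suc)
  finally show ?case .
qed simp

context
  fixes b :: "int \<Rightarrow> complex"
  assumes small: "x4 M (heat_maj (\<lambda>n. norm (b n))) \<le> ennreal (1 / 36864)"
begin

abbreviation V where "V \<equiv> limit_majorant (\<lambda>n. norm (b n))"

lemmas V_finite = limit_majorant_finite [OF small]

lemma nle_V_finite_AE: "AE s in M. \<forall>n. nle (V s) (V s) n < top"
proof -
  have "AE s in M. wsq wgt (V s) < top"
    by (rule wsq_wgt_finite_AE [OF _ V_finite(1)]) measurable
  then show ?thesis by eventually_elim (auto intro: nle_finite)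
qed

text \<open>The free evolutions cancel in a difference, so only Duhamel terms are compared;
  \<open>norm_nlc_diff_le\<close> and \<open>norm_duhc_diff_le\<close> carry the domination through
  one iteration.\<close>

lemma norm_picard_diff_le:
  "ennreal (norm (picard b (Suc k) t n - picard b k t n)) + majorant (\<lambda>n. norm (b n)) k t n \<le>
    majorant (\<lambda>n. norm (b n)) (Suc k) t n"
proof (induction k arbitrary: t n)
  case 0
  show ?case using norm_picard_le [of b "Suc 0" t n] by simp
next
  case (Suc k)
  let ?U = "majorant (\<lambda>n. norm (b n))"
  let ?h = "\<lambda>k s. nlc (picard b k s)" and ?H = "\<lambda>k s. nle (?U k s) (?U k s)"
  have *: "ennreal (norm (duhc (?h (Suc k)) t n - duhc (?h k) t n)) + duh (?H k) t n \<le> duh (?H (Suc k)) t n"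
  proof (rule norm_duhc_diff_le)
    show "AE s in M. ennreal (norm (?h (Suc k) s n)) \<le> ?H (Suc k) s n"
      "AE s in M. ennreal (norm (?h k s n)) \<le> ?H k s n"
      by (intro AE_I2 norm_nlc_le norm_picard_le)+
    show "AE s in M. ennreal (norm (?h (Suc k) s n - ?h k s n)) + ?H k s n \<le> ?H (Suc k) s n"
      using nle_V_finite_AE
    proof eventually_elim
      case (elim s)
      have "?H (Suc k) s n \<le> nle (V s) (V s) n" by (intro nle_mono majorant_le_limit)
      then have "?H (Suc k) s n < top" using elim by (metis order_le_less_trans)
      then show ?case by (intro norm_nlc_diff_le norm_picard_le Suc)
    qed
    have "duh (?H (Suc k)) t n \<le> duh (\<lambda>s. nle (V s) (V s)) t n"
      by (intro duh_mono nle_mono majorant_le_limit)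
    then show "duh (?H (Suc k)) t n < top"
      using V_finite(2) by (rule order_le_less_trans)
  qed measurable
  have "picard b (Suc (Suc k)) t n - picard b (Suc k) t n = duhc (?h (Suc k)) t n - duhc (?h k) t n"
    unfolding picard.simps(2) [of b "Suc k"] picard.simps(2) [of b k] by simp
  with add_left_mono [OF *, of "heat_maj (\<lambda>n. norm (b n)) t n"] show ?case
    unfolding majorant.simps(2) [of _ "Suc k"] majorant.simps(2) [of _ k] by (simp only: ac_simps)
qed

text \<open>The increments are summed against the telescoping increments of the majorant and stay
  below the finite limit \<open>V\<close>.\<close>

lemma picard_convergent: "convergent (\<lambda>k. picard b k t n)"
proof -
  let ?d = "\<lambda>k. picard b (Suc k) t n - picard b k t n"
  have sum_le: "(\<Sum>j<k. ennreal (norm (?d j))) \<le> majorant (\<lambda>n. norm (b n)) k t n" for k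
  proof (induction k)
    case (Suc k)
    have "(\<Sum>j<Suc k. ennreal (norm (?d j))) \<le> majorant (\<lambda>n. norm (b n)) k t n + ennreal (norm (?d k))"
      using Suc by (simp add: add_right_mono)
    also have "\<dots> \<le> majorant (\<lambda>n. norm (b n)) (Suc k) t n"
      using norm_picard_diff_le [of k t n] by (simp only: add.commute)
    finally show ?case .
  qed simp
  have "(\<Sum>j. ennreal (norm (?d j))) \<le> V t n"
    by (rule suminf_le_const [OF summableI]) (rule order_trans [OF sum_le majorant_le_limit])
  then have "(\<Sum>j. ennreal (norm (?d j))) \<noteq> top"
    using V_finite(3) [of t n] by (auto simp: top_unique)
  then have "summable (\<lambda>j. norm (?d j))" by (intro summable_suminf_not_top) simp_all
  then have "summable ?d" by (rule summable_norm_cancel)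
  then have "convergent (\<lambda>k. \<Sum>j<k. ?d j)" by (simp add: summable_iff_convergent)
  then show ?thesis using sum_lessThan_telescope [of "\<lambda>k. picard b k t n"] by simp
qed

definition mild :: "real \<Rightarrow> int \<Rightarrow> complex" where
  "mild t n = lim (\<lambda>k. picard b k t n)"

lemma picard_tendsto_mild: "(\<lambda>k. picard b k t n) \<longlonglongrightarrow> mild t n"
  unfolding mild_def using picard_convergent by (simp add: convergent_LIMSEQ_iff)

lemma mild_measurable [measurable]: "(\<lambda>t. mild t n) \<in> borel_measurable M"
  unfolding mild_def by (rule borel_measurable_lim_metric) measurable

lemma norm_mild_le: "ennreal (norm (mild t n)) \<le> V t n"
proof (rule LIMSEQ_le_const2)
  show "(\<lambda>k. ennreal (norm (picard b k t n))) \<longlonglongrightarrow> ennreal (norm (mild t n))"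
    by (intro tendsto_intros picard_tendsto_mild)
  show "\<exists>N. \<forall>k\<ge>N. ennreal (norm (picard b k t n)) \<le> V t n"
    using order_trans [OF norm_picard_le majorant_le_limit] by blast
qed

lemma norm_picard_le_V: "ennreal (norm (picard b k t n)) \<le> V t n"
  by (rule order_trans [OF norm_picard_le majorant_le_limit])

lemma mild_equation:
  "mild t n = of_real (exp (- (lam n * t))) * b n + duhc (\<lambda>s. nlc (mild s)) t n"
proof -
  have "(\<lambda>k. duhc (\<lambda>s. nlc (picard b k s)) t n) \<longlonglongrightarrow> duhc (\<lambda>s. nlc (mild s)) t n"
    unfolding duhc_def
  proof (rule integral_dominated_convergence)
    \<comment> \<open>\<open>enn2real\<close> sends \<infinity> to \<open>0\<close>, but the
      majorant is finite for almost every \<open>s\<close>.\<close>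
    let ?w = "\<lambda>s. enn2real (hk n t s * nle (V s) (V s) n)"
    have w: "AE s in M. ennreal (?w s) = hk n t s * nle (V s) (V s) n"
      using nle_V_finite_AE by eventually_elim (simp add: hk_hkr ennreal_mult_less_top)
    show "integrable M ?w"
    proof (rule integrableI_bounded)
      have "(\<integral>\<^sup>+s. ennreal (norm (?w s)) \<partial>M) = duh (\<lambda>s. nle (V s) (V s)) t n"
        unfolding duh_def by (rule nn_integral_cong_AE, use w in eventually_elim) simp
      then show "(\<integral>\<^sup>+s. ennreal (norm (?w s)) \<partial>M) < \<infinity>" using V_finite(2) by simp
    qed measurable
    show "AE s in M. norm (complex_of_real (hkr n t s) * nlc (picard b k s) n) \<le> ?w s" for k
      using w
    proof eventually_elim
      case (elim s)
      have "ennreal (norm (complex_of_real (hkr n t s) * nlc (picard b k s) n)) \<le> hk n t s * nle (V s) (V s) n"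
        unfolding hk_hkr norm_mult
        by (simp add: ennreal_mult) (intro mult_left_mono norm_nlc_le norm_picard_le_V, simp)
      then have "ennreal (norm (complex_of_real (hkr n t s) * nlc (picard b k s) n)) \<le> ennreal (?w s)"
        unfolding elim .
      then show ?case by (subst (asm) ennreal_le_iff) (rule enn2real_nonneg, assumption)
    qed
    show "AE s in M. (\<lambda>k. complex_of_real (hkr n t s) * nlc (picard b k s) n) \<longlonglongrightarrow>
        complex_of_real (hkr n t s) * nlc (mild s) n"
      using nle_V_finite_AE
    proof eventually_elim
      case (elim s)
      have "(\<lambda>k. nlc (picard b k s) n) \<longlonglongrightarrow> nlc (mild s) n"
      proof (rule nlc_tendsto)
        show "ennreal (norm (picard b k s m)) \<le> V s m" for k m by (rule norm_picard_le_V)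
        show "(\<lambda>k. picard b k s m) \<longlonglongrightarrow> mild s m" for m by (rule picard_tendsto_mild)
        show "nle (V s) (V s) n < top" using elim by (rule spec)
        show "V s m < top" for m by (rule V_finite(3))
      qed
      then show ?case by (rule tendsto_mult [OF tendsto_const])
    qed
  qed measurable
  then have "(\<lambda>k. picard b (Suc k) t n) \<longlonglongrightarrow>
      of_real (exp (- (lam n * t))) * b n + duhc (\<lambda>s. nlc (mild s)) t n"
    unfolding picard.simps by (intro tendsto_intros)
  with LIMSEQ_Suc [OF picard_tendsto_mild] show ?thesis by (rule LIMSEQ_unique)
qed

lemma x4_mild: "x4 M (\<lambda>t n. ennreal (norm (mild t n))) < top"
proof -
  have "x4 M (\<lambda>t n. ennreal (norm (mild t n))) \<le> x4 M V"
    unfolding x4_def by (intro nn_integral_mono power_mono wsq_mono norm_mild_le) simp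
  with V_finite(1) show ?thesis by (rule order_le_less_trans [rotated])
qed

end

lemma mild_solution_exists:
  assumes "x4 M (heat_maj (\<lambda>n. norm (b n))) \<le> ennreal (1 / 36864)"
  obtains u where "\<And>n. (\<lambda>t. u t n) \<in> borel_measurable M"
    "\<And>t n. u t n = of_real (exp (- (lam n * t))) * b n + duhc (\<lambda>s. nlc (u s)) t n"
    "x4 M (\<lambda>t n. ennreal (norm (u t n))) < top"
  using mild_measurable [OF assms] mild_equation [OF assms] x4_mild [OF assms] by (rule that)

end


section \<open>Uniqueness and regularity of mild solutions\<close>

context time_interval begin

lemma AE_M_neq: "AE s in M. s \<noteq> c"
  using I_sets AE_completion [OF AE_lborel_singleton [of c]]
  by (subst AE_restrict_space_iff) (auto elim: eventually_mono)

text \<open>Absolute continuity of the integral to the right of \<sigma>: the open intervals shrink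
  to the empty set, so dominated convergence applies whatever happens at \<sigma> itself.\<close>

lemma short_interval_integral:
  assumes [measurable]: "\<phi> \<in> borel_measurable M" and fin: "(\<integral>\<^sup>+s. \<phi> s \<partial>M) < top" and "0 < e"
  obtains \<tau> where "\<sigma> < \<tau>" "(\<integral>\<^sup>+s. \<phi> s * indicator {\<sigma><..<\<tau>} s \<partial>M) < e"
proof -
  have "(\<lambda>k. \<integral>\<^sup>+s. \<phi> s * indicator {\<sigma><..<\<sigma> + 1 / real (Suc k)} s \<partial>M) \<longlonglongrightarrow> (\<integral>\<^sup>+s. 0 \<partial>M)"
  proof (rule nn_integral_dominated_convergence [where w = \<phi>])
    show "AE s in M. \<phi> s * indicator {\<sigma><..<\<sigma> + 1 / real (Suc k)} s \<le> \<phi> s" for k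
      by (intro AE_I2) (simp add: indicator_def)
    show "AE s in M. (\<lambda>k. \<phi> s * indicator {\<sigma><..<\<sigma> + 1 / real (Suc k)} s) \<longlonglongrightarrow> 0"
    proof (rule AE_I2)
      fix s
      have "\<forall>\<^sub>F k in sequentially. \<phi> s * indicator {\<sigma><..<\<sigma> + 1 / real (Suc k)} s = 0"
      proof (cases "s \<le> \<sigma>")
        case False
        have "(\<lambda>k. 1 / real (Suc k)) \<longlonglongrightarrow> 0" by (rule LIMSEQ_Suc [OF lim_1_over_n])
        then have "\<forall>\<^sub>F k in sequentially. 1 / real (Suc k) < s - \<sigma>"
          by (rule order_tendstoD) (use False in simp)
        then show ?thesis by eventually_elim (simp add: indicator_def)
      qed (simp add: indicator_def)
      then show "(\<lambda>k. \<phi> s * indicator {\<sigma><..<\<sigma> + 1 / real (Suc k)} s) \<longlonglongrightarrow> 0"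
        by (rule tendsto_eventually)
    qed
  qed (use fin in simp_all)
  then have "\<forall>\<^sub>F k in sequentially. (\<integral>\<^sup>+s. \<phi> s * indicator {\<sigma><..<\<sigma> + 1 / real (Suc k)} s \<partial>M) < e"
    using \<open>0 < e\<close> by (auto intro: order_tendstoD)
  then obtain k where "(\<integral>\<^sup>+s. \<phi> s * indicator {\<sigma><..<\<sigma> + 1 / real (Suc k)} s \<partial>M) < e"
    by (auto simp: eventually_sequentially)
  with that [of "\<sigma> + 1 / real (Suc k)"] show ?thesis by simp
qed

text \<open>On a short interval following one on which \<open>W\<close> vanishes, the bilinear estimate yields
  \<open>X \<le> X * Q\<close> with \<open>Q < 1\<close> for the \<open>L\<^sup>4\<close> norm \<open>X\<close> of \<open>W\<close>.\<close>

lemma majorant_uniqueness_step: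
  assumes W [measurable]: "\<And>n. (\<lambda>t. W t n) \<in> borel_measurable M"
    and F [measurable]: "\<And>n. (\<lambda>t. F t n) \<in> borel_measurable M"
    and G [measurable]: "\<And>n. (\<lambda>t. G t n) \<in> borel_measurable M"
    and fin: "x4 M W < top"
    and ineq: "AE t in M. \<forall>n. W t n \<le> duh (\<lambda>s n. nle (W s) (F s) n + nle (G s) (W s) n) t n"
    and \<sigma>: "AE s in M. s < \<sigma> \<longrightarrow> wsq wgt (W s) = 0"
    and Q: "(\<integral>\<^sup>+s. (24 * (wsq wgt (F s) + wsq wgt (G s)))\<^sup>2 * indicator {\<sigma><..<\<tau>} s \<partial>M) < 1"
  shows "AE s in M. s < \<tau> \<longrightarrow> wsq wgt (W s) = 0"
proof -
  define H where "H = (\<lambda>s n. nle (W s) (F s) n + nle (G s) (W s) n)"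
  define c where "c = (\<lambda>s. indicator {..<\<tau>} s :: ennreal)"
  \<comment> \<open>\<open>24 = 2 * 12\<close>: each of the two bilinear terms costs
    \<open>12\<close>, and squaring their sum costs \<open>2\<close>.\<close>
  define \<psi> where "\<psi> = (\<lambda>s. 24 * (wsq wgt (F s) + wsq wgt (G s)))"
  have [measurable]: "c \<in> borel_measurable M"
    unfolding c_def by measurable
  have [measurable]: "(\<lambda>s. H s n) \<in> borel_measurable M" for n
    unfolding H_def by measurable
  have [measurable]: "\<psi> \<in> borel_measurable M"
    unfolding \<psi>_def by measurable
  \<comment> \<open>Causality: before \<open>\<tau>\<close> the Duhamel integral sees its source
    only before \<open>\<tau>\<close>, so the cut-off passes inside.\<close>
  have duh_cut: "duh H t n * c t \<le> duh (\<lambda>s n. H s n * c s) t n" for t n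
  proof (cases "t < \<tau>")
    case True
    have "hk n t s * H s n \<le> hk n t s * (H s n * c s)" for s
      using True by (auto simp: hk_def c_def indicator_def)
    then show ?thesis
      unfolding duh_def using True by (simp add: c_def nn_integral_mono)
  qed (simp add: c_def)
  let ?X = "x4 M (\<lambda>t n. W t n * c t)"
  have "?X \<le> x4 M (duh (\<lambda>s n. H s n * c s))"
    unfolding x4_def
  proof (rule nn_integral_mono_AE, use ineq in eventually_elim)
    fix t assume "\<forall>n. W t n \<le> duh (\<lambda>s n. nle (W s) (F s) n + nle (G s) (W s) n) t n"
    then have "W t n * c t \<le> duh H t n * c t" for n
      unfolding H_def by (intro mult_right_mono) auto
    then show "(wsq wgt (\<lambda>n. W t n * c t))\<^sup>2 \<le> (wsq wgt (duh (\<lambda>s n. H s n * c s) t))\<^sup>2"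
      by (intro power_mono wsq_mono order_trans [OF _ duh_cut]) auto
  qed
  also have "\<dots> \<le> (\<integral>\<^sup>+s. zsum (\<lambda>n. (H s n * c s)\<^sup>2) \<partial>M)\<^sup>2"
    by (rule x4_duh) measurable
  also have "\<dots> \<le> (\<integral>\<^sup>+s. wsq wgt (\<lambda>n. W s n * c s) * (\<psi> s * indicator {\<sigma><..<\<tau>} s) \<partial>M)\<^sup>2"
  proof (intro power_mono nn_integral_mono_AE)
    show "AE s in M. zsum (\<lambda>n. (H s n * c s)\<^sup>2) \<le>
        wsq wgt (\<lambda>n. W s n * c s) * (\<psi> s * indicator {\<sigma><..<\<tau>} s)"
      using \<sigma> AE_M_neq [of \<sigma>]
    proof eventually_elim
      case (elim s)
      have *: "zsum (\<lambda>n. (H s n)\<^sup>2) \<le> wsq wgt (W s) * \<psi> s"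
      proof -
        have "zsum (\<lambda>n. (H s n)\<^sup>2) \<le> zsum (\<lambda>n. 2 * ((nle (W s) (F s) n)\<^sup>2 + (nle (G s) (W s) n)\<^sup>2))"
          unfolding H_def by (intro nn_integral_mono ennreal_add_power2_le)
        also have "\<dots> = 2 * (zsum (\<lambda>n. (nle (W s) (F s) n)\<^sup>2) + zsum (\<lambda>n. (nle (G s) (W s) n)\<^sup>2))"
          by (simp add: nn_integral_cmult nn_integral_add)
        also have "\<dots> \<le> 2 * (12 * wsq wgt (W s) * wsq wgt (F s) + 12 * wsq wgt (G s) * wsq wgt (W s))"
          by (intro mult_left_mono add_mono nle_bilinear_estimate) simp
        also have "\<dots> = wsq wgt (W s) * \<psi> s"
        proof -
          have "2 * (12 * w * f + 12 * g * w) = w * ((2 * 12) * (f + g))" for w f g :: ennreal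
            by (simp only: distrib_left distrib_right mult_ac)
          then show ?thesis by (simp add: \<psi>_def)
        qed
        finally show ?thesis .
      qed
      show ?case
      proof (cases "s < \<tau> \<and> \<sigma> < s")
        case True
        with * show ?thesis by (simp add: c_def)
      next
        case False
        then have "\<not> s < \<tau> \<or> wsq wgt (W s) = 0" using elim by auto
        then have "zsum (\<lambda>n. (H s n * c s)\<^sup>2) \<le> 0" using * by (auto simp: c_def indicator_def)
        then show ?thesis by simp
      qed
    qed
  qed simp
  also have "\<dots> \<le> (\<integral>\<^sup>+s. (wsq wgt (\<lambda>n. W s n * c s))\<^sup>2 \<partial>M) * (\<integral>\<^sup>+s. (\<psi> s * indicator {\<sigma><..<\<tau>} s)\<^sup>2 \<partial>M)"
    by (rule Cauchy_Schwarz_nn_integral) measurable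
  also have "(\<integral>\<^sup>+s. (\<psi> s * indicator {\<sigma><..<\<tau>} s)\<^sup>2 \<partial>M) = (\<integral>\<^sup>+s. (\<psi> s)\<^sup>2 * indicator {\<sigma><..<\<tau>} s \<partial>M)"
    by (intro nn_integral_cong) (simp add: indicator_def)
  finally have X: "?X \<le> ?X * (\<integral>\<^sup>+s. (\<psi> s)\<^sup>2 * indicator {\<sigma><..<\<tau>} s \<partial>M)" (is "_ \<le> _ * ?Q")
    by (simp add: x4_def)
  \<comment> \<open>Finiteness is essential, since \<infinity> could also satisfy the inequality for
    \<open>?X\<close>. With \<open>?X\<close> finite and the factor below \<open>1\<close>, only
    \<open>0\<close> remains.\<close>
  have "?X \<le> x4 M W"
    unfolding x4_def by (intro nn_integral_mono power_mono wsq_mono) (auto simp: c_def indicator_def)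
  then have "?X < top" using fin by simp
  have "?X = 0"
  proof (rule ccontr)
    assume "?X \<noteq> 0"
    obtain x where x: "?X = ennreal x" "0 < x"
      using \<open>?X < top\<close> \<open>?X \<noteq> 0\<close> by (cases ?X) (auto simp: less_le)
    obtain q where q: "?Q = ennreal q" "0 \<le> q" "q < 1"
    proof -
      have "?Q < 1" using Q unfolding \<psi>_def .
      with that show ?thesis by (cases ?Q) auto
    qed
    have "ennreal x \<le> ennreal (x * q)"
      using X unfolding x(1) q(1) using x q by (simp add: ennreal_mult)
    then have "x \<le> x * q" using x q by (simp add: ennreal_le_iff)
    then show False using x q by simp
  qed
  then have "AE t in M. (wsq wgt (\<lambda>n. W t n * c t))\<^sup>2 = 0"
    unfolding x4_def by (subst (asm) nn_integral_0_iff_AE) measurable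
  then show ?thesis
    by eventually_elim (auto simp: c_def)
qed

text \<open>Continuation: \<open>Z\<close> collects the times up to which \<open>W\<close> vanishes.
  Were it bounded, \<open>W\<close> would vanish up to its supremum, and
  \<open>majorant_uniqueness_step\<close> would pass beyond it. \<open>F\<close> and
  \<open>G\<close> may be large; a short interval makes their contribution small.\<close>

lemma majorant_uniqueness:
  assumes W [measurable]: "\<And>n. (\<lambda>t. W t n) \<in> borel_measurable M"
    and F [measurable]: "\<And>n. (\<lambda>t. F t n) \<in> borel_measurable M"
    and G [measurable]: "\<And>n. (\<lambda>t. G t n) \<in> borel_measurable M"
    and fin: "x4 M W < top" "x4 M F < top" "x4 M G < top"
    and ineq: "AE t in M. \<forall>n. W t n \<le> duh (\<lambda>s n. nle (W s) (F s) n + nle (G s) (W s) n) t n"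
  shows "AE s in M. wsq wgt (W s) = 0"
proof -
  define Z where "Z = {\<tau>. AE s in M. s < \<tau> \<longrightarrow> wsq wgt (W s) = 0}"
  have zero: "0 \<in> Z"
    unfolding Z_def mem_Collect_eq
  proof (rule AE_I2, rule impI)
    fix s :: real assume "s \<in> space M" "s < 0"
    then show "wsq wgt (W s) = 0" using I_nonneg [of s] by simp
  qed
  have down: "\<tau>' \<in> Z" if "\<tau> \<in> Z" "\<tau>' \<le> \<tau>" for \<tau> \<tau>'
    using that unfolding Z_def by (auto elim!: eventually_mono)
  have "\<not> bdd_above Z"
  proof
    assume bdd: "bdd_above Z"
    define \<sigma> where "\<sigma> = Sup Z"
    \<comment> \<open>The supremum is approached by a sequence, because only countably many null
      sets may be united.\<close>
    have "\<sigma> - 1 / real (Suc k) \<in> Z" for k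
    proof -
      have "\<sigma> - 1 / real (Suc k) < Sup Z" unfolding \<sigma>_def by simp
      then obtain \<tau> where "\<tau> \<in> Z" "\<sigma> - 1 / real (Suc k) < \<tau>"
        using less_cSupD [of Z] zero by blast
      from down [OF this(1) less_imp_le [OF this(2)]] show ?thesis .
    qed
    then have "AE s in M. \<forall>k. s < \<sigma> - 1 / real (Suc k) \<longrightarrow> wsq wgt (W s) = 0"
      unfolding Z_def AE_all_countable by blast
    then have \<sigma>: "AE s in M. s < \<sigma> \<longrightarrow> wsq wgt (W s) = 0"
    proof eventually_elim
      case (elim s)
      show ?case
      proof
        assume "s < \<sigma>"
        then obtain k where "inverse (real (Suc k)) < \<sigma> - s"
          using reals_Archimedean [of "\<sigma> - s"] by auto
        then have "s < \<sigma> - 1 / real (Suc k)" by (simp add: inverse_eq_divide)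
        then show "wsq wgt (W s) = 0" using elim by blast
      qed
    qed
    have "(\<integral>\<^sup>+s. (24 * (wsq wgt (F s) + wsq wgt (G s)))\<^sup>2 \<partial>M) \<le>
        (\<integral>\<^sup>+s. 1152 * ((wsq wgt (F s))\<^sup>2 + (wsq wgt (G s))\<^sup>2) \<partial>M)"
    proof (rule nn_integral_mono)
      fix s
      have "(24 * (wsq wgt (F s) + wsq wgt (G s)))\<^sup>2 \<le> 576 * (2 * ((wsq wgt (F s))\<^sup>2 + (wsq wgt (G s))\<^sup>2))"
        unfolding power_mult_distrib
        by (intro mult_mono ennreal_add_power2_le) simp_all
      then show "(24 * (wsq wgt (F s) + wsq wgt (G s)))\<^sup>2 \<le> 1152 * ((wsq wgt (F s))\<^sup>2 + (wsq wgt (G s))\<^sup>2)"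
        by (simp add: mult.assoc [symmetric])
    qed
    also have "\<dots> = 1152 * (x4 M F + x4 M G)"
      unfolding x4_def by (simp add: nn_integral_cmult nn_integral_add)
    also have "\<dots> < top" using fin by (simp add: ennreal_mult_less_top)
    finally obtain \<tau> where "\<sigma> < \<tau>"
      "(\<integral>\<^sup>+s. (24 * (wsq wgt (F s) + wsq wgt (G s)))\<^sup>2 * indicator {\<sigma><..<\<tau>} s \<partial>M) < 1"
      using short_interval_integral [of "\<lambda>s. (24 * (wsq wgt (F s) + wsq wgt (G s)))\<^sup>2" 1 \<sigma>] by auto
    then have "\<tau> \<in> Z"
      unfolding Z_def using majorant_uniqueness_step [OF W F G fin(1) ineq \<sigma>] by simp
    then have "\<tau> \<le> \<sigma>" unfolding \<sigma>_def using bdd by (rule cSup_upper)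
    with \<open>\<sigma> < \<tau>\<close> show False by simp
  qed
  then have "real k \<in> Z" for k :: nat
    using down by (meson bdd_aboveI linear)
  then have "AE s in M. \<forall>k. s < real k \<longrightarrow> wsq wgt (W s) = 0"
    unfolding Z_def AE_all_countable by blast
  then show ?thesis
    by eventually_elim (meson reals_Archimedean2)
qed

section \<open>Continuity in time of the Duhamel integral\<close>

lemma hkr_tendsto:
  assumes "X \<longlonglongrightarrow> t" "s \<noteq> t" shows "(\<lambda>i. hkr n (X i) s) \<longlonglongrightarrow> hkr n t s"
\<comment> \<open>The kernel jumps at \<open>s = t\<close>; on either side of it a single formula
  eventually holds along the sequence.\<close>
proof (cases "s < t")
  case True
  then have "\<forall>\<^sub>F i in sequentially. s < X i" using assms(1) by (auto intro: order_tendstoD)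
  then have "\<forall>\<^sub>F i in sequentially. exp (- (lam n * (X i - s))) = hkr n (X i) s"
    by eventually_elim (simp add: hkr_def)
  moreover have "(\<lambda>i. exp (- (lam n * (X i - s)))) \<longlonglongrightarrow> exp (- (lam n * (t - s)))"
    by (intro tendsto_intros assms)
  ultimately show ?thesis using True by (simp add: hkr_def [of n t] tendsto_cong)
next
  case False
  then have "\<forall>\<^sub>F i in sequentially. X i < s" using assms by (auto intro: order_tendstoD)
  then have "\<forall>\<^sub>F i in sequentially. hkr n (X i) s = 0"
    by eventually_elim (simp add: hkr_def)
  then show ?thesis using False assms(2) by (simp add: hkr_def [of n t] tendsto_eventually)
qed

text \<open>The nonlinearity is known in \<open>L^2\<close> in time and \<open>I\<close> may be
  unbounded, so an \<open>L^1\<close> bound calls for a cut-off; with \<open>C\<close> a bound for a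
  convergent sequence of times, \<open>{..C}\<close> contains every source time that
  matters.\<close>

lemma integrable_on_bounded_time:
  assumes [measurable]: "(\<lambda>s. h s n :: complex) \<in> borel_measurable M"
    and fin: "(\<integral>\<^sup>+s. (ennreal (norm (h s n)))\<^sup>2 \<partial>M) < top"
  shows "integrable M (\<lambda>s. norm (h s n) * indicator {..C} s)"
proof (rule integrableI_bounded)
  have "(\<integral>\<^sup>+s. (indicator {..C} s)\<^sup>2 \<partial>M) = (\<integral>\<^sup>+s. indicator {0..C} s \<partial>M)"
    by (intro nn_integral_cong) (auto simp: indicator_def dest: I_nonneg)
  also have "\<dots> \<le> (\<integral>\<^sup>+s. indicator {0..C} s \<partial>lborel)"
    by (rule nn_integral_lebesgue_on_le [OF I_sets])
  also have "\<dots> < top" by (simp add: emeasure_lborel_Icc_eq)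
  finally have "(\<integral>\<^sup>+s. (ennreal (norm (h s n)))\<^sup>2 \<partial>M) * (\<integral>\<^sup>+s. (indicator {..C} s)\<^sup>2 \<partial>M) < top"
    using fin by (simp add: ennreal_mult_less_top)
  moreover have "(\<integral>\<^sup>+s. ennreal (norm (h s n)) * indicator {..C} s \<partial>M)\<^sup>2 \<le>
      (\<integral>\<^sup>+s. (ennreal (norm (h s n)))\<^sup>2 \<partial>M) * (\<integral>\<^sup>+s. (indicator {..C} s)\<^sup>2 \<partial>M)"
    by (rule Cauchy_Schwarz_nn_integral) measurable
  ultimately have "(\<integral>\<^sup>+s. ennreal (norm (h s n)) * indicator {..C} s \<partial>M)\<^sup>2 < top" by simp
  then have "(\<integral>\<^sup>+s. ennreal (norm (h s n)) * indicator {..C} s \<partial>M) < top"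
    by (auto simp: power2_eq_square ennreal_mult_eq_top_iff less_top [symmetric])
  moreover have "ennreal (norm (norm (h s n) * indicator {..C} s)) = ennreal (norm (h s n)) * indicator {..C} s" for s
    by (simp add: indicator_def)
  ultimately show "(\<integral>\<^sup>+s. ennreal (norm (norm (h s n) * indicator {..C} s)) \<partial>M) < \<infinity>" by simp
qed measurable

lemma duhc_tendsto:
  assumes h [measurable]: "(\<lambda>s. h s n) \<in> borel_measurable M"
    and fin: "(\<integral>\<^sup>+s. (ennreal (norm (h s n)))\<^sup>2 \<partial>M) < top" and X: "X \<longlonglongrightarrow> t"
  shows "(\<lambda>i. duhc h (X i) n) \<longlonglongrightarrow> duhc h t n"
proof -
  obtain C where C: "\<And>i. norm (X i) \<le> C"
    using convergent_imp_Bseq [OF convergentI [OF X]] by (auto simp: Bseq_def)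
  show ?thesis
    unfolding duhc_def
  proof (rule integral_dominated_convergence)
    show "integrable M (\<lambda>s. norm (h s n) * indicator {..C} s)"
      by (rule integrable_on_bounded_time [of h n, OF h fin])
    show "AE s in M. (\<lambda>i. complex_of_real (hkr n (X i) s) * h s n) \<longlonglongrightarrow> complex_of_real (hkr n t s) * h s n"
      using AE_M_neq [of t] by eventually_elim (intro tendsto_intros hkr_tendsto X)
    show "AE s in M. norm (complex_of_real (hkr n (X i) s) * h s n) \<le> norm (h s n) * indicator {..C} s" for i
    proof (rule AE_I2)
      fix s
      show "norm (complex_of_real (hkr n (X i) s) * h s n) \<le> norm (h s n) * indicator {..C} s"
        using C [of i] mult_left_le_one_le [of "norm (h s n)" "hkr n (X i) s"]
        by (auto simp: norm_mult hkr_def indicator_def)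
    qed
  qed measurable
qed

section \<open>Regularity of mild solutions\<close>

context
  fixes u :: "real \<Rightarrow> int \<Rightarrow> complex" and b :: "int \<Rightarrow> complex"
  assumes u [measurable]: "\<And>n. (\<lambda>t. u t n) \<in> borel_measurable M"
    and eq: "\<And>t n. u t n = of_real (exp (- (lam n * t))) * b n + duhc (\<lambda>s. nlc (u s)) t n"
    and x4_fin: "x4 M (\<lambda>t n. ennreal (norm (u t n))) < top"
    and b: "zsum (\<lambda>n. ennreal (lam n * (norm (b n))\<^sup>2)) < top"
begin

lemma mild_nlc_L2: "(\<integral>\<^sup>+s. zsum (\<lambda>n. (ennreal (norm (nlc (u s) n)))\<^sup>2) \<partial>M) < top"
proof -
  let ?U = "\<lambda>t n. ennreal (norm (u t n))"
  have "(\<integral>\<^sup>+s. zsum (\<lambda>n. (ennreal (norm (nlc (u s) n)))\<^sup>2) \<partial>M) \<le> (\<integral>\<^sup>+s. zsum (\<lambda>n. (nle (?U s) (?U s) n)\<^sup>2) \<partial>M)"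
    by (intro nn_integral_mono power_mono norm_nlc_le) simp_all
  also have "\<dots> \<le> 12 * x4 M ?U" by (rule nle_L2) measurable
  also have "\<dots> < top" using x4_fin by (simp add: ennreal_mult_less_top)
  finally show ?thesis .
qed

definition nl_energy :: "int \<Rightarrow> ennreal" where
  "nl_energy n = (\<integral>\<^sup>+s. (ennreal (norm (nlc (u s) n)))\<^sup>2 \<partial>M)"

lemma zsum_nl_energy: "zsum nl_energy < top"
proof -
  have "zsum nl_energy = (\<integral>\<^sup>+s. zsum (\<lambda>n. (ennreal (norm (nlc (u s) n)))\<^sup>2) \<partial>M)"
    unfolding nl_energy_def by (rule nn_integral_zsum [symmetric]) measurable
  with mild_nlc_L2 show ?thesis by simp
qed

lemma norm_mild_split:
  "ennreal (norm (u t n)) \<le> heat_maj (\<lambda>n. norm (b n)) t n + duh (\<lambda>s n. ennreal (norm (nlc (u s) n))) t n"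
proof -
  have "ennreal (norm (u t n)) \<le> ennreal (norm (complex_of_real (exp (- (lam n * t))) * b n) + norm (duhc (\<lambda>s. nlc (u s)) t n))"
    by (subst eq) (intro ennreal_leI norm_triangle_ineq)
  also have "\<dots> = heat_maj (\<lambda>n. norm (b n)) t n + ennreal (norm (duhc (\<lambda>s. nlc (u s)) t n))"
    unfolding norm_heat_term [symmetric] by (rule ennreal_plus) simp_all
  also have "\<dots> \<le> heat_maj (\<lambda>n. norm (b n)) t n + duh (\<lambda>s n. ennreal (norm (nlc (u s) n))) t n"
    by (intro add_left_mono norm_duhc_le AE_I2) simp
  finally show ?thesis .
qed

text \<open>The right-hand side is summable and independent of \<open>t\<close>. It places every
  \<open>u t\<close> in \<open>H^(3/2)\<close> and later dominates differences, which turns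
  continuity of each coefficient into continuity in norm.\<close>

lemma mild_sup_bound:
  assumes "t \<in> I"
  shows "ennreal (lam n) * (ennreal (norm (u t n)))\<^sup>2 \<le> 2 * (ennreal (lam n * (norm (b n))\<^sup>2) + nl_energy n)"
proof -
  let ?h = "heat_maj (\<lambda>n. norm (b n)) t n" and ?d = "duh (\<lambda>s n. ennreal (norm (nlc (u s) n))) t n"
  have "?h \<le> ennreal (norm (b n))"
    using I_nonneg [OF assms] unfolding heat_maj_def
    by (intro ennreal_leI mult_left_le_one_le) auto
  then have "?h\<^sup>2 \<le> (ennreal (norm (b n)))\<^sup>2" by (rule power_mono) simp
  then have h: "ennreal (lam n) * ?h\<^sup>2 \<le> ennreal (lam n * (norm (b n))\<^sup>2)"
    by (simp add: ennreal_mult ennreal_power mult_left_mono)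
  have d: "ennreal (lam n) * ?d\<^sup>2 \<le> nl_energy n"
    unfolding nl_energy_def by (rule duh_sup_estimate) measurable
  have "ennreal (lam n) * (ennreal (norm (u t n)))\<^sup>2 \<le> ennreal (lam n) * (2 * (?h\<^sup>2 + ?d\<^sup>2))"
    by (intro mult_left_mono order_trans [OF power_mono [OF norm_mild_split] ennreal_add_power2_le]) simp_all
  also have "\<dots> = 2 * (ennreal (lam n) * ?h\<^sup>2 + ennreal (lam n) * ?d\<^sup>2)"
    by (simp add: algebra_simps)
  also have "\<dots> \<le> 2 * (ennreal (lam n * (norm (b n))\<^sup>2) + nl_energy n)"
    by (intro mult_left_mono add_mono h d) simp
  finally show ?thesis .
qed

lemma mild_sup_bound_summable: "zsum (\<lambda>n. 2 * (ennreal (lam n * (norm (b n))\<^sup>2) + nl_energy n)) < top"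
  using b zsum_nl_energy by (simp add: nn_integral_cmult nn_integral_add ennreal_mult_less_top)

lemma mild_L2_H3: "(\<integral>\<^sup>+t. wsq (\<lambda>n. (lam n)\<^sup>2) (\<lambda>n. ennreal (norm (u t n))) \<partial>M) < top"
proof -
  let ?h = "heat_maj (\<lambda>n. norm (b n))" and ?d = "duh (\<lambda>s n. ennreal (norm (nlc (u s) n)))"
  let ?l = "\<lambda>n. (lam n)\<^sup>2"
  have "(\<integral>\<^sup>+t. wsq ?l (\<lambda>n. ennreal (norm (u t n))) \<partial>M) \<le> (\<integral>\<^sup>+t. 2 * (wsq ?l (?h t) + wsq ?l (?d t)) \<partial>M)"
    by (intro nn_integral_mono order_trans [OF wsq_mono [OF norm_mild_split] wsq_add_le])
  also have "\<dots> = 2 * ((\<integral>\<^sup>+t. wsq ?l (?h t) \<partial>M) + (\<integral>\<^sup>+t. wsq ?l (?d t) \<partial>M))"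
    by (simp add: nn_integral_cmult nn_integral_add)
  also have "\<dots> \<le> 2 * (zsum (\<lambda>n. ennreal (lam n * (norm (b n))\<^sup>2)) +
      (\<integral>\<^sup>+s. zsum (\<lambda>n. (ennreal (norm (nlc (u s) n)))\<^sup>2) \<partial>M))"
    by (intro mult_left_mono add_mono heat_maj_wsq_lam2 duh_wsq_lam2) simp_all
  also have "\<dots> < top" using b mild_nlc_L2 by (simp add: ennreal_mult_less_top)
  finally show ?thesis .
qed

lemma mild_continuous: "t \<in> I \<Longrightarrow> ((\<lambda>t'. u t' n) \<longlongrightarrow> u t n) (at t within I)"
  unfolding tendsto_at_iff_sequentially o_def
proof (intro allI impI)
  fix X assume "X \<longlonglongrightarrow> t"
  have "nl_energy n \<le> zsum nl_energy" by (rule zsum_term_le)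
  then have "nl_energy n < top" using zsum_nl_energy by simp
  then have "(\<lambda>i. duhc (\<lambda>s. nlc (u s)) (X i) n) \<longlonglongrightarrow> duhc (\<lambda>s. nlc (u s)) t n"
    unfolding nl_energy_def by (intro duhc_tendsto \<open>X \<longlonglongrightarrow> t\<close>) measurable
  then have "(\<lambda>i. of_real (exp (- (lam n * X i))) * b n + duhc (\<lambda>s. nlc (u s)) (X i) n)
      \<longlonglongrightarrow> of_real (exp (- (lam n * t))) * b n + duhc (\<lambda>s. nlc (u s)) t n"
    by (intro tendsto_intros \<open>X \<longlonglongrightarrow> t\<close>)
  then show "(\<lambda>i. u (X i) n) \<longlonglongrightarrow> u t n"
    unfolding eq [symmetric] .
qed

end

end


section \<open>The nonlinearity on the Fourier side\<close>

text \<open>Translates between the unordered sums of the definitions and the counting-measure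
  integrals of the estimates.\<close>

lemma zsum_ennreal:
  fixes f :: "int \<Rightarrow> real"
  assumes "\<And>n. 0 \<le> f n"
  shows "f summable_on UNIV \<longleftrightarrow> zsum (\<lambda>n. ennreal (f n)) < top"
    and "f summable_on UNIV \<Longrightarrow> zsum (\<lambda>n. ennreal (f n)) = ennreal (infsum f UNIV)"
proof -
  have n: "(\<lambda>n. norm (f n)) = f" using assms by auto
  have e: "Infinite_Sum.abs_summable_on f UNIV \<longleftrightarrow> integrable (count_space UNIV) f"
    unfolding abs_summable_equivalent Infinite_Set_Sum.abs_summable_on_def ..
  have "integrable (count_space UNIV) f \<longleftrightarrow> zsum (\<lambda>n. ennreal (f n)) < top"
    by (simp add: integrable_iff_bounded assms)
  with e show "f summable_on UNIV \<longleftrightarrow> zsum (\<lambda>n. ennreal (f n)) < top"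
    unfolding n by simp
  assume s: "f summable_on UNIV"
  have a: "Infinite_Set_Sum.abs_summable_on f UNIV"
    using s unfolding abs_summable_equivalent [symmetric] n .
  have "zsum (\<lambda>n. ennreal (f n)) = ennreal (infsetsum f UNIV)"
    by (rule nn_integral_conv_infsetsum [OF a assms])
  also have "infsetsum f UNIV = infsum f UNIV"
    by (rule infsetsum_infsum [OF a])
  finally show "zsum (\<lambda>n. ennreal (f n)) = ennreal (infsum f UNIV)" .
qed

text \<open>The squared norm of \<open>Hdot s\<close>, with value \<infinity> when the series
  diverges. \<open>Hdot_norm\<close> alone cannot detect membership, since a divergent
  \<open>infsum\<close> has value \<open>0\<close>.\<close>

definition esq :: "real \<Rightarrow> torus_distribution \<Rightarrow> ennreal" where
  "esq s v = wsq (\<lambda>n. \<bar>real_of_int n\<bar> powr (2 * s)) (\<lambda>n. ennreal (norm (fourier_coeff v n)))"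

lemma esq_eq: "esq s v = zsum (\<lambda>n. ennreal (\<bar>real_of_int n\<bar> powr (2 * s) * (norm (fourier_coeff v n))\<^sup>2))"
  by (simp add: esq_def wsq_def ennreal_mult ennreal_power)

lemma Hdot_iff_esq: "v \<in> Hdot s \<longleftrightarrow> fourier_coeff v 0 = 0 \<and> esq s v < top"
  unfolding Hdot_iff esq_eq by (subst zsum_ennreal(1)) simp_all

lemma Hdot_norm_esq: "v \<in> Hdot s \<Longrightarrow> ennreal ((Hdot_norm s v)\<^sup>2) = esq s v"
  unfolding esq_eq Hdot_norm_def Hdot_iff
  by (subst zsum_ennreal(2)) (simp_all add: infsum_nonneg)

lemma Hdot_norm_nonneg: "0 \<le> Hdot_norm s v"
  by (simp add: Hdot_norm_def infsum_nonneg)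

lemma esq_diff_le: "esq s (u - v) \<le> 2 * (esq s u + esq s v)"
proof -
  have "esq s (u - v) \<le> wsq (\<lambda>n. \<bar>real_of_int n\<bar> powr (2 * s))
      (\<lambda>n. ennreal (norm (fourier_coeff u n)) + ennreal (norm (fourier_coeff v n)))"
    unfolding esq_def
  proof (rule wsq_mono)
    fix n
    have "norm (fourier_coeff (u - v) n) \<le> norm (fourier_coeff u n) + norm (fourier_coeff v n)"
      unfolding fourier_coeff_minus by (rule norm_triangle_ineq4)
    then show "ennreal (norm (fourier_coeff (u - v) n)) \<le>
        ennreal (norm (fourier_coeff u n)) + ennreal (norm (fourier_coeff v n))"
      by (simp flip: ennreal_plus)
  qed
  also have "\<dots> \<le> 2 * (esq s u + esq s v)"
    unfolding esq_def by (rule wsq_add_le)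
  finally show ?thesis .
qed

lemma Hdot_diff: "u \<in> Hdot s \<Longrightarrow> v \<in> Hdot s \<Longrightarrow> u - v \<in> Hdot s"
  unfolding Hdot_iff_esq
  by (auto simp: fourier_coeff_minus ennreal_mult_less_top intro: order_le_less_trans [OF esq_diff_le])

text \<open>Makes each nonzero mode continuous for the norm, which does not see
  \<open>n = 0\<close>.\<close>

lemma Hdot_norm_ge_coeff:
  assumes "v \<in> Hdot s" "n \<noteq> 0"
  shows "norm (fourier_coeff v n) \<le> \<bar>real_of_int n\<bar> powr (- s) * Hdot_norm s v"
proof -
  let ?p = "\<bar>real_of_int n\<bar> powr s" and ?c = "norm (fourier_coeff v n)"
  have p2: "\<bar>real_of_int n\<bar> powr (2 * s) = ?p\<^sup>2"
    by (simp only: mult_2 powr_add power2_eq_square)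
  have "ennreal (\<bar>real_of_int n\<bar> powr (2 * s) * ?c\<^sup>2) \<le> esq s v"
    unfolding esq_eq by (rule zsum_term_le)
  also have "\<dots> = ennreal ((Hdot_norm s v)\<^sup>2)" by (rule Hdot_norm_esq [OF assms(1), symmetric])
  finally have "\<bar>real_of_int n\<bar> powr (2 * s) * ?c\<^sup>2 \<le> (Hdot_norm s v)\<^sup>2"
    by (subst (asm) ennreal_le_iff) simp_all
  then have "(?p * ?c)\<^sup>2 \<le> (Hdot_norm s v)\<^sup>2" unfolding p2 power_mult_distrib .
  then have "?p * ?c \<le> Hdot_norm s v"
    by (rule power2_le_imp_le) (rule Hdot_norm_nonneg)
  then have "\<bar>real_of_int n\<bar> powr (- s) * (?p * ?c) \<le> \<bar>real_of_int n\<bar> powr (- s) * Hdot_norm s v"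
    by (rule mult_left_mono) simp
  moreover have "\<bar>real_of_int n\<bar> powr (- s) * ?p = 1"
    using assms(2) by (subst powr_add [symmetric]) simp
  ultimately show ?thesis by (simp add: mult.assoc [symmetric])
qed

text \<open>The product of \<open>f\<close> and \<open>\<Lambda>^3 f\<close> must exist before the
  commutator can cancel anything, so all pairs of frequencies count here. Polynomial growth in
  \<open>n\<close> suffices: \<open>k\<close> has \<open>3/4\<close> derivatives too many, and they
  are moved to \<open>n - k\<close> by
  \<open>\<bar>k\<bar> \<le> (1 + \<bar>n\<bar>) * \<bar>n - k\<bar>\<close>. At
  \<open>n = k\<close> the mean \<open>a 0\<close> vanishes.\<close>

lemma conv_term_le:
  assumes "a 0 = (0 :: complex)"
  shows "norm (a (n - k)) * (\<bar>real_of_int k\<bar> powr 3 * norm (a k)) \<le>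
    (1 + \<bar>real_of_int n\<bar>) * ((\<bar>real_of_int (n - k)\<bar> powr (9 / 4) * norm (a (n - k))) *
      (\<bar>real_of_int k\<bar> powr (9 / 4) * norm (a k)))"
proof (cases "n - k = 0")
  case False
  let ?k = "\<bar>real_of_int k\<bar>" and ?n = "\<bar>real_of_int n\<bar>" and ?d = "\<bar>real_of_int (n - k)\<bar>"
  have d1: "1 \<le> ?d" using False by linarith
  have "?k \<le> ?n + ?d" by simp
  also have "\<dots> \<le> ?n * ?d + ?d" using d1 mult_left_mono [of 1 ?d ?n] by simp
  finally have "?k \<le> (1 + ?n) * ?d" by (simp add: algebra_simps)
  then have "?k powr (3 / 4) \<le> ((1 + ?n) * ?d) powr (3 / 4)" by (intro powr_mono2) auto
  also have "\<dots> = (1 + ?n) powr (3 / 4) * ?d powr (3 / 4)" by (rule powr_mult)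
  also have "\<dots> \<le> (1 + ?n) powr 1 * ?d powr (9 / 4)"
    using d1 by (intro mult_mono powr_mono) auto
  finally have le: "?k powr (3 / 4) \<le> (1 + ?n) * ?d powr (9 / 4)" by simp
  have "?k powr 3 = ?k powr (3 / 4) * ?k powr (9 / 4)" by (subst powr_add [symmetric]) simp
  then have "norm (a (n - k)) * (?k powr 3 * norm (a k)) =
      ?k powr (3 / 4) * (norm (a (n - k)) * (?k powr (9 / 4) * norm (a k)))" by (simp only: mult_ac)
  also have "\<dots> \<le> ((1 + ?n) * ?d powr (9 / 4)) * (norm (a (n - k)) * (?k powr (9 / 4) * norm (a k)))"
    by (intro mult_right_mono le) auto
  finally show ?thesis by (simp only: mult_ac)
qed (simp add: assms)

lemma zsum_reflect: "zsum (\<lambda>k. f (n - k)) = zsum f"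
proof (rule nn_integral_bij_count_space)
  show "bij (\<lambda>k :: int. n - k)"
    by (rule bij_betw_byWitness [where f' = "\<lambda>k. n - k"]) auto
qed

lemma ennreal_power2_le_imp_le:
  fixes x y :: ennreal
  assumes "x\<^sup>2 \<le> y\<^sup>2" shows "x \<le> y"
proof (cases "x = top \<or> y = top")
  case True
  with assms show ?thesis by (auto simp: top_unique power2_eq_square ennreal_mult_eq_top_iff)
next
  case False
  then obtain a b where "x = ennreal a" "0 \<le> a" "y = ennreal b" "0 \<le> b"
    by (metis ennreal_cases)
  with assms show ?thesis
    by (auto simp: ennreal_power intro!: ennreal_leI dest: power2_le_imp_le)
qed

lemma conv_zsum_le:
  fixes a :: "int \<Rightarrow> complex"
  assumes "a 0 = 0"
  shows "zsum (\<lambda>k. ennreal (norm (a (n - k)) * (\<bar>real_of_int k\<bar> powr 3 * norm (a k)))) \<le>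
    ennreal (1 + \<bar>real_of_int n\<bar>) * wsq wgt (\<lambda>k. ennreal (norm (a k)))"
proof -
  let ?A = "\<lambda>k. ennreal (\<bar>real_of_int k\<bar> powr (9 / 4) * norm (a k))"
  have A2: "zsum (\<lambda>k. (?A k)\<^sup>2) = wsq wgt (\<lambda>k. ennreal (norm (a k)))"
    unfolding wsq_def
  proof (rule nn_integral_cong)
    fix k
    have "(\<bar>real_of_int k\<bar> powr (9 / 4))\<^sup>2 = wgt k"
      unfolding wgt_powr power2_eq_square by (subst powr_add [symmetric]) simp
    then show "(?A k)\<^sup>2 = ennreal (wgt k) * (ennreal (norm (a k)))\<^sup>2"
      by (simp add: ennreal_power power_mult_distrib flip: ennreal_mult)
  qed
  have "(zsum (\<lambda>k. ?A (n - k) * ?A k))\<^sup>2 \<le> zsum (\<lambda>k. (?A (n - k))\<^sup>2) * zsum (\<lambda>k. (?A k)\<^sup>2)"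
    by (rule Cauchy_Schwarz_nn_integral) simp_all
  also have "zsum (\<lambda>k. (?A (n - k))\<^sup>2) = zsum (\<lambda>k. (?A k)\<^sup>2)"
    by (rule zsum_reflect)
  finally have "(zsum (\<lambda>k. ?A (n - k) * ?A k))\<^sup>2 \<le> (wsq wgt (\<lambda>k. ennreal (norm (a k))))\<^sup>2"
    unfolding A2 by (simp add: power2_eq_square)
  then have cs: "zsum (\<lambda>k. ?A (n - k) * ?A k) \<le> wsq wgt (\<lambda>k. ennreal (norm (a k)))"
    by (rule ennreal_power2_le_imp_le)
  have "zsum (\<lambda>k. ennreal (norm (a (n - k)) * (\<bar>real_of_int k\<bar> powr 3 * norm (a k)))) \<le>
      zsum (\<lambda>k. ennreal (1 + \<bar>real_of_int n\<bar>) * (?A (n - k) * ?A k))"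
  proof (rule nn_integral_mono)
    fix k
    show "ennreal (norm (a (n - k)) * (\<bar>real_of_int k\<bar> powr 3 * norm (a k))) \<le>
        ennreal (1 + \<bar>real_of_int n\<bar>) * (?A (n - k) * ?A k)"
      using ennreal_leI [OF conv_term_le [of a n k, OF assms]]
      by (simp only: ennreal_mult mult_nonneg_nonneg norm_ge_zero powr_ge_zero abs_ge_zero add_nonneg_nonneg zero_le_one)
  qed
  also have "\<dots> = ennreal (1 + \<bar>real_of_int n\<bar>) * zsum (\<lambda>k. ?A (n - k) * ?A k)"
    by (rule nn_integral_cmult) simp
  also have "\<dots> \<le> ennreal (1 + \<bar>real_of_int n\<bar>) * wsq wgt (\<lambda>k. ennreal (norm (a k)))"
    by (intro mult_left_mono cs) simp
  finally show ?thesis .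
qed

lemma esq_wgt: "esq (9 / 4) v = wsq wgt (\<lambda>n. ennreal (norm (fourier_coeff v n)))"
  by (simp add: esq_def wgt_powr [abs_def])

lemma esq_lam2: "esq 3 v = wsq (\<lambda>n. (lam n)\<^sup>2) (\<lambda>n. ennreal (norm (fourier_coeff v n)))"
proof -
  have "(lam n)\<^sup>2 = \<bar>real_of_int n\<bar> powr (2 * 3)" for n
    by (simp add: lam_def flip: power_mult)
  then show ?thesis by (simp add: esq_def)
qed

text \<open>The bounded symbol \<open>m\<close> covers both products of the commutator at once, with
  \<open>\<Lambda>^3 f\<close> and with its Hilbert transform.\<close>

lemma fourier_coeff_dist_mult_Lambda3:
  assumes f: "f \<in> Hdot (9 / 4)"
    and g: "\<And>k. fourier_coeff g k = m k * (of_real (\<bar>real_of_int k\<bar> powr 3) * fourier_coeff f k)"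
    and m: "\<And>k. norm (m k) \<le> 1"
  shows "(\<lambda>k. fourier_coeff f (n - k) * fourier_coeff g k) summable_on UNIV"
    and "fourier_coeff (dist_mult f g) n = (\<Sum>\<^sub>\<infinity>k\<in>UNIV. fourier_coeff f (n - k) * fourier_coeff g k)"
proof -
  let ?a = "fourier_coeff f"
  let ?t = "\<lambda>n k. norm (?a (n - k)) * (\<bar>real_of_int k\<bar> powr 3 * norm (?a k))"
  have a0: "?a 0 = 0" and fin: "wsq wgt (\<lambda>k. ennreal (norm (?a k))) < top"
    using f unfolding Hdot_iff_esq esq_wgt by auto
  obtain w where w: "wsq wgt (\<lambda>k. ennreal (norm (?a k))) = ennreal w" "0 \<le> w"
    using fin by (cases "wsq wgt (\<lambda>k. ennreal (norm (?a k)))") auto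
  have le: "zsum (\<lambda>k. ennreal (?t n k)) \<le> ennreal ((1 + \<bar>real_of_int n\<bar>) * w)" for n
    using conv_zsum_le [of ?a n, OF a0] w by (simp add: ennreal_mult)
  have ts: "?t n summable_on UNIV" for n
    by (subst zsum_ennreal(1)) (use le [of n] in \<open>auto intro: order_le_less_trans\<close>)
  have tle: "infsum (?t n) UNIV \<le> w * (1 + \<bar>real_of_int n\<bar>) ^ 1" for n
    using le [of n] unfolding zsum_ennreal(2) [OF _ ts, of n, simplified]
    by (subst (asm) zsum_ennreal(2) [OF _ ts]) (simp_all add: ennreal_le_iff w(2) mult.commute)
  have term_le: "norm (?a (n - k) * fourier_coeff g k) \<le> ?t n k" for n k
  proof -
    have "norm (fourier_coeff g k) = norm (m k) * (\<bar>real_of_int k\<bar> powr 3 * norm (?a k))"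
      unfolding g by (simp only: norm_mult norm_of_real abs_of_nonneg [OF powr_ge_zero])
    also have "\<dots> \<le> 1 * (\<bar>real_of_int k\<bar> powr 3 * norm (?a k))"
      by (intro mult_right_mono m) simp
    finally have "norm (fourier_coeff g k) \<le> \<bar>real_of_int k\<bar> powr 3 * norm (?a k)" by simp
    then show ?thesis by (simp add: norm_mult mult_left_mono)
  qed
  have abs: "(\<lambda>k. norm (?a (n - k) * fourier_coeff g k)) summable_on UNIV" for n
    by (rule summable_on_comparison_test [OF ts [of n]]) (use term_le in auto)
  show "(\<lambda>k. ?a (n - k) * fourier_coeff g k) summable_on UNIV"
    by (rule abs_summable_summable [OF abs])
  have "poly_bounded (\<lambda>n. \<Sum>\<^sub>\<infinity>k\<in>UNIV. ?a (n - k) * fourier_coeff g k)"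
  proof (rule poly_boundedI)
    fix n
    have "norm (\<Sum>\<^sub>\<infinity>k\<in>UNIV. ?a (n - k) * fourier_coeff g k) \<le> (\<Sum>\<^sub>\<infinity>k\<in>UNIV. norm (?a (n - k) * fourier_coeff g k))"
      by (rule norm_infsum_bound [OF abs])
    also have "\<dots> \<le> infsum (?t n) UNIV"
      by (rule infsum_mono [OF abs ts term_le])
    also have "\<dots> \<le> w * (1 + \<bar>real_of_int n\<bar>) ^ 1" by (rule tle)
    finally show "norm (\<Sum>\<^sub>\<infinity>k\<in>UNIV. ?a (n - k) * fourier_coeff g k) \<le> w * (1 + \<bar>real_of_int n\<bar>) ^ 1" .
  qed
  then show "fourier_coeff (dist_mult f g) n = (\<Sum>\<^sub>\<infinity>k\<in>UNIV. ?a (n - k) * fourier_coeff g k)"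
    unfolding dist_mult_def by (rule fourier_coeff_dist_of_coeffs)
qed

text \<open>The commutator keeps exactly the interactions between frequencies \<open>n\<close> and \<open>k\<close> of opposite
  sign.\<close>

lemma commutator_symbol:
  "of_int n * (of_int (sgn n) - of_int (sgn k)) * \<bar>real_of_int k\<bar> powr 3 = nlker n k"
  by (auto simp: nlker_def sgn_if mult_less_0_iff split: if_splits)

text \<open>Both products converge absolutely on their own, so they may be merged into one series,
  in which the signs cancel term by term.\<close>

lemma fourier_coeff_nonlinearity:
  assumes f: "f \<in> Hdot (9 / 4)"
  shows "fourier_coeff (nonlinearity f) n = nlc (fourier_coeff f) n"
proof -
  let ?a = "fourier_coeff f"
  let ?L = "Lambda_pow 3 f"
  have L: "fourier_coeff ?L k = of_real (\<bar>real_of_int k\<bar> powr 3) * ?a k" for k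
    by (rule fourier_coeff_Lambda_pow)
  have HL: "fourier_coeff (hilbert_transform ?L) k =
      (- \<i> * of_int (sgn k)) * (of_real (\<bar>real_of_int k\<bar> powr 3) * ?a k)" for k
    by (simp add: fourier_coeff_hilbert L)
  have "fourier_coeff ?L k = 1 * (of_real (\<bar>real_of_int k\<bar> powr 3) * ?a k)" for k
    by (simp only: L mult_1_left)
  note 1 = fourier_coeff_dist_mult_Lambda3 [OF f this eq_refl [OF norm_one]]
  have "norm (- \<i> * of_int (sgn k) :: complex) \<le> 1" for k
    by (simp add: norm_mult sgn_if)
  note 2 = fourier_coeff_dist_mult_Lambda3 [OF f HL this]
  let ?s1 = "\<lambda>k. ?a (n - k) * fourier_coeff ?L k"
  let ?s2 = "\<lambda>k. ?a (n - k) * fourier_coeff (hilbert_transform ?L) k"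
  have s1: "?s1 summable_on UNIV" and s2: "?s2 summable_on UNIV"
    by (rule 1(1), rule 2(1))
  have "fourier_coeff (nonlinearity f) n =
      \<i> * of_int n * (- \<i> * of_int (sgn n) * infsum ?s1 UNIV - infsum ?s2 UNIV)"
    unfolding nonlinearity_def commutator_def fourier_coeff_dist_deriv fourier_coeff_minus
      fourier_coeff_hilbert [of "dist_mult f ?L"] 1(2) 2(2) ..
  also have "\<dots> = of_int n * of_int (sgn n) * infsum ?s1 UNIV + (- \<i> * of_int n) * infsum ?s2 UNIV"
    by (simp add: algebra_simps)
  also have "\<dots> = (\<Sum>\<^sub>\<infinity>k\<in>UNIV. of_int n * of_int (sgn n) * ?s1 k + (- \<i> * of_int n) * ?s2 k)"
    unfolding infsum_cmult_right' [symmetric]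
    by (rule infsum_add [symmetric]) (intro summable_on_cmult_right s1 s2)+
  also have "\<dots> = (\<Sum>\<^sub>\<infinity>k\<in>UNIV. of_real (nlker n k) * (?a (n - k) * ?a k))"
  proof (rule infsum_cong)
    fix k
    show "of_int n * of_int (sgn n) * ?s1 k + (- \<i> * of_int n) * ?s2 k = of_real (nlker n k) * (?a (n - k) * ?a k)"
      unfolding commutator_symbol [symmetric] L HL by (simp add: algebra_simps)
  qed
  also have "\<dots> = infsetsum (\<lambda>k. of_real (nlker n k) * (?a (n - k) * ?a k)) UNIV"
  proof (rule infsetsum_infsum [symmetric])
    have "wsq wgt (\<lambda>n. ennreal (norm (?a n))) < top"
      using f unfolding Hdot_iff_esq esq_wgt by blast
    then have "integrable (count_space UNIV) (\<lambda>k. complex_of_real (nlker n k) * (?a (n - k) * ?a k))"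
      by (intro integrable_nlc [where U = "\<lambda>n. ennreal (norm (?a n))"] nle_finite) simp_all
    then show "Infinite_Set_Sum.abs_summable_on (\<lambda>k. complex_of_real (nlker n k) * (?a (n - k) * ?a k)) UNIV"
      unfolding Infinite_Set_Sum.abs_summable_on_def .
  qed
  finally show ?thesis by (simp add: infsetsum_def nlc_def)
qed


section \<open>The Duhamel equation on the Fourier side\<close>

text \<open>Elements of \<open>Lp_Hdot\<close> are controlled only almost everywhere; completeness
  of Lebesgue measure carries measurability across null sets.\<close>

lemma lebesgue_on_AE_measurable:
  fixes f g :: "real \<Rightarrow> 'b::euclidean_space"
  assumes S: "S \<in> sets lebesgue" and g: "g \<in> borel_measurable (lebesgue_on S)"
    and ae: "AE x in lebesgue_on S. f x = g x"
  shows "f \<in> borel_measurable (lebesgue_on S)"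
proof -
  let ?f = "\<lambda>x. if x \<in> S then f x else 0" and ?g = "\<lambda>x. if x \<in> S then g x else 0"
  have g': "?g \<in> borel_measurable lebesgue"
    using g S by (simp add: borel_measurable_if)
  have "AE x in lebesgue. x \<in> S \<longrightarrow> f x = g x"
    using ae S by (subst (asm) AE_restrict_space_iff) simp_all
  then have ae': "AE x in lebesgue. ?f x = ?g x" by eventually_elim simp
  have "?f \<in> borel_measurable lebesgue"
  proof (rule measurableI)
    fix A :: "'b set" assume "A \<in> sets borel"
    then have "?g -` A \<inter> space lebesgue \<in> sets lebesgue" by (rule measurable_sets [OF g'])
    moreover have "AE x in lebesgue. x \<in> ?g -` A \<inter> space lebesgue \<longleftrightarrow> x \<in> ?f -` A \<inter> space lebesgue"
      using ae' by eventually_elim simp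
    ultimately show "?f -` A \<inter> space lebesgue \<in> sets lebesgue"
      by (intro completion.in_sets_AE [of "?g -` A \<inter> space lebesgue" "?f -` A \<inter> space lebesgue" lborel]) simp_all
  qed simp
  then show ?thesis using S by (simp add: borel_measurable_if)
qed

lemma pairing_heat_fmode:
  "0 \<le> \<tau> \<Longrightarrow> pairing (heat_semigroup \<tau> v) (fmode (- n)) =
    2 * pi * (of_real (exp (- (lam n * \<tau>))) * fourier_coeff v n)"
  by (simp add: pairing_fmode fourier_coeff_heat_semigroup lam_def mult.commute)

lemma fourier_coeff_heat_lam:
  "0 \<le> \<tau> \<Longrightarrow> fourier_coeff (heat_semigroup \<tau> v) n = of_real (exp (- (lam n * \<tau>))) * fourier_coeff v n"
  by (simp add: fourier_coeff_heat_semigroup lam_def mult.commute)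

context time_interval begin

lemma initial_interval: "t \<in> I \<Longrightarrow> lebesgue_on {0..t} = restrict_space M {0..t}"
  using I_down [of t] I_sets by (subst restrict_restrict_space) (auto simp: Int_absorb1)

lemma initial_interval_sets: "t \<in> I \<Longrightarrow> {0..t} \<inter> space M \<in> sets M"
  using I_down [of t] I_sets by (auto simp: sets_restrict_space_iff Int_absorb2)

lemma integral_initial:
  fixes g :: "real \<Rightarrow> complex"
  assumes "t \<in> I"
  shows "integral\<^sup>L (lebesgue_on {0..t}) g = (LINT s|M. indicator {0..t} s *\<^sub>R g s)"
    and "integrable (lebesgue_on {0..t}) g \<longleftrightarrow> integrable M (\<lambda>s. indicator {0..t} s *\<^sub>R g s)"
  unfolding initial_interval [OF assms]
  using initial_interval_sets [OF assms]
  by (simp_all only: integral_restrict_space integrable_restrict_space)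

lemma hkr_indicator:
  "s \<in> I \<Longrightarrow> indicator {0..t} s *\<^sub>R (of_real (exp (- (lam n * (t - s)))) * z) = of_real (hkr n t s) * (z :: complex)"
  using I_nonneg [of s] by (auto simp: hkr_def indicator_def)

context
  fixes f :: "real \<Rightarrow> torus_distribution"
  assumes good: "AE s in M. f s \<in> Hdot (9 / 4)"
    and meas [measurable]: "\<And>n. (\<lambda>s. fourier_coeff (f s) n) \<in> borel_measurable M"
begin

abbreviation N where "N s \<equiv> nlc (fourier_coeff (f s))"

text \<open>The weak equation is tested with a single mode. The nonlinearity has the coefficients
  \<open>N\<close> only at times with \<open>f s\<close> in \<open>H^(9/4)\<close>, hence almost
  everywhere.\<close>

lemma duhamel_imp_coeff:
  assumes t: "t \<in> I" and d: "duhamel f0 f t"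
  shows "integrable M (\<lambda>s. of_real (hkr n t s) * N s n)"
    and "fourier_coeff (f t) n = of_real (exp (- (lam n * t))) * fourier_coeff f0 n + duhc N t n"
proof -
  let ?g = "\<lambda>s. pairing (heat_semigroup (t - s) (nonlinearity (f s))) (fmode (- n))"
  have g: "AE s in M. indicator {0..t} s *\<^sub>R ?g s = 2 * pi * (of_real (hkr n t s) * N s n)"
    using good AE_space
  proof eventually_elim
    case (elim s)
    then have s: "s \<in> I" by simp
    show ?case
    proof (cases "s \<le> t")
      case True
      have "?g s = 2 * pi * (of_real (exp (- (lam n * (t - s)))) * N s n)"
        using True elim by (simp add: pairing_heat_fmode fourier_coeff_nonlinearity)
      then have "indicator {0..t} s *\<^sub>R ?g s =
          2 * pi * (indicator {0..t} s *\<^sub>R (of_real (exp (- (lam n * (t - s)))) * N s n))"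
        by (simp only: mult_scaleR_right)
      then show ?thesis by (simp only: hkr_indicator [OF s])
    qed (simp add: hkr_def)
  qed
  have int: "integrable (lebesgue_on {0..t}) ?g"
    and eq: "pairing (f t) (fmode (- n)) = pairing (heat_semigroup t f0) (fmode (- n)) + integral\<^sup>L (lebesgue_on {0..t}) ?g"
    using d fmode_test_function unfolding duhamel_def by blast+
  have int': "integrable M (\<lambda>s. indicator {0..t} s *\<^sub>R ?g s)"
    using int by (simp only: integral_initial(2) [OF t])
  have m: "(\<lambda>s. 2 * pi * (of_real (hkr n t s) * N s n)) \<in> borel_measurable M" by measurable
  have "integrable M (\<lambda>s. 2 * pi * (of_real (hkr n t s) * N s n))"
    by (rule integrable_cong_AE_imp [OF int' m g])
  then have "integrable M (\<lambda>s. (1 / (2 * pi)) * (2 * pi * (of_real (hkr n t s) * N s n)))"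
    by (rule Bochner_Integration.integrable_mult_right)
  then show "integrable M (\<lambda>s. of_real (hkr n t s) * N s n)" by simp
  have "integral\<^sup>L (lebesgue_on {0..t}) ?g = (LINT s|M. 2 * pi * (of_real (hkr n t s) * N s n))"
    unfolding integral_initial(1) [OF t]
    by (rule integral_cong_AE [OF borel_measurable_integrable [OF int'] m g])
  also have "\<dots> = 2 * pi * duhc N t n" by (simp add: duhc_def)
  finally have "2 * pi * fourier_coeff (f t) n =
      2 * pi * (of_real (exp (- (lam n * t))) * fourier_coeff f0 n + duhc N t n)"
    using eq I_nonneg [OF t] by (simp add: pairing_fmode pairing_heat_fmode distrib_left fourier_coeff_heat_lam)
  then show "fourier_coeff (f t) n = of_real (exp (- (lam n * t))) * fourier_coeff f0 n + duhc N t n"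
    by simp
qed

text \<open>The Fourier series of the test function is inserted, and its sum is exchanged with the
  time integral by dominated convergence. The \<open>L^2\<close> bound on \<open>N\<close> supplies
  the dominating function.\<close>

lemma coeff_imp_duhamel:
  assumes t: "t \<in> I"
    and L2: "(\<integral>\<^sup>+s. zsum (\<lambda>n. ennreal ((norm (N s n))\<^sup>2)) \<partial>M) < top"
    and eq: "\<And>n. fourier_coeff (f t) n = of_real (exp (- (lam n * t))) * fourier_coeff f0 n + duhc N t n"
  shows "duhamel f0 f t"
  unfolding duhamel_def
proof (intro ballI)
  fix \<phi> assume \<phi>: "\<phi> \<in> test_functions"
  let ?c = "torus_coeff \<phi>" and ?J = "\<lambda>j::nat. {- int j..int j}"
  let ?g = "\<lambda>s. pairing (heat_semigroup (t - s) (nonlinearity (f s))) \<phi>"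
  let ?h = "\<lambda>s. indicator {0..t} s *\<^sub>R ?g s / (2 * pi)"
  define K where "K = (\<Sum>\<^sub>\<infinity>m\<in>UNIV. norm (?c m))"
  define e where "e = (\<lambda>s. enn2real (zsum (\<lambda>n. ennreal ((norm (N s n))\<^sup>2))))"
  \<comment> \<open>The cut-off at \<open>t\<close> makes \<open>1\<close> integrable even on an
    unbounded \<open>I\<close>; with \<open>norm z \<le> 1 + (norm z)^2\<close>, the
    \<open>L^2\<close> bound then acts as an \<open>L^1\<close> bound.\<close>
  define w where "w = (\<lambda>s. (1 + e s) * indicator {..t} s)"
  define G where "G = (\<lambda>j s. \<Sum>m\<in>?J j. ?c m * (of_real (hkr (- m) t s) * N s (- m)))"
  note cs = fourier_inversion(1) [OF \<phi>]
  have [measurable]: "e \<in> borel_measurable M" unfolding e_def by measurable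
  have e_nonneg: "0 \<le> e s" for s by (simp add: e_def)
  have fin: "AE s in M. zsum (\<lambda>n. ennreal ((norm (N s n))\<^sup>2)) < top"
    using nn_integral_PInf_AE [of "\<lambda>s. zsum (\<lambda>n. ennreal ((norm (N s n))\<^sup>2))" M] L2
    by (simp add: less_top)
  have w_int: "integrable M w"
  proof (rule integrableI_bounded)
    have "(\<integral>\<^sup>+s. ennreal (norm (w s)) \<partial>M) \<le>
        (\<integral>\<^sup>+s. indicator {0..t} s + zsum (\<lambda>n. ennreal ((norm (N s n))\<^sup>2)) \<partial>M)"
    proof (rule nn_integral_mono)
      fix s assume "s \<in> space M"
      then have "0 \<le> s" using I_nonneg by simp
      have "ennreal (e s) \<le> zsum (\<lambda>n. ennreal ((norm (N s n))\<^sup>2))"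
        by (simp add: e_def ennreal_enn2real_if)
      then show "ennreal (norm (w s)) \<le> indicator {0..t} s + zsum (\<lambda>n. ennreal ((norm (N s n))\<^sup>2))"
        using \<open>0 \<le> s\<close> e_nonneg [of s] by (auto simp: w_def indicator_def add_left_mono)
    qed
    also have "\<dots> = (\<integral>\<^sup>+s. indicator {0..t} s \<partial>M) + (\<integral>\<^sup>+s. zsum (\<lambda>n. ennreal ((norm (N s n))\<^sup>2)) \<partial>M)"
      by (rule nn_integral_add) measurable
    also have "(\<integral>\<^sup>+s. indicator {0..t} s \<partial>M) \<le> (\<integral>\<^sup>+s. indicator {0..t} s \<partial>lborel)"
      by (rule nn_integral_lebesgue_on_le [OF I_sets])
    also have "(\<integral>\<^sup>+s. indicator {0..t} s \<partial>lborel) + (\<integral>\<^sup>+s. zsum (\<lambda>n. ennreal ((norm (N s n))\<^sup>2)) \<partial>M) < top"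
      using L2 by (simp add: emeasure_lborel_Icc_eq)
    finally show "(\<integral>\<^sup>+s. ennreal (norm (w s)) \<partial>M) < \<infinity>" by (simp add: add_right_mono)
  qed (unfold w_def, measurable)
  have sum_le: "(\<Sum>n\<in>F. (norm (N s n))\<^sup>2) \<le> e s"
    if "finite F" "zsum (\<lambda>n. ennreal ((norm (N s n))\<^sup>2)) < top" for F s
  proof -
    have s: "(\<lambda>n. (norm (N s n))\<^sup>2) summable_on UNIV"
      using that(2) by (subst zsum_ennreal(1)) simp_all
    then have "e s = (\<Sum>\<^sub>\<infinity>n\<in>UNIV. (norm (N s n))\<^sup>2)"
      unfolding e_def by (subst zsum_ennreal(2)) (simp_all add: infsum_nonneg)
    then show ?thesis using finite_sum_le_infsum [OF s that(1)] by simp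
  qed
  have norm_le: "norm z \<le> 1 + (norm z)\<^sup>2" for z :: complex
    using sum_squares_bound [of 1 "norm z"] norm_ge_zero [of z]
    unfolding power_one mult_1_right by linarith
  have term_int: "integrable M (\<lambda>s. of_real (hkr n t s) * N s n)" for n
  proof (rule Bochner_Integration.integrable_bound [OF w_int])
    show "AE s in M. norm (complex_of_real (hkr n t s) * N s n) \<le> norm (w s)"
      using fin
    proof eventually_elim
      case (elim s)
      have "norm (N s n) \<le> 1 + e s"
        using norm_le [of "N s n"] sum_le [of "{n}", OF _ elim] by simp
      moreover have "hkr n t s \<le> 1" if "s \<le> t" using that by (simp add: hkr_def)
      ultimately have "hkr n t s * norm (N s n) \<le> 1 * (1 + e s)" if "s \<le> t"
        using that by (intro mult_mono) (auto simp: hkr_nonneg)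
      then show ?case
        using e_nonneg [of s] by (auto simp: w_def norm_mult hkr_def indicator_def)
    qed
  qed measurable
  have lim: "AE s in M. (\<lambda>j. G j s) \<longlonglongrightarrow> ?h s"
    using good AE_space
  proof eventually_elim
    case (elim s)
    then have s: "s \<in> I" by simp
    show ?case
    proof (cases "s \<le> t")
      case True
      have "fourier_coeff (heat_semigroup (t - s) (nonlinearity (f s))) (- m) =
          of_real (hkr (- m) t s) * N s (- m)" for m
        using True elim by (simp add: fourier_coeff_heat_lam fourier_coeff_nonlinearity hkr_def)
      with has_sum_imp_symmetric_limit [OF pairing_has_sum [OF \<phi>, of "heat_semigroup (t - s) (nonlinearity (f s))"]]
      show ?thesis using True I_nonneg [OF s] by (simp add: G_def)
    qed (simp add: G_def hkr_def)
  qed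
  have G_meas [measurable]: "G j \<in> borel_measurable M" for j unfolding G_def by measurable
  \<comment> \<open>Measurability of the pairing is obtained from its being almost everywhere the
    limit of the measurable \<open>G j\<close>.\<close>
  have h_meas: "?h \<in> borel_measurable M"
  proof (rule lebesgue_on_AE_measurable [OF I_sets])
    show "(\<lambda>s. lim (\<lambda>j. G j s)) \<in> borel_measurable M"
      by (rule borel_measurable_lim_metric) measurable
    show "AE s in M. ?h s = lim (\<lambda>j. G j s)"
      using lim by eventually_elim (simp add: limI)
  qed
  have dom: "AE s in M. norm (G j s) \<le> (1 + K) * w s" for j
    using fin
  proof eventually_elim
    case (elim s)
    show ?case
    proof (cases "s \<le> t")
      case True
      have cK: "norm (?c m) \<le> K" for m
        unfolding K_def using finite_sum_le_infsum [OF cs, of "{m}"] by simp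
      have "norm (G j s) \<le> (\<Sum>m\<in>?J j. norm (?c m) + K * (norm (N s (- m)))\<^sup>2)"
        unfolding G_def
      proof (rule sum_norm_le)
        fix m
        have "norm (?c m * (of_real (hkr (- m) t s) * N s (- m))) = hkr (- m) t s * (norm (?c m) * norm (N s (- m)))"
          by (simp add: norm_mult)
        also have "\<dots> \<le> 1 * (norm (?c m) * norm (N s (- m)))"
          by (intro mult_right_mono) (simp_all add: hkr_def)
        also have "\<dots> \<le> norm (?c m) * (1 + (norm (N s (- m)))\<^sup>2)"
          using norm_le by (simp add: mult_left_mono)
        also have "\<dots> \<le> norm (?c m) + K * (norm (N s (- m)))\<^sup>2"
          using mult_right_mono [OF cK, of "(norm (N s (- m)))\<^sup>2" m] by (simp add: distrib_left)
        finally show "norm (?c m * (of_real (hkr (- m) t s) * N s (- m))) \<le> norm (?c m) + K * (norm (N s (- m)))\<^sup>2" .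
      qed
      also have "\<dots> = (\<Sum>m\<in>?J j. norm (?c m)) + K * (\<Sum>m\<in>?J j. (norm (N s (- m)))\<^sup>2)"
        by (simp add: sum.distrib sum_distrib_left)
      also have "(\<Sum>m\<in>?J j. (norm (N s (- m)))\<^sup>2) = (\<Sum>m\<in>?J j. (norm (N s m))\<^sup>2)"
        by (rule sum.reindex_bij_witness [of _ uminus uminus]) auto
      also have "(\<Sum>m\<in>?J j. norm (?c m)) + K * (\<Sum>m\<in>?J j. (norm (N s m))\<^sup>2) \<le> K + K * e s"
      proof (intro add_mono mult_left_mono)
        show "(\<Sum>m\<in>?J j. norm (?c m)) \<le> K"
          unfolding K_def by (rule finite_sum_le_infsum [OF cs]) auto
        show "(\<Sum>m\<in>?J j. (norm (N s m))\<^sup>2) \<le> e s" by (rule sum_le [OF _ elim]) simp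
        show "0 \<le> K" using cK [of 0] norm_ge_zero order_trans by blast
      qed
      also have "\<dots> \<le> (1 + K) * (1 + e s)" using e_nonneg [of s] by (simp add: algebra_simps)
      finally show ?thesis using True by (simp add: w_def)
    qed (simp add: G_def hkr_def w_def)
  qed
  have wK: "integrable M (\<lambda>s. (1 + K) * w s)" using w_int by simp
  have h_int: "integrable M ?h"
    by (rule integrable_dominated_convergence [OF h_meas G_meas wK lim dom])
  have "(\<lambda>j. LINT s|M. G j s) \<longlonglongrightarrow> (LINT s|M. ?h s)"
    by (rule integral_dominated_convergence [OF h_meas G_meas wK lim dom])
  moreover have "(LINT s|M. G j s) = (\<Sum>m\<in>?J j. ?c m * duhc N t (- m))" for j
    unfolding G_def duhc_def
    by (subst Bochner_Integration.integral_sum) (simp_all add: term_int)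
  ultimately have "(\<lambda>j. \<Sum>m\<in>?J j. ?c m * duhc N t (- m)) \<longlonglongrightarrow> (LINT s|M. ?h s)" by simp
  moreover have "(\<lambda>j. \<Sum>m\<in>?J j. ?c m * (of_real (exp (- (lam (- m) * t))) * fourier_coeff f0 (- m)))
      \<longlonglongrightarrow> pairing (heat_semigroup t f0) \<phi> / (2 * pi)"
    using has_sum_imp_symmetric_limit [OF pairing_has_sum [OF \<phi>, of "heat_semigroup t f0"]] I_nonneg [OF t]
    by (simp only: fourier_coeff_heat_lam)
  ultimately have "(\<lambda>j. (\<Sum>m\<in>?J j. ?c m * (of_real (exp (- (lam (- m) * t))) * fourier_coeff f0 (- m))) +
      (\<Sum>m\<in>?J j. ?c m * duhc N t (- m))) \<longlonglongrightarrow> pairing (heat_semigroup t f0) \<phi> / (2 * pi) + (LINT s|M. ?h s)"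
    by (intro tendsto_add)
  moreover have "(\<Sum>m\<in>?J j. ?c m * (of_real (exp (- (lam (- m) * t))) * fourier_coeff f0 (- m))) +
      (\<Sum>m\<in>?J j. ?c m * duhc N t (- m)) = (\<Sum>m\<in>?J j. ?c m * fourier_coeff (f t) (- m))" for j
    unfolding eq sum.distrib [symmetric] distrib_left ..
  ultimately have "(\<lambda>j. \<Sum>m\<in>?J j. ?c m * fourier_coeff (f t) (- m)) \<longlonglongrightarrow>
      pairing (heat_semigroup t f0) \<phi> / (2 * pi) + (LINT s|M. ?h s)" by simp
  with has_sum_imp_symmetric_limit [OF pairing_has_sum [OF \<phi>, of "f t"]]
  have "pairing (f t) \<phi> / (2 * pi) = pairing (heat_semigroup t f0) \<phi> / (2 * pi) + (LINT s|M. ?h s)"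
    by (rule LIMSEQ_unique)
  moreover have "(LINT s|M. ?h s) = integral\<^sup>L (lebesgue_on {0..t}) ?g / (2 * pi)"
    unfolding integral_initial(1) [OF t] by (rule integral_divide_zero)
  moreover have "integrable M (\<lambda>s. (2 * pi) * ?h s)" using h_int by (rule Bochner_Integration.integrable_mult_right)
  then have "integrable (lebesgue_on {0..t}) ?g"
  proof -
    have "2 * pi * ?h s = indicator {0..t} s *\<^sub>R ?g s" for s
      by (simp add: scaleR_conv_of_real)
    with \<open>integrable M (\<lambda>s. (2 * pi) * ?h s)\<close> show ?thesis
      unfolding integral_initial(2) [OF t] by (simp only:)
  qed
  ultimately show "integrable (lebesgue_on {0..t}) ?g \<and>
      pairing (f t) \<phi> = pairing (heat_semigroup t f0) \<phi> + integral\<^sup>L (lebesgue_on {0..t}) ?g"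
    by (simp add: field_simps)
qed

end

end


section \<open>Bochner spaces\<close>

text \<open>Dominated convergence over frequencies. It serves both strong measurability and
  continuity in time.\<close>

lemma Hdot_norm_tendsto_0:
  assumes v: "\<And>i. v i \<in> Hdot s" and w: "w \<in> Hdot s"
    and lim: "\<And>n. (\<lambda>i :: nat. fourier_coeff (v i) n) \<longlonglongrightarrow> fourier_coeff w n"
    and bd: "\<And>i n. ennreal (\<bar>real_of_int n\<bar> powr (2 * s) * (norm (fourier_coeff (v i) n - fourier_coeff w n))\<^sup>2) \<le> B n"
    and fin: "zsum B < top"
  shows "(\<lambda>i. Hdot_norm s (v i - w)) \<longlonglongrightarrow> 0"
proof -
  have "(\<lambda>i. esq s (v i - w)) \<longlonglongrightarrow> zsum (\<lambda>n. 0)"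
    unfolding esq_eq fourier_coeff_minus
  proof (rule nn_integral_dominated_convergence [where w = B])
    show "AE n in count_space UNIV.
        (\<lambda>i. ennreal (\<bar>real_of_int n\<bar> powr (2 * s) * (norm (fourier_coeff (v i) n - fourier_coeff w n))\<^sup>2)) \<longlonglongrightarrow> 0"
    proof (rule AE_I2)
      fix n
      have "(\<lambda>i. ennreal (\<bar>real_of_int n\<bar> powr (2 * s) * (norm (fourier_coeff (v i) n - fourier_coeff w n))\<^sup>2))
          \<longlonglongrightarrow> ennreal (\<bar>real_of_int n\<bar> powr (2 * s) * (norm (fourier_coeff w n - fourier_coeff w n))\<^sup>2)"
        by (intro tendsto_ennrealI tendsto_mult tendsto_const tendsto_power tendsto_norm tendsto_diff lim)
      then show "(\<lambda>i. ennreal (\<bar>real_of_int n\<bar> powr (2 * s) * (norm (fourier_coeff (v i) n - fourier_coeff w n))\<^sup>2)) \<longlonglongrightarrow> 0"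
        by simp
    qed
  qed (use bd fin in simp_all)
  then have "(\<lambda>i. ennreal ((Hdot_norm s (v i - w))\<^sup>2)) \<longlonglongrightarrow> ennreal 0"
    by (simp add: Hdot_norm_esq [OF Hdot_diff [OF v w]])
  then have "(\<lambda>i. (Hdot_norm s (v i - w))\<^sup>2) \<longlonglongrightarrow> 0"
    by (subst (asm) tendsto_ennreal_iff) simp_all
  then have "(\<lambda>i. sqrt ((Hdot_norm s (v i - w))\<^sup>2)) \<longlonglongrightarrow> sqrt 0"
    by (rule tendsto_real_sqrt)
  then show ?thesis by (simp add: Hdot_norm_nonneg)
qed

lemma poly_bounded_finite_support:
  assumes "finite A" "\<And>n. n \<notin> A \<Longrightarrow> a n = 0" shows "poly_bounded a"
proof (rule poly_boundedI)
  fix n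
  show "norm (a n) \<le> (\<Sum>m\<in>A. norm (a m)) * (1 + \<bar>real_of_int n\<bar>) ^ 0"
    using assms member_le_sum [of n A "\<lambda>m. norm (a m)"] by (cases "n \<in> A") (auto intro: sum_nonneg)
qed

lemma trig_poly_Hdot:
  assumes "finite A" "\<And>n. n \<notin> A \<Longrightarrow> a n = 0" "a 0 = 0"
  shows "dist_of_coeffs a \<in> Hdot s"
proof -
  have c: "fourier_coeff (dist_of_coeffs a) n = a n" for n
    by (rule fourier_coeff_dist_of_coeffs [OF poly_bounded_finite_support [OF assms(1,2)]])
  have "(\<lambda>n. \<bar>real_of_int n\<bar> powr (2 * s) * (norm (a n))\<^sup>2) summable_on A"
    using assms(1) by simp
  then have "(\<lambda>n. \<bar>real_of_int n\<bar> powr (2 * s) * (norm (a n))\<^sup>2) summable_on UNIV"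
    by (subst summable_on_cong_neutral [of A UNIV]) (use assms(2) in auto)
  with assms(3) show ?thesis by (simp add: Hdot_iff c)
qed

text \<open>Again \<open>u u - v v = (u - v) u + v (u - v)\<close>; in contrast to
  \<open>norm_nlc_diff_le\<close>, the two sequences are unrelated.\<close>

lemma norm_nlc_diff_le_nle:
  assumes "wsq wgt (\<lambda>n. ennreal (norm (u n))) < top" "wsq wgt (\<lambda>n. ennreal (norm (v n))) < top"
  shows "ennreal (norm (nlc u n - nlc v n)) \<le>
    nle (\<lambda>m. ennreal (norm (u m - v m))) (\<lambda>m. ennreal (norm (u m))) n +
    nle (\<lambda>m. ennreal (norm (v m))) (\<lambda>m. ennreal (norm (u m - v m))) n"
proof -
  let ?f = "\<lambda>u k. complex_of_real (nlker n k) * (u (n - k) * u k)"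
  have i: "integrable (count_space UNIV) (?f u)" "integrable (count_space UNIV) (?f v)"
    using assms by (auto intro!: integrable_nlc nle_finite)
  have "nlc u n - nlc v n = (LINT k|count_space UNIV. ?f u k - ?f v k)"
    unfolding nlc_def by (rule Bochner_Integration.integral_diff [OF i, symmetric])
  then have "ennreal (norm (nlc u n - nlc v n)) \<le> zsum (\<lambda>k. ennreal (norm (?f u k - ?f v k)))"
    using integral_norm_bound_ennreal [OF Bochner_Integration.integrable_diff [OF i]] by simp
  also have "\<dots> \<le> zsum (\<lambda>k. ennreal (nlker n k) * (ennreal (norm (u (n - k) - v (n - k))) * ennreal (norm (u k))) +
      ennreal (nlker n k) * (ennreal (norm (v (n - k))) * ennreal (norm (u k - v k))))"
  proof (rule nn_integral_mono)
    fix k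
    have "?f u k - ?f v k = of_real (nlker n k) * ((u (n - k) - v (n - k)) * u k + v (n - k) * (u k - v k))"
      by (simp add: algebra_simps)
    then have "norm (?f u k - ?f v k) = nlker n k * norm ((u (n - k) - v (n - k)) * u k + v (n - k) * (u k - v k))"
      by (simp only: norm_mult norm_of_real abs_of_nonneg [OF nlker_nonneg])
    also have "\<dots> \<le> nlker n k * (norm (u (n - k) - v (n - k)) * norm (u k) + norm (v (n - k)) * norm (u k - v k))"
      unfolding norm_mult [symmetric] by (intro mult_left_mono norm_triangle_ineq) simp
    finally have "ennreal (norm (?f u k - ?f v k)) \<le>
        ennreal (nlker n k * (norm (u (n - k) - v (n - k)) * norm (u k)) + nlker n k * (norm (v (n - k)) * norm (u k - v k)))"
      by (intro ennreal_leI) (simp add: distrib_left)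
    then show "ennreal (norm (?f u k - ?f v k)) \<le>
        ennreal (nlker n k) * (ennreal (norm (u (n - k) - v (n - k))) * ennreal (norm (u k))) +
        ennreal (nlker n k) * (ennreal (norm (v (n - k))) * ennreal (norm (u k - v k)))"
      by (simp add: ennreal_mult ennreal_plus)
  qed
  also have "\<dots> = nle (\<lambda>m. ennreal (norm (u m - v m))) (\<lambda>m. ennreal (norm (u m))) n +
    nle (\<lambda>m. ennreal (norm (v m))) (\<lambda>m. ennreal (norm (u m - v m))) n"
    unfolding nle_def by (rule nn_integral_add) simp_all
  finally show ?thesis .
qed

lemma nlc_zero [simp]: "nlc u 0 = 0"
  by (simp add: nlc_def)

context time_interval begin

text \<open>A nonzero coefficient is continuous for the norm, hence almost everywhere a limit of
  simple functions. The norm ignores \<open>n = 0\<close>, where membership in \<open>Hdot\<close>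
  fixes the value.\<close>

lemma Lp_Hdot_coeff_measurable:
  assumes f: "f \<in> Lp_Hdot p I s"
  shows "(\<lambda>t. fourier_coeff (f t) n) \<in> borel_measurable M"
proof -
  obtain F :: "nat \<Rightarrow> real \<Rightarrow> torus_distribution" where
    F: "\<And>j. simple_function M (F j)" "\<And>j t. t \<in> I \<Longrightarrow> F j t \<in> Hdot s"
      "AE t in M. (\<lambda>j. Hdot_norm s (F j t - f t)) \<longlonglongrightarrow> 0"
    and fH: "AE t in M. f t \<in> Hdot s"
    using f unfolding Lp_Hdot_def by blast
  show ?thesis
  proof (cases "n = 0")
    case True
    have "AE t in M. fourier_coeff (f t) 0 = 0" using fH by eventually_elim (simp add: Hdot_iff)
    with True show ?thesis
      by (simp add: lebesgue_on_AE_measurable [OF I_sets borel_measurable_const])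
  next
    case False
    have m: "(\<lambda>t. fourier_coeff (F j t) n) \<in> borel_measurable M" for j
      by (intro borel_measurable_simple_function simple_function_compose1 [OF F(1), of "\<lambda>v. fourier_coeff v n"])
    have "AE t in M. fourier_coeff (f t) n = lim (\<lambda>j. fourier_coeff (F j t) n)"
      using F(3) fH AE_space
    proof eventually_elim
      case (elim t)
      then have t: "t \<in> I" by simp
      have "(\<lambda>j. fourier_coeff (F j t) n - fourier_coeff (f t) n) \<longlonglongrightarrow> 0"
      proof (rule Lim_null_comparison)
        show "\<forall>\<^sub>F j in sequentially. norm (fourier_coeff (F j t) n - fourier_coeff (f t) n) \<le>
            \<bar>real_of_int n\<bar> powr (- s) * Hdot_norm s (F j t - f t)"
          using Hdot_norm_ge_coeff [OF Hdot_diff [OF F(2) [OF t] elim(2)] False]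
          unfolding fourier_coeff_minus by (intro always_eventually allI)
        show "(\<lambda>j. \<bar>real_of_int n\<bar> powr (- s) * Hdot_norm s (F j t - f t)) \<longlonglongrightarrow> 0"
          using tendsto_mult_left [OF elim(1), of "\<bar>real_of_int n\<bar> powr (- s)"] by simp
      qed
      then have "(\<lambda>j. fourier_coeff (F j t) n) \<longlonglongrightarrow> fourier_coeff (f t) n"
        by (rule LIM_zero_cancel)
      then show ?case by (simp add: limI)
    qed
    then show ?thesis
      by (rule lebesgue_on_AE_measurable [OF I_sets borel_measurable_lim_metric [OF m]])
  qed
qed

text \<open>A simple function with values in sequences is assembled one coordinate at a time;
  finiteness of \<open>A\<close> keeps its range finite.\<close>

lemma simple_function_coeffs:
  assumes "finite A" "\<And>n. simple_function M (\<sigma> n)"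
  shows "simple_function M (\<lambda>t n. if n \<in> A then \<sigma> n t else (0 :: complex))"
  using assms(1)
proof (induction A)
  case (insert m A)
  have "simple_function M (\<lambda>t. (\<lambda>g z. g (m := z)) (\<lambda>n. if n \<in> A then \<sigma> n t else 0) (\<sigma> m t))"
    by (rule simple_function_compose2 [OF insert.IH assms(2)])
  moreover have "(\<lambda>g z. g (m := z)) (\<lambda>n. if n \<in> A then \<sigma> n t else 0) (\<sigma> m t) =
      (\<lambda>n. if n \<in> insert m A then \<sigma> n t else 0)" for t by auto
  ultimately show ?case by simp
qed simp

text \<open>Strong measurability follows from measurability of the coefficients: at stage
  \<open>j\<close> the nonzero modes up to \<open>j\<close> are replaced by simple functions and the
  others dropped, which leaves trigonometric polynomials of zero mean.\<close>

lemma Lp_HdotI: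
  assumes m: "\<And>n. (\<lambda>t. fourier_coeff (f t) n) \<in> borel_measurable M"
    and H: "AE t in M. f t \<in> Hdot s"
    and int: "integrable M (\<lambda>t. Hdot_norm s (f t) ^ p)"
  shows "f \<in> Lp_Hdot p I s"
proof -
  have "\<exists>F. (\<forall>i. simple_function M (F i)) \<and> (\<forall>t\<in>space M. (\<lambda>i. F i t) \<longlonglongrightarrow> fourier_coeff (f t) n) \<and>
      (\<forall>i. \<forall>t\<in>space M. dist (F i t) 0 \<le> 2 * dist (fourier_coeff (f t) n) 0)" for n
    by (rule borel_measurable_implies_sequence_metric [OF m])
  then obtain \<sigma> where \<sigma>: "\<And>n i. simple_function M (\<sigma> n i)"
    "\<And>n t. t \<in> I \<Longrightarrow> (\<lambda>i. \<sigma> n i t) \<longlonglongrightarrow> fourier_coeff (f t) n"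
    "\<And>n i t. t \<in> I \<Longrightarrow> norm (\<sigma> n i t) \<le> 2 * norm (fourier_coeff (f t) n)"
    by (simp add: dist_norm) metis
  define A where "A = (\<lambda>j::nat. {- int j..int j} - {0})"
  define a where "a = (\<lambda>j t n. if n \<in> A j then \<sigma> n j t else 0)"
  define F where "F = (\<lambda>j t. dist_of_coeffs (a j t))"
  have A: "finite (A j)" for j by (simp add: A_def)
  have supp: "a j t n = 0" if "n \<notin> A j" for j t n using that by (simp add: a_def)
  have Fc: "fourier_coeff (F j t) n = a j t n" for j t n
    unfolding F_def by (rule fourier_coeff_dist_of_coeffs [OF poly_bounded_finite_support [OF A supp]])
  have FH: "F j t \<in> Hdot s" for j t
    unfolding F_def by (rule trig_poly_Hdot [OF A supp]) (auto simp: a_def A_def)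
  have simple: "simple_function M (F j)" for j
    unfolding F_def a_def
    by (rule simple_function_compose1 [OF simple_function_coeffs [OF A \<sigma>(1)]])
  have "AE t in M. (\<lambda>j. Hdot_norm s (F j t - f t)) \<longlonglongrightarrow> 0"
    using H AE_space
  proof eventually_elim
    case (elim t)
    then have t: "t \<in> I" by simp
    let ?c = "fourier_coeff (f t)"
    show ?case
    proof (rule Hdot_norm_tendsto_0 [OF FH elim(1)])
      show "(\<lambda>i. fourier_coeff (F i t) n) \<longlonglongrightarrow> ?c n" for n
      proof (cases "n = 0")
        case True
        with elim(1) show ?thesis by (simp add: Fc a_def A_def Hdot_iff)
      next
        case False
        have "\<forall>\<^sub>F i in sequentially. \<sigma> n i t = fourier_coeff (F i t) n"
          using eventually_ge_at_top [of "nat \<bar>n\<bar>"]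
          by eventually_elim (use False in \<open>auto simp: Fc a_def A_def\<close>)
        then show ?thesis using \<sigma>(2) [OF t, of n] by (rule Lim_transform_eventually [rotated])
      qed
      \<comment> \<open>The approximants have norm at most twice that of the coefficient, so the
        difference is at most three times it, whence \<open>9 = 3^2\<close>.\<close>
      show "ennreal (\<bar>real_of_int n\<bar> powr (2 * s) * (norm (fourier_coeff (F i t) n - ?c n))\<^sup>2) \<le>
          9 * ennreal (\<bar>real_of_int n\<bar> powr (2 * s) * (norm (?c n))\<^sup>2)" for i n
      proof -
        have "norm (fourier_coeff (F i t) n - ?c n) \<le> norm (fourier_coeff (F i t) n) + norm (?c n)"
          by (rule norm_triangle_ineq4)
        also have "\<dots> \<le> 3 * norm (?c n)"
          using \<sigma>(3) [OF t, of n i] by (simp add: Fc a_def)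
        finally have "(norm (fourier_coeff (F i t) n - ?c n))\<^sup>2 \<le> (3 * norm (?c n))\<^sup>2"
          by (rule power_mono) simp
        then have "\<bar>real_of_int n\<bar> powr (2 * s) * (norm (fourier_coeff (F i t) n - ?c n))\<^sup>2 \<le>
            \<bar>real_of_int n\<bar> powr (2 * s) * (3 * norm (?c n))\<^sup>2" by (rule mult_left_mono) simp
        also have "\<dots> = 9 * (\<bar>real_of_int n\<bar> powr (2 * s) * (norm (?c n))\<^sup>2)"
          by (simp add: power_mult_distrib)
        finally show ?thesis
          by (subst ennreal_numeral [symmetric], subst ennreal_mult [symmetric]) (auto intro: ennreal_leI)
      qed
      have "zsum (\<lambda>n. 9 * ennreal (\<bar>real_of_int n\<bar> powr (2 * s) * (norm (?c n))\<^sup>2)) = 9 * esq s (f t)"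
        unfolding esq_eq by (rule nn_integral_cmult) simp
      also have "\<dots> < top" using elim(1) by (simp add: Hdot_iff_esq ennreal_mult_less_top)
      finally show "zsum (\<lambda>n. 9 * ennreal (\<bar>real_of_int n\<bar> powr (2 * s) * (norm (?c n))\<^sup>2)) < top" .
    qed
  qed
  with H int simple FH show ?thesis unfolding Lp_Hdot_def by blast
qed

text \<open>The norm is an \<open>infsum\<close>; measurability is proved for its
  \<open>ennreal\<close> version and transferred where the two agree.\<close>

lemma Hdot_norm_measurable:
  assumes [measurable]: "\<And>n. (\<lambda>t. fourier_coeff (f t) n) \<in> borel_measurable M"
    and "AE t in M. f t \<in> Hdot s"
  shows "(\<lambda>t. Hdot_norm s (f t)) \<in> borel_measurable M"
proof (rule lebesgue_on_AE_measurable [OF I_sets])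
  show "(\<lambda>t. sqrt (enn2real (esq s (f t)))) \<in> borel_measurable M"
    unfolding esq_def by measurable
  show "AE t in M. Hdot_norm s (f t) = sqrt (enn2real (esq s (f t)))"
    using assms(2) by eventually_elim (simp add: Hdot_norm_esq [symmetric] Hdot_norm_nonneg)
qed

lemma x4_Lp_Hdot:
  assumes f: "f \<in> Lp_Hdot 4 I (9 / 4)"
  shows "x4 M (\<lambda>t n. ennreal (norm (fourier_coeff (f t) n))) < top"
proof -
  have H: "AE t in M. f t \<in> Hdot (9 / 4)" and int: "integrable M (\<lambda>t. Hdot_norm (9 / 4) (f t) ^ 4)"
    using f unfolding Lp_Hdot_def by blast+
  have "x4 M (\<lambda>t n. ennreal (norm (fourier_coeff (f t) n))) = (\<integral>\<^sup>+t. ennreal (norm (Hdot_norm (9 / 4) (f t) ^ 4)) \<partial>M)"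
    unfolding x4_def esq_wgt [symmetric]
  proof (rule nn_integral_cong_AE, use H in eventually_elim)
    fix t assume t: "f t \<in> Hdot (9 / 4)"
    show "(esq (9 / 4) (f t))\<^sup>2 = ennreal (norm (Hdot_norm (9 / 4) (f t) ^ 4))"
      unfolding Hdot_norm_esq [OF t, symmetric]
      by (simp add: ennreal_power Hdot_norm_nonneg flip: power_mult)
  qed
  also have "\<dots> < top" using int unfolding integrable_iff_bounded by simp
  finally show ?thesis .
qed

end


section \<open>Well-posedness\<close>

context time_interval begin

lemma duhc_cong: "(\<And>s. s \<in> I \<Longrightarrow> h s n = h' s n) \<Longrightarrow> duhc h t n = duhc h' t n"
  unfolding duhc_def by (intro Bochner_Integration.integral_cong) simp_all

text \<open>The difference of two solutions obeys a linear inequality whose coefficients are the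
  solutions themselves, which is the setting of \<open>majorant_uniqueness\<close>. The weight
  \<open>wgt\<close> is blind to \<open>n = 0\<close>, where both coefficients are
  \<open>0\<close>.\<close>

lemma duhamel_unique:
  assumes f: "f \<in> Lp_Hdot 4 I (9 / 4)" and g: "g \<in> Lp_Hdot 4 I (9 / 4)"
    and df: "AE t in M. duhamel f0 f t" and dg: "AE t in M. duhamel f0 g t"
  shows "AE t in M. g t = f t"
proof -
  let ?a = "\<lambda>t. fourier_coeff (f t)" and ?c = "\<lambda>t. fourier_coeff (g t)"
  let ?F = "\<lambda>t n. ennreal (norm (?a t n))" and ?G = "\<lambda>t n. ennreal (norm (?c t n))"
    and ?W = "\<lambda>t n. ennreal (norm (?a t n - ?c t n))"
  note m [measurable] = Lp_Hdot_coeff_measurable [OF f] Lp_Hdot_coeff_measurable [OF g]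
  have fH: "AE t in M. f t \<in> Hdot (9 / 4)" and gH: "AE t in M. g t \<in> Hdot (9 / 4)"
    using f g unfolding Lp_Hdot_def by blast+
  note xF = x4_Lp_Hdot [OF f] and xG = x4_Lp_Hdot [OF g]
  have "x4 M ?W \<le> x4 M (\<lambda>t n. ?F t n + ?G t n)"
    unfolding x4_def
    by (intro nn_integral_mono power_mono wsq_mono)
      (simp_all add: norm_triangle_ineq4 ennreal_leI flip: ennreal_plus)
  also have "\<dots> \<le> 8 * (x4 M ?F + x4 M ?G)" by (rule x4_add) measurable
  also have "\<dots> < top" using xF xG by (simp add: ennreal_mult_less_top)
  finally have xW: "x4 M ?W < top" .
  have nl: "AE s in M. \<forall>n. ennreal (norm (nlc (?a s) n - nlc (?c s) n)) \<le>
      nle (?W s) (?F s) n + nle (?G s) (?W s) n"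
    using fH gH by eventually_elim (auto simp: Hdot_iff_esq esq_wgt intro!: norm_nlc_diff_le_nle)
  have "AE t in M. \<forall>n. ?W t n \<le> duh (\<lambda>s n. nle (?W s) (?F s) n + nle (?G s) (?W s) n) t n"
    using df dg AE_space
  proof eventually_elim
    case (elim t)
    then have t: "t \<in> I" by simp
    show ?case
    proof
      fix n
      note ft = duhamel_imp_coeff [OF fH m(1) t elim(1), of n]
      note gt = duhamel_imp_coeff [OF gH m(2) t elim(2), of n]
      have "?a t n - ?c t n = duhc (\<lambda>s. nlc (?a s)) t n - duhc (\<lambda>s. nlc (?c s)) t n"
        unfolding ft(2) gt(2) by simp
      also have "\<dots> = duhc (\<lambda>s n. nlc (?a s) n - nlc (?c s) n) t n"
        unfolding duhc_def right_diff_distrib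
        by (rule Bochner_Integration.integral_diff [OF ft(1) gt(1), symmetric])
      finally show "?W t n \<le> duh (\<lambda>s n. nle (?W s) (?F s) n + nle (?G s) (?W s) n) t n"
        using nl by (simp only:) (rule norm_duhc_le, auto elim: eventually_mono)
    qed
  qed
  then have "AE t in M. wsq wgt (?W t) = 0"
    by (intro majorant_uniqueness [OF _ _ _ xW xF xG]) measurable
  then show ?thesis
    using fH gH
  proof eventually_elim
    case (elim t)
    have "?c t n = ?a t n" for n
    proof (cases "n = 0")
      case False
      have "ennreal (wgt n) * (?W t n)\<^sup>2 \<le> wsq wgt (?W t)"
        unfolding wsq_def by (rule zsum_term_le)
      then have "ennreal (wgt n) * (?W t n)\<^sup>2 = 0" using elim(1) by simp
      then show ?thesis using wgt_pos [OF False] by (simp add: ennreal_eq_0_iff)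
    qed (use elim in \<open>simp add: Hdot_iff\<close>)
    then show ?case by (rule torus_distribution_eqI)
  qed
qed

lemma duhamel_solution:
  assumes f0: "f0 \<in> Hdot (3 / 2)"
    and small: "x4 M (heat_maj (\<lambda>n. norm (fourier_coeff f0 n))) \<le> ennreal (1 / 36864)"
  obtains f where "f \<in> Lp_Hdot 4 I (9 / 4)" "\<And>t. t \<in> I \<Longrightarrow> duhamel f0 f t"
    "f \<in> C_Hdot I (3 / 2)" "f \<in> Lp_Hdot 2 I 3"
proof -
  let ?b = "fourier_coeff f0"
  obtain u where u [measurable]: "\<And>n. (\<lambda>t. u t n) \<in> borel_measurable M"
    and eq: "\<And>t n. u t n = of_real (exp (- (lam n * t))) * ?b n + duhc (\<lambda>s. nlc (u s)) t n"
    and x4u: "x4 M (\<lambda>t n. ennreal (norm (u t n))) < top"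
    using mild_solution_exists [OF small] by blast
  have b0: "?b 0 = 0" and "esq (3 / 2) f0 < top" using f0 by (auto simp: Hdot_iff_esq)
  then have b: "zsum (\<lambda>n. ennreal (lam n * (norm (?b n))\<^sup>2)) < top"
    by (simp add: esq_eq lam_powr)
  note sol = u eq x4u b
  define B where "B = (\<lambda>n. 2 * (ennreal (lam n * (norm (?b n))\<^sup>2) + nl_energy u n))"
  have B: "zsum B < top" unfolding B_def by (rule mild_sup_bound_summable [OF sol])
  have uB: "ennreal (lam n * (norm (u t n))\<^sup>2) \<le> B n" if "t \<in> I" for t n
    using mild_sup_bound [OF sol that, of n] by (simp add: B_def ennreal_mult ennreal_power)
  have u0: "u t 0 = 0" for t by (subst eq) (simp add: b0 duhc_def)
  \<comment> \<open>\<open>dist_of_coeffs\<close> must be meaningful at every time of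
    \<open>I\<close> and not just at almost every one, so the bound is taken from
    \<open>H^(3/2)\<close> and not from \<open>H^(9/4)\<close>.\<close>
  have pb: "poly_bounded (u t)" if t: "t \<in> I" for t
  proof -
    obtain C where C: "zsum B = ennreal C" "0 \<le> C" using B by (cases "zsum B") auto
    have "norm (u t n) \<le> (1 + C) * (1 + \<bar>real_of_int n\<bar>) ^ 0" for n
    proof (cases "n = 0")
      case False
      have "ennreal (lam n * (norm (u t n))\<^sup>2) \<le> ennreal C"
        using order_trans [OF uB [OF t] zsum_term_le [of B n]] C(1) by simp
      then have "lam n * (norm (u t n))\<^sup>2 \<le> C" using C(2) by (simp add: ennreal_le_iff)
      moreover have "1 * (norm (u t n))\<^sup>2 \<le> lam n * (norm (u t n))\<^sup>2"
        by (intro mult_right_mono lam_ge_1 False) simp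
      ultimately have "(norm (u t n))\<^sup>2 \<le> C" by simp
      then show ?thesis
        using sum_squares_bound [of 1 "norm (u t n)"] norm_ge_zero [of "u t n"]
        unfolding power_0 power_one mult_1_right by linarith
    qed (use C u0 in simp)
    then show ?thesis by (rule poly_boundedI)
  qed
  define f where "f = (\<lambda>t. dist_of_coeffs (u t))"
  have fc: "fourier_coeff (f t) n = u t n" if "t \<in> I" for t n
    unfolding f_def by (rule fourier_coeff_dist_of_coeffs [OF pb [OF that]])
  have fc_fun: "fourier_coeff (f t) = u t" if "t \<in> I" for t
    using fc [OF that] by blast
  have f_meas [measurable]: "(\<lambda>t. fourier_coeff (f t) n) \<in> borel_measurable M" for n
    by (subst measurable_cong [of M _ "\<lambda>t. u t n"]) (simp_all add: fc)
  have Hdot_f: "f t \<in> Hdot s" if "t \<in> I" "esq s (f t) < top" for t s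
    using that by (simp add: Hdot_iff_esq fc u0)
  have H94: "AE t in M. f t \<in> Hdot (9 / 4)"
  proof -
    have "AE t in M. wsq wgt (\<lambda>n. ennreal (norm (u t n))) < top"
      by (rule wsq_wgt_finite_AE [OF _ x4u]) measurable
    then show ?thesis
      using AE_space by eventually_elim (auto intro!: Hdot_f simp: esq_wgt fc_fun)
  qed
  have f_C: "f t \<in> Hdot (3 / 2)" if t: "t \<in> I" for t
  proof (rule Hdot_f [OF t])
    have "esq (3 / 2) (f t) \<le> zsum B"
      unfolding esq_eq fc [OF t] using uB [OF t] by (intro nn_integral_mono) (simp add: lam_powr)
    then show "esq (3 / 2) (f t) < top" using B by simp
  qed
  have L4: "f \<in> Lp_Hdot 4 I (9 / 4)"
  proof (rule Lp_HdotI [OF f_meas H94], rule integrableI_bounded)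
    have [measurable]: "(\<lambda>t. Hdot_norm (9 / 4) (f t)) \<in> borel_measurable M"
      by (rule Hdot_norm_measurable [OF f_meas H94])
    show "(\<lambda>t. Hdot_norm (9 / 4) (f t) ^ 4) \<in> borel_measurable M" by measurable
    have "(\<integral>\<^sup>+t. ennreal (norm (Hdot_norm (9 / 4) (f t) ^ 4)) \<partial>M) = x4 M (\<lambda>t n. ennreal (norm (u t n)))"
      unfolding x4_def
    proof (rule nn_integral_cong_AE, use H94 AE_space in eventually_elim)
      fix t assume t: "f t \<in> Hdot (9 / 4)" "t \<in> space M"
      have "(ennreal ((Hdot_norm (9 / 4) (f t))\<^sup>2))\<^sup>2 = (wsq wgt (\<lambda>n. ennreal (norm (u t n))))\<^sup>2"
        using t by (simp add: Hdot_norm_esq esq_wgt fc_fun)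
      then show "ennreal (norm (Hdot_norm (9 / 4) (f t) ^ 4)) = (wsq wgt (\<lambda>n. ennreal (norm (u t n))))\<^sup>2"
        by (simp add: ennreal_power Hdot_norm_nonneg flip: power_mult)
    qed
    then show "(\<integral>\<^sup>+t. ennreal (norm (Hdot_norm (9 / 4) (f t) ^ 4)) \<partial>M) < \<infinity>" using x4u by simp
  qed
  have H3: "AE t in M. f t \<in> Hdot 3"
  proof -
    have "AE t in M. wsq (\<lambda>n. (lam n)\<^sup>2) (\<lambda>n. ennreal (norm (u t n))) \<noteq> \<infinity>"
      using mild_L2_H3 [OF sol] by (intro nn_integral_PInf_AE) (simp_all add: less_top)
    then show ?thesis
      using AE_space by eventually_elim (auto intro!: Hdot_f simp: esq_lam2 fc_fun less_top)
  qed
  have L2: "f \<in> Lp_Hdot 2 I 3"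
  proof (rule Lp_HdotI [OF f_meas H3], rule integrableI_bounded)
    have [measurable]: "(\<lambda>t. Hdot_norm 3 (f t)) \<in> borel_measurable M"
      by (rule Hdot_norm_measurable [OF f_meas H3])
    show "(\<lambda>t. (Hdot_norm 3 (f t))\<^sup>2) \<in> borel_measurable M" by measurable
    have "(\<integral>\<^sup>+t. ennreal (norm ((Hdot_norm 3 (f t))\<^sup>2)) \<partial>M) =
        (\<integral>\<^sup>+t. wsq (\<lambda>n. (lam n)\<^sup>2) (\<lambda>n. ennreal (norm (u t n))) \<partial>M)"
      by (rule nn_integral_cong_AE, use H3 AE_space in eventually_elim)
        (simp add: Hdot_norm_esq esq_lam2 fc_fun)
    then show "(\<integral>\<^sup>+t. ennreal (norm ((Hdot_norm 3 (f t))\<^sup>2)) \<partial>M) < \<infinity>"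
      using mild_L2_H3 [OF sol] by simp
  qed
  have C: "f \<in> C_Hdot I (3 / 2)"
    unfolding C_Hdot_def mem_Collect_eq
  proof (intro conjI ballI)
    fix t assume t: "t \<in> I"
    show "((\<lambda>t'. Hdot_norm (3 / 2) (f t' - f t)) \<longlongrightarrow> 0) (at t within I)"
      unfolding tendsto_at_iff_sequentially o_def
    proof (intro allI impI)
      fix X :: "nat \<Rightarrow> real"
      assume "\<forall>i. X i \<in> I - {t}" and "X \<longlonglongrightarrow> t"
      then have X: "X i \<in> I" "X i \<noteq> t" for i by auto
      show "(\<lambda>i. Hdot_norm (3 / 2) (f (X i) - f t)) \<longlonglongrightarrow> 0"
      proof (rule Hdot_norm_tendsto_0 [OF f_C [OF X(1)] f_C [OF t]])
        show "(\<lambda>i. fourier_coeff (f (X i)) n) \<longlonglongrightarrow> fourier_coeff (f t) n" for n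
        proof -
          have "((\<lambda>t'. u t' n) \<longlongrightarrow> u t n) (at t within I)"
            by (rule mild_continuous [OF sol t])
          then show ?thesis
            using X \<open>X \<longlonglongrightarrow> t\<close> unfolding tendsto_at_iff_sequentially o_def
            by (auto simp: fc [OF X(1)] fc [OF t])
        qed
        show "ennreal (\<bar>real_of_int n\<bar> powr (2 * (3 / 2)) * (norm (fourier_coeff (f (X i)) n - fourier_coeff (f t) n))\<^sup>2) \<le>
            4 * B n" for i n
        proof -
          let ?x = "norm (u (X i) n)" and ?y = "norm (u t n)"
          have "ennreal (norm (u (X i) n - u t n)) \<le> ennreal ?x + ennreal ?y"
            by (simp add: norm_triangle_ineq4 ennreal_leI flip: ennreal_plus)
          then have "(ennreal (norm (u (X i) n - u t n)))\<^sup>2 \<le> 2 * ((ennreal ?x)\<^sup>2 + (ennreal ?y)\<^sup>2)"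
            by (intro order_trans [OF power_mono ennreal_add_power2_le]) simp_all
          then have "ennreal (lam n) * (ennreal (norm (u (X i) n - u t n)))\<^sup>2 \<le>
              ennreal (lam n) * (2 * ((ennreal ?x)\<^sup>2 + (ennreal ?y)\<^sup>2))" by (rule mult_left_mono) simp
          also have "\<dots> = 2 * (ennreal (lam n * ?x\<^sup>2) + ennreal (lam n * ?y\<^sup>2))"
            by (simp add: ennreal_mult ennreal_power algebra_simps)
          also have "\<dots> \<le> 2 * (B n + B n)"
            by (intro mult_left_mono add_mono uB X t) simp
          also have "\<dots> = 4 * B n" by (simp add: mult_2 [symmetric] mult.assoc [symmetric])
          finally show ?thesis
            by (simp add: fc [OF X(1)] fc [OF t] ennreal_mult ennreal_power lam_powr)
        qed
        have "zsum (\<lambda>n. 4 * B n) = 4 * zsum B" by (rule nn_integral_cmult) simp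
        then show "zsum (\<lambda>n. 4 * B n) < top" using B by (simp add: ennreal_mult_less_top)
      qed
    qed
  qed (rule f_C)
  have D: "duhamel f0 f t" if t: "t \<in> I" for t
  proof (rule coeff_imp_duhamel [OF H94 f_meas t])
    have "(\<integral>\<^sup>+s. zsum (\<lambda>n. ennreal ((norm (nlc (fourier_coeff (f s)) n))\<^sup>2)) \<partial>M) =
        (\<integral>\<^sup>+s. zsum (\<lambda>n. (ennreal (norm (nlc (u s) n)))\<^sup>2) \<partial>M)"
      by (intro nn_integral_cong) (simp add: fc_fun ennreal_power)
    then show "(\<integral>\<^sup>+s. zsum (\<lambda>n. ennreal ((norm (nlc (fourier_coeff (f s)) n))\<^sup>2)) \<partial>M) < top"
      using mild_nlc_L2 [OF sol] by simp
    show "fourier_coeff (f t) n = of_real (exp (- (lam n * t))) * ?b n + duhc (\<lambda>s. nlc (fourier_coeff (f s))) t n" for n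
      unfolding fc [OF t] by (subst eq) (simp add: fc_fun cong: duhc_cong)
  qed
  from that [OF L4 D C L2] show ?thesis .
qed

lemma duhamel_well_posed:
  assumes "f0 \<in> Hdot (3 / 2)"
    and "x4 M (heat_maj (\<lambda>n. norm (fourier_coeff f0 n))) \<le> ennreal (1 / 36864)"
  shows "\<exists>f \<in> Lp_Hdot 4 I (9/4).
         (\<forall>t\<in>I. duhamel f0 f t) \<and>
         (\<forall>g \<in> Lp_Hdot 4 I (9/4).
            (AE t in lebesgue_on I. duhamel f0 g t) \<longrightarrow> (AE t in lebesgue_on I. g t = f t)) \<and>
         f \<in> C_Hdot I (3/2) \<inter> Lp_Hdot 2 I 3"
proof -
  obtain f where f: "f \<in> Lp_Hdot 4 I (9 / 4)" "\<And>t. t \<in> I \<Longrightarrow> duhamel f0 f t"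
    "f \<in> C_Hdot I (3 / 2)" "f \<in> Lp_Hdot 2 I 3"
    using duhamel_solution [OF assms] by blast
  have "AE t in M. duhamel f0 f t" by (rule AE_I2) (simp add: f(2))
  then have "AE t in M. g t = f t"
    if "g \<in> Lp_Hdot 4 I (9 / 4)" "AE t in M. duhamel f0 g t" for g
    using duhamel_unique [OF f(1) that(1) _ that(2)] by blast
  with f show ?thesis by blast
qed

end

section \<open>Smallness of the free evolution for short times and for small data\<close>

lemma time_interval_Icc: "0 \<le> T \<Longrightarrow> time_interval {0..T}"
  by unfold_locales auto

lemma time_interval_half_line: "time_interval {0..}"
  by unfold_locales auto

lemma Hdot_norm_zsum_lam:
  assumes "f0 \<in> Hdot (3 / 2)"
  shows "zsum (\<lambda>n. ennreal (lam n * (norm (fourier_coeff f0 n))\<^sup>2)) = ennreal ((Hdot_norm (3 / 2) f0)\<^sup>2)"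
  unfolding Hdot_norm_esq [OF assms] by (simp add: esq_eq lam_powr)

text \<open>The fourth power of the \<open>H^(9/4)\<close> norm of the free evolution is integrable
  on \<open>{0..1}\<close>, so its integral over short initial intervals tends to \<open>0\<close>.
  No rate in terms of the norm of \<open>f0\<close> is asserted.\<close>

lemma small_time:
  assumes f0: "f0 \<in> Hdot (3 / 2)"
  obtains T where "0 < T" "x4 (lebesgue_on {0..T}) (heat_maj (\<lambda>n. norm (fourier_coeff f0 n))) \<le> ennreal (1 / 36864)"
proof -
  let ?h = "heat_maj (\<lambda>n. norm (fourier_coeff f0 n))"
  interpret J: time_interval "{0..1}" by (rule time_interval_Icc) simp
  let ?M = "lebesgue_on {0..1 :: real}"
  let ?p = "\<lambda>t. (wsq wgt (?h t))\<^sup>2"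
  have "x4 ?M ?h \<le> (zsum (\<lambda>n. ennreal (lam n * (norm (fourier_coeff f0 n))\<^sup>2)))\<^sup>2"
    by (rule J.x4_heat_maj) simp
  also have "\<dots> < top" unfolding Hdot_norm_zsum_lam [OF f0] by (simp add: ennreal_power)
  finally have fin: "(\<integral>\<^sup>+t. ?p t \<partial>?M) < top" by (simp add: x4_def)
  have "?p \<in> borel_measurable ?M"
    unfolding power2_eq_square
    by (intro borel_measurable_times_ennreal wsq_measurable J.heat_maj_measurable)
  then obtain \<tau> where \<tau>: "0 < \<tau>" "(\<integral>\<^sup>+t. ?p t * indicator {0<..<\<tau>} t \<partial>?M) < ennreal (1 / 36864)"
    using J.short_interval_integral [OF _ fin, of "ennreal (1 / 36864)" 0] by auto
  \<comment> \<open>The closed interval has to lie in \<open>{0..1}\<close> and, up to the null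
    point \<open>0\<close>, in the open interval below \<open>\<tau>\<close>.\<close>
  define T where "T = min 1 (\<tau> / 2)"
  have T: "0 < T" "T \<le> 1" "T < \<tau>" using \<tau>(1) by (auto simp: T_def min_def)
  have "lebesgue_on {0..T} = restrict_space ?M {0..T}"
    using T by (intro J.initial_interval) simp
  then have "x4 (lebesgue_on {0..T}) ?h = (\<integral>\<^sup>+t. ?p t * indicator {0..T} t \<partial>?M)"
    unfolding x4_def using T J.initial_interval_sets [of T]
    by (simp only:) (rule nn_integral_restrict_space, simp)
  also have "\<dots> \<le> (\<integral>\<^sup>+t. ?p t * indicator {0<..<\<tau>} t \<partial>?M)"
    by (rule nn_integral_mono_AE, use J.AE_M_neq [of 0] in eventually_elim)
      (use T in \<open>auto simp: indicator_def\<close>)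
  finally show ?thesis using that [OF T(1)] \<tau>(2) by simp
qed

theorem theorem2p1:
  shows
   "(\<forall>f0 \<in> Hdot (3/2). \<exists>T>0.
       \<exists>f \<in> Lp_Hdot 4 {0..T} (9/4).
         (\<forall>t\<in>{0..T}. duhamel f0 f t) \<and>
         (\<forall>g \<in> Lp_Hdot 4 {0..T} (9/4).
            (AE t in lebesgue_on {0..T}. duhamel f0 g t) \<longrightarrow>
            (AE t in lebesgue_on {0..T}. g t = f t)) \<and>
         f \<in> C_Hdot {0..T} (3/2) \<inter> Lp_Hdot 2 {0..T} 3)
    \<and>
    (\<exists>\<epsilon>\<^sub>0>0. \<forall>f0 \<in> Hdot (3/2). Hdot_norm (3/2) f0 \<le> \<epsilon>\<^sub>0 \<longrightarrow>
       (\<exists>f \<in> Lp_Hdot 4 {0..} (9/4).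
         (\<forall>t\<in>{0..}. duhamel f0 f t) \<and>
         (\<forall>g \<in> Lp_Hdot 4 {0..} (9/4).
            (AE t in lebesgue_on {0..}. duhamel f0 g t) \<longrightarrow>
            (AE t in lebesgue_on {0..}. g t = f t)) \<and>
         f \<in> C_Hdot {0..} (3/2) \<inter> Lp_Hdot 2 {0..} 3))"
proof (rule conjI)
  show "\<forall>f0 \<in> Hdot (3/2). \<exists>T>0.
       \<exists>f \<in> Lp_Hdot 4 {0..T} (9/4).
         (\<forall>t\<in>{0..T}. duhamel f0 f t) \<and>
         (\<forall>g \<in> Lp_Hdot 4 {0..T} (9/4).
            (AE t in lebesgue_on {0..T}. duhamel f0 g t) \<longrightarrow>
            (AE t in lebesgue_on {0..T}. g t = f t)) \<and>
         f \<in> C_Hdot {0..T} (3/2) \<inter> Lp_Hdot 2 {0..T} 3"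
  proof
    fix f0 assume f0: "f0 \<in> Hdot (3/2)"
    obtain T where T: "0 < T"
      "x4 (lebesgue_on {0..T}) (heat_maj (\<lambda>n. norm (fourier_coeff f0 n))) \<le> ennreal (1 / 36864)"
      by (rule small_time [OF f0])
    have "time_interval {0..T}" using T(1) by (intro time_interval_Icc) simp
    from time_interval.duhamel_well_posed [OF this f0 T(2)] T(1)
    show "\<exists>T>0. \<exists>f \<in> Lp_Hdot 4 {0..T} (9/4).
         (\<forall>t\<in>{0..T}. duhamel f0 f t) \<and>
         (\<forall>g \<in> Lp_Hdot 4 {0..T} (9/4).
            (AE t in lebesgue_on {0..T}. duhamel f0 g t) \<longrightarrow>
            (AE t in lebesgue_on {0..T}. g t = f t)) \<and>
         f \<in> C_Hdot {0..T} (3/2) \<inter> Lp_Hdot 2 {0..T} 3" by blast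
  qed
  \<comment> \<open>\<open>14^4 = 38416\<close> exceeds \<open>36864\<close>, so the fourth power of
    \<open>1 / 14\<close> lies below the threshold of \<open>x4_majorant\<close>.\<close>
  have small: "x4 (lebesgue_on {0..}) (heat_maj (\<lambda>n. norm (fourier_coeff f0 n))) \<le> ennreal (1 / 36864)"
    if f0: "f0 \<in> Hdot (3/2)" and le: "Hdot_norm (3/2) f0 \<le> 1 / 14" for f0
  proof -
    have "x4 (lebesgue_on {0..}) (heat_maj (\<lambda>n. norm (fourier_coeff f0 n))) \<le>
        (zsum (\<lambda>n. ennreal (lam n * (norm (fourier_coeff f0 n))\<^sup>2)))\<^sup>2"
      by (rule time_interval.x4_heat_maj [OF time_interval_half_line]) simp
    also have "\<dots> = ennreal (Hdot_norm (3/2) f0 ^ 4)"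
      unfolding Hdot_norm_zsum_lam [OF f0] by (simp add: ennreal_power flip: power_mult)
    also have "\<dots> \<le> ennreal ((1 / 14) ^ 4)"
      by (intro ennreal_leI power_mono le Hdot_norm_nonneg)
    also have "\<dots> \<le> ennreal (1 / 36864)"
      by (intro ennreal_leI) (simp add: power_divide)
    finally show ?thesis .
  qed
  show "\<exists>\<epsilon>\<^sub>0>0. \<forall>f0 \<in> Hdot (3/2). Hdot_norm (3/2) f0 \<le> \<epsilon>\<^sub>0 \<longrightarrow>
       (\<exists>f \<in> Lp_Hdot 4 {0..} (9/4).
         (\<forall>t\<in>{0..}. duhamel f0 f t) \<and>
         (\<forall>g \<in> Lp_Hdot 4 {0..} (9/4).
            (AE t in lebesgue_on {0..}. duhamel f0 g t) \<longrightarrow>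
            (AE t in lebesgue_on {0..}. g t = f t)) \<and>
         f \<in> C_Hdot {0..} (3/2) \<inter> Lp_Hdot 2 {0..} 3)"
  proof (rule exI [of _ "1 / 14"], intro conjI ballI impI)
    fix f0 assume "f0 \<in> Hdot (3/2)" "Hdot_norm (3/2) f0 \<le> 1 / 14"
    then show "\<exists>f \<in> Lp_Hdot 4 {0..} (9/4).
         (\<forall>t\<in>{0..}. duhamel f0 f t) \<and>
         (\<forall>g \<in> Lp_Hdot 4 {0..} (9/4).
            (AE t in lebesgue_on {0..}. duhamel f0 g t) \<longrightarrow>
            (AE t in lebesgue_on {0..}. g t = f t)) \<and>
         f \<in> C_Hdot {0..} (3/2) \<inter> Lp_Hdot 2 {0..} 3"
      by (intro time_interval.duhamel_well_posed [OF time_interval_half_line] small)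
  qed simp
qed


end
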